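(* If the problem of deciding whether a cubic polynomial has any second-order points is in P (resp. in NP), then the SDP Feasibility Problem (SDPF) is in P (resp. in NP).
   Context: A cubic polynomial is a real polynomial all of whose monomials have degree at most 3; in the decision problem, the input is a cubic polynomial in $n$ variables ($n$ part of the input) with rational coefficients. A second-order point of $p$ is a point $x\in\mathbb{R}^n$ with $\nabla p(x)=0$ and $\nabla^2 p(x)\succeq 0$. SDPF is the decision problem: given $m\times m$ symmetric matrices $A_0,\ldots,A_n$ with rational entries, decide whether there exists $x\in\mathbb{R}^n$ such that $A_0+\sum_{i=1}^n x_iA_i\succeq 0$ (positive semidefinite). Complexity is in the Turing model with respect to the bit length of the input. *)

theory Defs
  imports
    "HOL-Analysis.Analysis"
    "HOL-Computational_Algebra.Polynomial"
    "Jordan_Normal_Form.Matrix"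
begin

unbundle no vec_syntax
unbundle no inner_syntax

text \<open>
  A machine works on a fixed number of two-way infinite tapes. States and symbols are natural
  numbers. A transition \<open>(q, as, q', bs)\<close> may be taken in state \<open>q\<close> when the \<open>k\<close> heads read the
  symbols \<open>as\<close>; it leads to state \<open>q'\<close>, and \<open>bs\<close> gives, tape by tape, the symbol that is written and
  the move of the head. The set of transitions is finite, so only finitely many states and symbols
  occur in it. There is no separate reject state: a machine halts when no transition applies.
\<close>

datatype move = Left | Stay | Right

type_synonym transition = "nat \<times> nat list \<times> nat \<times> (nat \<times> move) list"

record tm =
  num_tapes :: nat
  start_state :: nat
  accept_state :: nat
  transitions :: "transition set"

definition wf_tm :: "tm \<Rightarrow> bool" where
  "wf_tm M \<longleftrightarrow> num_tapes M \<ge> 1 \<and> finite (transitions M) \<and>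
    (\<forall>(q, as, q', bs) \<in> transitions M. length as = num_tapes M \<and> length bs = num_tapes M)"

definition deterministic :: "tm \<Rightarrow> bool" where
  "deterministic M \<longleftrightarrow>
    (\<forall>q as q1 bs1 q2 bs2. (q, as, q1, bs1) \<in> transitions M \<longrightarrow> (q, as, q2, bs2) \<in> transitions M \<longrightarrow>
      q1 = q2 \<and> bs1 = bs2)"

text \<open>A tape is given by the position of its head and its contents; the blank is \<open>0\<close>.\<close>

type_synonym tape = "int \<times> (int \<Rightarrow> nat)"

type_synonym config = "nat \<times> tape list"

fun read_tape :: "tape \<Rightarrow> nat" where
  "read_tape (h, f) = f h"

fun offset :: "move \<Rightarrow> int" where
  "offset Left = - 1"
| "offset Stay = 0"
| "offset Right = 1"

fun act_tape :: "nat \<times> move \<Rightarrow> tape \<Rightarrow> tape" where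
  "act_tape (a, d) (h, f) = (h + offset d, f(h := a))"

definition step :: "tm \<Rightarrow> config \<Rightarrow> config \<Rightarrow> bool" where
  "step M c c' \<longleftrightarrow> (\<exists>q ts q' bs. c = (q, ts) \<and> (q, map read_tape ts, q', bs) \<in> transitions M \<and>
    c' = (q', map2 act_tape bs ts))"

definition input_tape :: "bool list \<Rightarrow> tape" where
  "input_tape w = (0, \<lambda>i. if 0 \<le> i \<and> i < int (length w) then (if w ! nat i then 2 else 1) else 0)"

definition init_config :: "tm \<Rightarrow> bool list \<Rightarrow> config" where
  "init_config M w = (start_state M, input_tape w # replicate (num_tapes M - 1) (0, \<lambda>i. 0))"

definition accepts :: "tm \<Rightarrow> bool list \<Rightarrow> bool" where
  "accepts M w \<longleftrightarrow> (\<exists>c. (step M)\<^sup>*\<^sup>* (init_config M w) c \<and>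
    fst c = accept_state M \<and> (\<nexists>c'. step M c c'))"

text \<open>Every computation (not only the accepting ones) halts within the time bound.\<close>

definition decides_in_polytime :: "tm \<Rightarrow> bool list set \<Rightarrow> bool" where
  "decides_in_polytime M L \<longleftrightarrow>
    (\<forall>w. accepts M w \<longleftrightarrow> w \<in> L) \<and>
    (\<exists>T :: nat poly. \<forall>w t c. (step M ^^ t) (init_config M w) c \<longrightarrow> t \<le> poly T (length w))"

definition class_P :: "bool list set set" where
  "class_P = {L. \<exists>M. wf_tm M \<and> deterministic M \<and> decides_in_polytime M L}"

definition class_NP :: "bool list set set" where
  "class_NP = {L. \<exists>M. wf_tm M \<and> decides_in_polytime M L}"

text \<open>
  Instances are written as bracketed expressions over the four symbols \<open>0\<close>, \<open>1\<close>, \<open>(\<close>, \<open>)\<close>, each of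
  which takes two bits. All numbers are in binary, most significant digit first.
\<close>

definition enc_bit :: "bool \<Rightarrow> bool list" where
  "enc_bit b = [False, b]"

definition bracket :: "bool list \<Rightarrow> bool list" where
  "bracket w = [True, False] @ w @ [True, True]"

definition enc_list :: "('a \<Rightarrow> bool list) \<Rightarrow> 'a list \<Rightarrow> bool list" where
  "enc_list e xs = bracket (concat (map e xs))"

fun binary :: "nat \<Rightarrow> bool list" where
  "binary n = (if n = 0 then [] else binary (n div 2) @ [odd n])"

declare binary.simps [simp del]

definition enc_nat :: "nat \<Rightarrow> bool list" where
  "enc_nat n = enc_list enc_bit (binary n)"

definition enc_int :: "int \<Rightarrow> bool list" where
  "enc_int z = enc_list enc_bit ((z < 0) # binary (nat \<bar>z\<bar>))"

definition enc_rat :: "rat \<Rightarrow> bool list" where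
  "enc_rat r = (case quotient_of r of (p, q) \<Rightarrow> bracket (enc_int p @ enc_nat (nat q)))"

definition enc_mat :: "rat mat \<Rightarrow> bool list" where
  "enc_mat A = enc_list (enc_list enc_rat) (mat_to_list A)"

definition psd :: "nat \<Rightarrow> real mat \<Rightarrow> bool" where
  "psd n A \<longleftrightarrow> A \<in> carrier_mat n n \<and> A\<^sup>T = A \<and> (\<forall>v \<in> carrier_vec n. v \<bullet> (A *\<^sub>v v) \<ge> 0)"

definition sym_rat_mat :: "nat \<Rightarrow> rat mat \<Rightarrow> bool" where
  "sym_rat_mat m A \<longleftrightarrow> A \<in> carrier_mat m m \<and> A\<^sup>T = A"

text \<open>The matrix \<open>A\<^sub>0 + \<Sum>i. x\<^sub>i A\<^sub>i\<close>; the list \<open>As\<close> consists of \<open>A\<^sub>1, \<dots>, A\<^sub>n\<close>.\<close>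

definition lin_mat :: "nat \<Rightarrow> rat mat \<Rightarrow> rat mat list \<Rightarrow> real vec \<Rightarrow> real mat" where
  "lin_mat m A0 As x = mat m m (\<lambda>(r, s).
    of_rat (A0 $$ (r, s)) + (\<Sum>i<length As. x $ i * of_rat ((As ! i) $$ (r, s))))"

definition SDPF :: "bool list set" where
  "SDPF = {enc_list enc_mat (A0 # As) | m A0 As.
    (\<forall>A \<in> set (A0 # As). sym_rat_mat m A) \<and>
    (\<exists>x \<in> carrier_vec (length As). psd m (lin_mat m A0 As x))}"

text \<open>
  A polynomial in \<open>n\<close> variables with rational coefficients is given in sparse form, as a list of
  terms, whose sum it is. A term consists of a coefficient and the vector of the \<open>n\<close> exponents of
  the monomial; the order of the terms is arbitrary, and a monomial may occur in several of them.
\<close>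

type_synonym poly_term = "rat \<times> nat list"

definition cubic_terms :: "nat \<Rightarrow> poly_term list \<Rightarrow> bool" where
  "cubic_terms n ps \<longleftrightarrow> (\<forall>(c, es) \<in> set ps. length es = n \<and> sum_list es \<le> 3)"

definition eval_terms :: "nat \<Rightarrow> poly_term list \<Rightarrow> real vec \<Rightarrow> real" where
  "eval_terms n ps x = (\<Sum>(c, es) \<leftarrow> ps. of_rat c * (\<Prod>i<n. x $ i ^ (es ! i)))"

definition partial :: "nat \<Rightarrow> nat \<Rightarrow> (real vec \<Rightarrow> real) \<Rightarrow> real vec \<Rightarrow> real" where
  "partial n i f x = deriv (\<lambda>t. f (x + t \<cdot>\<^sub>v unit_vec n i)) 0"

definition gradient :: "nat \<Rightarrow> (real vec \<Rightarrow> real) \<Rightarrow> real vec \<Rightarrow> real vec" where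
  "gradient n f x = vec n (\<lambda>i. partial n i f x)"

definition hessian :: "nat \<Rightarrow> (real vec \<Rightarrow> real) \<Rightarrow> real vec \<Rightarrow> real mat" where
  "hessian n f x = mat n n (\<lambda>(i, j). partial n i (partial n j f) x)"

definition second_order_point :: "nat \<Rightarrow> (real vec \<Rightarrow> real) \<Rightarrow> real vec \<Rightarrow> bool" where
  "second_order_point n f x \<longleftrightarrow>
    x \<in> carrier_vec n \<and> gradient n f x = 0\<^sub>v n \<and> psd n (hessian n f x)"

definition enc_term :: "poly_term \<Rightarrow> bool list" where
  "enc_term t = bracket (enc_rat (fst t) @ enc_list enc_nat (snd t))"

text \<open>The number of variables is written in unary, in front of the list of terms.\<close>

definition enc_poly :: "nat \<Rightarrow> poly_term list \<Rightarrow> bool list" where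
  "enc_poly n ps = bracket (enc_list enc_bit (replicate n True) @ enc_list enc_term ps)"

definition CUBIC_SOP :: "bool list set" where
  "CUBIC_SOP = {enc_poly n ps | n ps.
    cubic_terms n ps \<and> (\<exists>x. second_order_point n (eval_terms n ps) x)}"

end

theory Submission
  imports Defs
begin

text \<open>
  To the matrices \<open>A\<^sub>0, \<dots>, A\<^sub>n\<close> one associates the cubic polynomial
  \<open>e\<^sup>2 + 2 e + \<Sum>\<^sub>i\<^sub>r\<^sub>s A\<^sub>i\<^sub>r\<^sub>s (x\<^sub>i y\<^sub>r y\<^sub>s + g\<^sub>i a\<^sub>r\<^sub>s + e g\<^sub>i a\<^sub>s\<^sub>r)\<close> with \<open>x\<^sub>0 := 1\<close>. At a second-order point the
  block of the Hessian for \<open>y\<close> is twice \<open>A\<^sub>0 + \<Sum>\<^sub>i x\<^sub>i A\<^sub>i\<close>, so this matrix is positive semidefinite. The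
  variables \<open>e, g, a\<close> force the \<open>A\<^sub>i\<close> to be symmetric: the Hessian has zeros on the diagonal at \<open>g\<close>, so
  its rows at \<open>g\<close> vanish; the entries at \<open>(g\<^sub>i, e)\<close> then make the derivative in \<open>e\<close> equal to \<open>2 e + 2\<close>, hence
  \<open>e = -1\<close>, and the entries at \<open>(g\<^sub>i, a\<^sub>r\<^sub>s)\<close> are \<open>A\<^sub>i\<^sub>r\<^sub>s - A\<^sub>i\<^sub>s\<^sub>r\<close>. Conversely, a feasible \<open>x\<close> gives the
  second-order point with \<open>e = -1\<close> and \<open>g = y = a = 0\<close>.

  The polynomial is computed by a structured program that is compiled to the transitions of a Turing
  machine and runs before the given machine for cubic polynomials; its output tape is the input tape of
  that machine. The program itself checks only the bracket structure and that the matrices are square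
  of equal size.
\<close>

section \<open>Structured programs on tapes\<close>

text \<open>The Hessian of a polynomial only sees \<open>A_i + A_i^T\<close>, so the monomials in
  \<open>x\<close> and \<open>y\<close> cannot distinguish a symmetric instance from one that is
  not, while \<open>SDPF\<close> contains symmetric ones only. Comparing the entries at
  \<open>(r,s)\<close> and \<open>(s,r)\<close> on a tape would mean addressing two distant places;
  the program instead processes the entries once, in order, and copies each coefficient verbatim. So
  the symmetry test is left to the polynomial. It needs the difference \<open>A_irs - A_isr\<close>,
  but a copied coefficient cannot change its sign: the sign comes from the variable
  \<open>e\<close>, and \<open>e^2 + 2 e\<close> is there to pin \<open>e\<close> to
  \<open>-1\<close>. The part in \<open>x\<close> and \<open>y\<close> adds no constraint to the
  gradient at \<open>y = 0\<close>, as each of its derivatives has a factor \<open>y_r\<close>; what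
  remains is the semidefiniteness of the block for \<open>y\<close>. The added code runs
  deterministically and then hands over to the given machine, whose choices are preserved. Hence one
  construction serves P and NP.\<close>

datatype tname = Inp | Tok | Mode | Flag | Mats | Rows | Cols | Out

definition names :: "tname list" where
  "names = [Inp, Tok, Mode, Flag, Mats, Rows, Cols, Out]"

lemma UNIV_tname: "UNIV = {Inp, Tok, Mode, Flag, Mats, Rows, Cols, Out}"
  using tname.exhaust by blast

lemma set_names: "set names = UNIV"
  by (auto simp: names_def UNIV_tname)

type_synonym store = "tname \<Rightarrow> tape"
type_synonym action = "tname \<Rightarrow> nat \<times> move"

datatype com =
  Act "(tname \<Rightarrow> nat) \<Rightarrow> action option"
| Seq com com (infixr ";;" 60)
| Cond "(tname \<Rightarrow> nat) \<Rightarrow> bool" com com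
| While "(tname \<Rightarrow> nat) \<Rightarrow> bool" com

definition reads :: "store \<Rightarrow> tname \<Rightarrow> nat" where
  "reads \<sigma> k = read_tape (\<sigma> k)"

definition perform :: "action \<Rightarrow> store \<Rightarrow> store" where
  "perform a \<sigma> k = act_tape (a k) (\<sigma> k)"

definition keep :: "(tname \<Rightarrow> nat) \<Rightarrow> action" where
  "keep r k = (r k, Stay)"

lemma perform_keep [simp]: "perform (keep (reads \<sigma>)) \<sigma> = \<sigma>"
proof
  show "perform (keep (reads \<sigma>)) \<sigma> k = \<sigma> k" for k
    by (cases "\<sigma> k") (simp add: perform_def keep_def reads_def)
qed

text \<open>\<open>exec c \<sigma> n r\<close>: run from \<open>\<sigma>\<close>, the program \<open>c\<close> ends after \<open>n\<close> steps, in the store \<open>r\<close> or,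
  when \<open>r\<close> is \<open>None\<close>, by getting stuck, which is how a program rejects.\<close>

inductive exec :: "com \<Rightarrow> store \<Rightarrow> nat \<Rightarrow> store option \<Rightarrow> bool" where
  act: "g (reads \<sigma>) = Some a \<Longrightarrow> exec (Act g) \<sigma> 1 (Some (perform a \<sigma>))"
| act_stuck: "g (reads \<sigma>) = None \<Longrightarrow> exec (Act g) \<sigma> 0 None"
| seq: "exec c \<sigma> n (Some \<sigma>') \<Longrightarrow> exec d \<sigma>' n' r \<Longrightarrow> exec (c ;; d) \<sigma> (n + n') r"
| seq_stuck: "exec c \<sigma> n None \<Longrightarrow> exec (c ;; d) \<sigma> n None"
| cond_true: "b (reads \<sigma>) \<Longrightarrow> exec c \<sigma> n r \<Longrightarrow> exec (Cond b c d) \<sigma> (Suc n) r"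
| cond_false: "\<not> b (reads \<sigma>) \<Longrightarrow> exec d \<sigma> n r \<Longrightarrow> exec (Cond b c d) \<sigma> (Suc n) r"
| while_done: "\<not> b (reads \<sigma>) \<Longrightarrow> exec (While b c) \<sigma> 1 (Some \<sigma>)"
| while_step: "b (reads \<sigma>) \<Longrightarrow> exec c \<sigma> n (Some \<sigma>') \<Longrightarrow> exec (While b c) \<sigma>' n' r \<Longrightarrow>
    exec (While b c) \<sigma> (Suc (n + n')) r"
| while_stuck: "b (reads \<sigma>) \<Longrightarrow> exec c \<sigma> n None \<Longrightarrow> exec (While b c) \<sigma> (Suc n) None"

section \<open>Compilation to addressed code\<close>

type_synonym instr = "(tname \<Rightarrow> nat) \<Rightarrow> (nat \<times> action) option"

fun len :: "com \<Rightarrow> nat" where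
  "len (Act g) = 1"
| "len (c ;; d) = len c + len d"
| "len (Cond b c d) = Suc (len c + len d)"
| "len (While b c) = Suc (len c)"

text \<open>\<open>compile c p e\<close> is the code of \<open>c\<close> placed at address \<open>p\<close>, with exit to address \<open>e\<close>.\<close>

fun compile :: "com \<Rightarrow> nat \<Rightarrow> nat \<Rightarrow> instr list" where
  "compile (Act g) p e = [\<lambda>r. map_option (Pair e) (g r)]"
| "compile (c ;; d) p e = compile c p (p + len c) @ compile d (p + len c) e"
| "compile (Cond b c d) p e = (\<lambda>r. Some (if b r then Suc p else Suc p + len c, keep r)) #
     compile c (Suc p) e @ compile d (Suc p + len c) e"
| "compile (While b c) p e = (\<lambda>r. Some (if b r then Suc p else e, keep r)) # compile c (Suc p) p"

lemma length_compile [simp]: "length (compile c p e) = len c"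
  by (induction c arbitrary: p e) auto

definition code_at :: "instr list \<Rightarrow> nat \<Rightarrow> instr list \<Rightarrow> bool" where
  "code_at P p is \<longleftrightarrow> (\<exists>xs ys. P = xs @ is @ ys \<and> length xs = p)"

lemma code_at_append:
  "code_at P p (xs @ ys) \<longleftrightarrow> code_at P p xs \<and> code_at P (p + length xs) ys"
proof
  assume "code_at P p (xs @ ys)"
  then obtain a b where "P = a @ xs @ (ys @ b)" "P = (a @ xs) @ ys @ b" "length a = p"
    unfolding code_at_def by auto
  then show "code_at P p xs \<and> code_at P (p + length xs) ys"
    unfolding code_at_def by (metis length_append)
next
  assume "code_at P p xs \<and> code_at P (p + length xs) ys"
  then obtain a b c d where *: "P = a @ xs @ b" "length a = p" "P = c @ ys @ d" "length c = p + length xs"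
    unfolding code_at_def by blast
  then have "(a @ xs) @ b = c @ (ys @ d)" by simp
  then have "b = ys @ d" using * by (metis append_eq_append_conv length_append)
  then show "code_at P p (xs @ ys)" using * unfolding code_at_def by auto
qed

lemma code_at_single: "code_at P p [x] \<longleftrightarrow> p < length P \<and> P ! p = x"
proof
  assume "p < length P \<and> P ! p = x"
  then have "P = take p P @ [x] @ drop (Suc p) P" "length (take p P) = p"
    using id_take_nth_drop[of p P] by auto
  then show "code_at P p [x]" unfolding code_at_def by blast
qed (auto simp: code_at_def)

lemma code_at_Cons:
  "code_at P p (x # xs) \<longleftrightarrow> p < length P \<and> P ! p = x \<and> code_at P (Suc p) xs"
  using code_at_append[of P p "[x]" xs] by (simp add: code_at_single)

section \<open>Forced runs and correctness of the compiled code\<close>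

definition cstep :: "instr list \<Rightarrow> nat \<times> store \<Rightarrow> (nat \<times> store) option" where
  "cstep P = (\<lambda>(p, \<sigma>). if p < length P then
     map_option (\<lambda>(p', a). (p', perform a \<sigma>)) ((P ! p) (reads \<sigma>)) else None)"

text \<open>Each step is required to be the only possible one. Reachability in \<open>n\<close>
  steps would not do: for a nondeterministic machine, time bound and acceptance concern all
  computations, and each of them has to begin with the run of the program.\<close>

fun forced :: "('a \<Rightarrow> 'a \<Rightarrow> bool) \<Rightarrow> nat \<Rightarrow> 'a \<Rightarrow> 'a \<Rightarrow> bool" where
  "forced R 0 c d \<longleftrightarrow> c = d"
| "forced R (Suc n) c d \<longleftrightarrow> (\<exists>c1. (\<forall>c'. R c c' \<longleftrightarrow> c' = c1) \<and> forced R n c1 d)"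

lemma forced_add: "forced R n c d \<Longrightarrow> forced R n' d e \<Longrightarrow> forced R (n + n') c e"
  by (induction n arbitrary: c) auto

text \<open>The dichotomy used for the composed machine: a computation either is still inside the
  forced part, where it can be continued and so has not halted, or has passed through
  \<open>d\<close>, and its remainder is a computation from \<open>d\<close>.\<close>

lemma forced_relpowp:
  assumes "forced R n c d" and "(R ^^ t) c e"
  shows "t < n \<and> (\<exists>e'. R e e') \<or> n \<le> t \<and> (R ^^ (t - n)) d e"
  using assms
proof (induction n arbitrary: c t)
  case (Suc n)
  then obtain c1 where c1: "\<And>c'. R c c' \<longleftrightarrow> c' = c1" "forced R n c1 d" by auto
  show ?case
  proof (cases t)
    case 0
    then show ?thesis using Suc.prems c1 by auto
  next
    case (Suc t')
    then have "(R ^^ t') c1 e"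
      using Suc.prems(2) c1 by (metis relpowp_Suc_D2)
    from Suc.IH[OF c1(2) this] Suc show ?thesis by auto
  qed
qed auto

lemma forced_relpowp_self: "forced R n c d \<Longrightarrow> (R ^^ n) c d"
proof (induction n arbitrary: c)
  case (Suc n)
  then obtain c1 where "R c c1" "(R ^^ n) c1 d" by auto
  then show ?case by (rule relpowp_Suc_I2)
qed auto

abbreviation cforced :: "instr list \<Rightarrow> nat \<Rightarrow> nat \<times> store \<Rightarrow> nat \<times> store \<Rightarrow> bool" where
  "cforced P \<equiv> forced (\<lambda>c d. cstep P c = Some d)"

lemma cforced_1: "cstep P c = Some d \<Longrightarrow> cforced P (Suc 0) c d"
  unfolding forced.simps by (intro exI[of _ d]) auto

lemma cforced_Suc: "cstep P c = Some c1 \<Longrightarrow> cforced P n c1 d \<Longrightarrow> cforced P (Suc n) c d"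
  unfolding forced.simps(2) by (intro exI[of _ c1]) auto

text \<open>A rejecting run has to stop strictly inside \<open>P\<close>. At the address
  \<open>length P\<close>, where \<open>cstep\<close> is undefined as well, the second machine takes
  over.\<close>

definition reaches :: "instr list \<Rightarrow> nat \<Rightarrow> nat \<times> store \<Rightarrow> nat \<Rightarrow> store option \<Rightarrow> bool" where
  "reaches P n s e r = (case r of Some \<sigma>' \<Rightarrow> cforced P n s (e, \<sigma>')
    | None \<Rightarrow> \<exists>s'. cforced P n s s' \<and> fst s' < length P \<and> cstep P s' = None)"

lemma reaches_add:
  assumes "cforced P n s s1" and "reaches P n' s1 e r"
  shows "reaches P (n + n') s e r"
proof (cases r)
  case None
  then obtain s' where "cforced P n' s1 s'" "fst s' < length P" "cstep P s' = None"
    using assms(2) unfolding reaches_def by auto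
  moreover from forced_add[OF assms(1) this(1)] have "cforced P (n + n') s s'" .
  ultimately show ?thesis unfolding reaches_def None option.case by (intro exI[of _ s'] conjI)
next
  case (Some \<sigma>)
  then show ?thesis using assms forced_add[OF assms(1)] by (simp add: reaches_def)
qed

lemma reaches_None: "reaches P n s e None \<longleftrightarrow> reaches P n s e' None"
  by (simp add: reaches_def)

lemma reaches_Suc: "cstep P s = Some s1 \<Longrightarrow> reaches P n s1 e r \<Longrightarrow> reaches P (Suc n) s e r"
  using reaches_add[OF cforced_1] by simp

text \<open>A subprogram runs in place, hence the arbitrary surrounding code \<open>P\<close> and
  the arbitrary addresses. The step counts agree exactly: only the tests of \<open>Cond\<close> and
  \<open>While\<close> cost an instruction of their own, whereas sequencing and the jump back of a
  loop are done by exit addresses.\<close>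

lemma compile_correct:
  assumes "exec c \<sigma> n r" and "code_at P p (compile c p e)"
  shows "reaches P n (p, \<sigma>) e r"
  using assms
proof (induction arbitrary: p e rule: exec.induct)
  case (act g \<sigma> a)
  then have "cstep P (p, \<sigma>) = Some (e, perform a \<sigma>)" by (auto simp: code_at_single cstep_def)
  then show ?case by (simp add: reaches_def cforced_1 del: forced.simps)
next
  case (act_stuck g \<sigma>)
  then have "p < length P" "cstep P (p, \<sigma>) = None" by (auto simp: code_at_single cstep_def)
  then show ?case unfolding reaches_def option.case forced.simps(1) by auto
next
  case (seq c \<sigma> n \<sigma>' d n' r)
  have 1: "cforced P n (p, \<sigma>) (p + len c, \<sigma>')"
    using seq.IH(1)[of p "p + len c"] seq.prems by (simp add: code_at_append reaches_def)
  have 2: "code_at P (p + len c) (compile d (p + len c) e)"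
    using seq.prems by (simp add: code_at_append)
  show ?case
    using reaches_add[OF 1 seq.IH(2)[OF 2]] .
next
  case (seq_stuck c \<sigma> n d)
  then show ?case by (metis code_at_append reaches_None compile.simps(2) length_compile)
next
  case (cond_true b \<sigma> c n r d)
  have 1: "cstep P (p, \<sigma>) = Some (Suc p, \<sigma>)"
    using cond_true by (simp add: code_at_Cons cstep_def)
  have 2: "code_at P (Suc p) (compile c (Suc p) e)"
    using cond_true.prems by (simp add: code_at_Cons code_at_append)
  show ?case
    using reaches_Suc[OF 1 cond_true.IH[OF 2]] .
next
  case (cond_false b \<sigma> d n r c)
  have 1: "cstep P (p, \<sigma>) = Some (Suc p + len c, \<sigma>)"
    using cond_false by (simp add: code_at_Cons cstep_def)
  have 2: "code_at P (Suc p + len c) (compile d (Suc p + len c) e)"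
    using cond_false.prems by (simp add: code_at_Cons code_at_append)
  show ?case
    using reaches_Suc[OF 1 cond_false.IH[OF 2]] .
next
  case (while_done b \<sigma> c)
  then have "cstep P (p, \<sigma>) = Some (e, \<sigma>)" by (simp add: code_at_Cons cstep_def)
  then show ?case by (simp add: reaches_def cforced_1 del: forced.simps)
next
  case (while_step b \<sigma> c n \<sigma>' n' r)
  have 1: "cstep P (p, \<sigma>) = Some (Suc p, \<sigma>)"
    using while_step by (simp add: code_at_Cons cstep_def)
  have 2: "code_at P (Suc p) (compile c (Suc p) p)"
    using while_step.prems by (simp add: code_at_Cons)
  have "cforced P n (Suc p, \<sigma>) (p, \<sigma>')"
    using while_step.IH(1)[OF 2] by (simp add: reaches_def)
  from cforced_Suc[OF 1 this] have 3: "cforced P (Suc n) (p, \<sigma>) (p, \<sigma>')" .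
  show ?case
    using reaches_add[OF 3 while_step.IH(2)[OF while_step.prems]] by simp
next
  case (while_stuck b \<sigma> c n)
  have 1: "cstep P (p, \<sigma>) = Some (Suc p, \<sigma>)"
    using while_stuck by (simp add: code_at_Cons cstep_def)
  have 2: "code_at P (Suc p) (compile c (Suc p) p)"
    using while_stuck.prems by (simp add: code_at_Cons)
  show ?case
    using reaches_Suc[OF 1 while_stuck.IH[OF 2]] reaches_None by blast
qed

text \<open>Programs are functions of arbitrary symbols, whereas a machine has finitely many
  transitions. If symbols below \<open>A\<close> only lead to writing symbols below
  \<open>A\<close>, it is enough to tabulate the instructions on these.\<close>

fun bounded_com :: "nat \<Rightarrow> com \<Rightarrow> bool" where
  "bounded_com A (Act g) \<longleftrightarrow> (\<forall>r a k. (\<forall>k. r k < A) \<longrightarrow> g r = Some a \<longrightarrow> fst (a k) < A)"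
| "bounded_com A (c ;; d) \<longleftrightarrow> bounded_com A c \<and> bounded_com A d"
| "bounded_com A (Cond b c d) \<longleftrightarrow> bounded_com A c \<and> bounded_com A d"
| "bounded_com A (While b c) \<longleftrightarrow> bounded_com A c"

definition bounded_code :: "nat \<Rightarrow> instr list \<Rightarrow> bool" where
  "bounded_code A P \<longleftrightarrow>
    (\<forall>i\<in>set P. \<forall>r p a k. (\<forall>k. r k < A) \<longrightarrow> i r = Some (p, a) \<longrightarrow> fst (a k) < A)"

lemma bounded_compile: "bounded_com A c \<Longrightarrow> bounded_code A (compile c p e)"
  by (induction c arbitrary: p e) (auto simp: bounded_code_def keep_def)

definition bounded_store :: "nat \<Rightarrow> store \<Rightarrow> bool" where
  "bounded_store A \<sigma> \<longleftrightarrow> (\<forall>k i. snd (\<sigma> k) i < A)"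

lemma reads_bounded: "bounded_store A \<sigma> \<Longrightarrow> reads \<sigma> k < A"
  by (metis bounded_store_def prod.collapse read_tape.simps reads_def)

lemma bounded_store_perform:
  assumes "bounded_store A \<sigma>" and "\<And>k. fst (a k) < A"
  shows "bounded_store A (perform a \<sigma>)"
  unfolding bounded_store_def perform_def
proof (intro allI)
  fix k i
  show "snd (act_tape (a k) (\<sigma> k)) i < A"
    using assms(1)[unfolded bounded_store_def, rule_format, of k i] assms(2)[of k]
    by (cases "a k"; cases "\<sigma> k") auto
qed

lemma cstep_bounded:
  assumes "bounded_code A P" "bounded_store A \<sigma>" "cstep P (p, \<sigma>) = Some (p', \<sigma>')"
  shows "bounded_store A \<sigma>'"
proof -
  from assms(3) obtain a where p: "p < length P" and a: "(P ! p) (reads \<sigma>) = Some (p', a)"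
    and s: "\<sigma>' = perform a \<sigma>"
    by (auto simp: cstep_def split: if_splits)
  have "fst (a k) < A" for k
    using assms(1) a p reads_bounded[OF assms(2)] unfolding bounded_code_def by (meson nth_mem)
  with s bounded_store_perform[OF assms(2)] show ?thesis by simp
qed

section \<open>The composed Turing machine\<close>

definition blank_tape :: tape where
  "blank_tape = (0, \<lambda>i. 0)"

text \<open>The last \<open>e\<close> tapes are the work tapes of the second machine. They are blank
  while the code runs, so transitions that read \<open>0\<close> there suffice.\<close>

definition code_transitions :: "nat \<Rightarrow> instr list \<Rightarrow> nat \<Rightarrow> transition set" where
  "code_transitions A P e = {(p, map r names @ replicate e 0, p', map a names @ replicate e (0, Stay)) | p r p' a.
    p < length P \<and> (\<forall>k. r k < A) \<and> (P ! p) r = Some (p', a)}"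

text \<open>The start state is sent to the exit address of the code, so that the hand-over costs no
  step; all other states are moved above it.\<close>

definition embed_state :: "tm \<Rightarrow> nat \<Rightarrow> nat \<Rightarrow> nat" where
  "embed_state M l q = (if q = start_state M then l else Suc (l + q))"

lemma embed_state_inj: "embed_state M l q = embed_state M l q' \<longleftrightarrow> q = q'"
  by (auto simp: embed_state_def)

lemma embed_state_ge: "l \<le> embed_state M l q"
  by (auto simp: embed_state_def)

lemma embed_state_not_less [simp]: "\<not> embed_state M l q < l"
  by (auto simp: embed_state_def)

text \<open>After the code has run, its seven private tapes have unknown contents. A transition of
  \<open>M\<close> is therefore repeated for every reading \<open>pre\<close> of them, which it
  writes back without moving.\<close>

definition tail_transitions :: "nat \<Rightarrow> tm \<Rightarrow> nat \<Rightarrow> transition set" where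
  "tail_transitions A M l = {(embed_state M l q, pre @ as, embed_state M l q', map (\<lambda>a. (a, Stay)) pre @ bs) | q as q' bs pre.
    (q, as, q', bs) \<in> transitions M \<and> length pre = 7 \<and> set pre \<subseteq> {..<A}}"

text \<open>The machine runs the code \<open>P\<close> on its first eight tapes, and then \<open>M\<close>, for which the last of
  these, \<open>Out\<close>, is the input tape.\<close>

definition prefix_tm :: "nat \<Rightarrow> instr list \<Rightarrow> tm \<Rightarrow> tm" where
  "prefix_tm A P M = \<lparr>num_tapes = 7 + num_tapes M, start_state = 0,
     accept_state = embed_state M (length P) (accept_state M),
     transitions = code_transitions A P (num_tapes M - 1) \<union> tail_transitions A M (length P)\<rparr>"

lemma finite_code_transitions: "finite (code_transitions A P e)"
proof -
  let ?R = "{r :: tname \<Rightarrow> nat. \<forall>k. r k < A}"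
  have "?R = PiE UNIV (\<lambda>_. {..<A})" by (auto simp: PiE_UNIV_domain)
  then have fin: "finite ?R" by (simp add: finite_PiE UNIV_tname)
  show ?thesis
  proof (rule finite_subset)
    show "code_transitions A P e \<subseteq> (\<lambda>(p, r). (p, map r names @ replicate e 0,
        fst (the ((P ! p) r)), map (snd (the ((P ! p) r))) names @ replicate e (0, Stay))) ` ({..<length P} \<times> ?R)"
    proof
      fix x assume "x \<in> code_transitions A P e"
      then obtain p r p' a where *: "x = (p, map r names @ replicate e 0, p', map a names @ replicate e (0, Stay))"
        "p < length P" "\<forall>k. r k < A" "(P ! p) r = Some (p', a)"
        unfolding code_transitions_def by blast
      then show "x \<in> (\<lambda>(p, r). (p, map r names @ replicate e 0,
        fst (the ((P ! p) r)), map (snd (the ((P ! p) r))) names @ replicate e (0, Stay))) ` ({..<length P} \<times> ?R)"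
        by (intro image_eqI[of _ _ "(p, r)"]) auto
    qed
  qed (use fin in auto)
qed

lemma finite_tail_transitions:
  assumes "finite (transitions M)"
  shows "finite (tail_transitions A M l)"
proof (rule finite_subset)
  show "tail_transitions A M l \<subseteq> (\<lambda>((q, as, q', bs), pre). (embed_state M l q, pre @ as, embed_state M l q',
      map (\<lambda>a. (a, Stay)) pre @ bs)) ` (transitions M \<times> {pre. set pre \<subseteq> {..<A} \<and> length pre = 7})"
    unfolding tail_transitions_def by force
  show "finite ((\<lambda>((q, as, q', bs), pre). (embed_state M l q, pre @ as, embed_state M l q',
      map (\<lambda>a. (a, Stay)) pre @ bs)) ` (transitions M \<times> {pre. set pre \<subseteq> {..<A} \<and> length pre = 7}))"
    by (intro finite_imageI finite_cartesian_product assms finite_lists_length_eq) auto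
qed

lemma map_names_eq: "map r names = map s names \<longleftrightarrow> r = s"
  using set_names by (auto simp: map_eq_conv)

lemma wf_prefix_tm: "wf_tm M \<Longrightarrow> wf_tm (prefix_tm A P M)"
  using finite_code_transitions[of A P "num_tapes M - 1"] finite_tail_transitions[of M A "length P"]
  unfolding wf_tm_def prefix_tm_def
  by (fastforce simp: code_transitions_def tail_transitions_def names_def)

text \<open>Comparing the state with \<open>length P\<close> tells the two kinds of transitions
  apart. In the code, an instruction is a function of the symbols read; in the tail, the length of
  \<open>pre\<close> and the injectivity of \<open>embed_state\<close> recover the transition of
  \<open>M\<close>.\<close>

lemma deterministic_prefix_tm:
  assumes M: "wf_tm M" and det: "deterministic M"
  shows "deterministic (prefix_tm A P M)"
  unfolding deterministic_def
proof (intro allI impI)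
  fix q as q1 bs1 q2 bs2
  assume 1: "(q, as, q1, bs1) \<in> transitions (prefix_tm A P M)"
    and 2: "(q, as, q2, bs2) \<in> transitions (prefix_tm A P M)"
  show "q1 = q2 \<and> bs1 = bs2"
  proof (cases "q < length P")
    case True
    then have "(q, as, q1, bs1) \<in> code_transitions A P (num_tapes M - 1)"
      "(q, as, q2, bs2) \<in> code_transitions A P (num_tapes M - 1)"
      using 1 2 by (auto simp: prefix_tm_def tail_transitions_def)
    then obtain r a r' a' where
      "map r names @ replicate (num_tapes M - 1) (0::nat) = map r' names @ replicate (num_tapes M - 1) 0"
      "(P ! q) r = Some (q1, a)" "(P ! q) r' = Some (q2, a')"
      "bs1 = map a names @ replicate (num_tapes M - 1) (0, Stay)"
      "bs2 = map a' names @ replicate (num_tapes M - 1) (0, Stay)"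
      unfolding code_transitions_def by blast
    then show ?thesis by (simp only: append_same_eq map_names_eq) simp
  next
    case False
    then have "(q, as, q1, bs1) \<in> tail_transitions A M (length P)"
      "(q, as, q2, bs2) \<in> tail_transitions A M (length P)"
      using 1 2 by (auto simp: prefix_tm_def code_transitions_def)
    then obtain p as1 p1 cs1 pre1 p' as2 p2 cs2 pre2 where *:
      "q = embed_state M (length P) p" "as = pre1 @ as1" "q1 = embed_state M (length P) p1"
      "bs1 = map (\<lambda>a. (a, Stay)) pre1 @ cs1" "(p, as1, p1, cs1) \<in> transitions M" "length pre1 = 7"
      "q = embed_state M (length P) p'" "as = pre2 @ as2" "q2 = embed_state M (length P) p2"
      "bs2 = map (\<lambda>a. (a, Stay)) pre2 @ cs2" "(p', as2, p2, cs2) \<in> transitions M" "length pre2 = 7"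
      unfolding tail_transitions_def by blast
    then have "p = p'" "pre1 = pre2" "as1 = as2" by (auto simp: embed_state_inj)
    then show ?thesis using * det unfolding deterministic_def by blast
  qed
qed

lemma act_blank: "act_tape (0, Stay) blank_tape = blank_tape"
  by (auto simp: blank_tape_def)

lemma step_pair: "step M (q, ts) c' \<longleftrightarrow>
    (\<exists>q' bs. (q, map read_tape ts, q', bs) \<in> transitions M \<and> c' = (q', map2 act_tape bs ts))"
  by (auto simp: step_def)

lemma step_code:
  assumes "bounded_store A \<sigma>" "p < length P"
  shows "step (prefix_tm A P M) (p, map \<sigma> names @ replicate (num_tapes M - 1) blank_tape) c' \<longleftrightarrow>
    (\<exists>p' \<sigma>'. cstep P (p, \<sigma>) = Some (p', \<sigma>') \<and> c' = (p', map \<sigma>' names @ replicate (num_tapes M - 1) blank_tape))"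
    (is "?L \<longleftrightarrow> ?R")
proof -
  define e where "e = num_tapes M - 1"
  define T where "T = map \<sigma> names @ replicate e blank_tape"
  have rd: "map read_tape T = map (reads \<sigma>) names @ replicate e 0"
    by (simp add: reads_def blank_tape_def T_def)
  have ac: "map2 act_tape (map a names @ replicate e (0, Stay)) T
      = map (perform a \<sigma>) names @ replicate e blank_tape" for a
    by (simp add: T_def names_def perform_def zip_append zip_replicate act_blank)
  have tr: "(p, as, q', bs) \<in> transitions (prefix_tm A P M) \<longleftrightarrow> (p, as, q', bs) \<in> code_transitions A P e"
    for as q' bs
    using assms(2) by (auto simp: prefix_tm_def tail_transitions_def e_def)
  have mem: "(p, map (reads \<sigma>) names @ replicate e 0, q', bs) \<in> code_transitions A P e \<longleftrightarrow>
     (\<exists>a. (P ! p) (reads \<sigma>) = Some (q', a) \<and> bs = map a names @ replicate e (0, Stay))" for q' bs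
  proof
    assume "(p, map (reads \<sigma>) names @ replicate e 0, q', bs) \<in> code_transitions A P e"
    then obtain r a where "map (reads \<sigma>) names = map r names" "(P ! p) r = Some (q', a)"
      "bs = map a names @ replicate e (0, Stay)"
      unfolding code_transitions_def by auto
    then show "\<exists>a. (P ! p) (reads \<sigma>) = Some (q', a) \<and> bs = map a names @ replicate e (0, Stay)"
      by (simp only: map_names_eq) blast
  next
    assume "\<exists>a. (P ! p) (reads \<sigma>) = Some (q', a) \<and> bs = map a names @ replicate e (0, Stay)"
    then show "(p, map (reads \<sigma>) names @ replicate e 0, q', bs) \<in> code_transitions A P e"
      unfolding code_transitions_def using assms reads_bounded by fastforce
  qed
  have "?L \<longleftrightarrow> (\<exists>q' a. (P ! p) (reads \<sigma>) = Some (q', a) \<and> c' = (q', map (perform a \<sigma>) names @ replicate e blank_tape))"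
    unfolding e_def[symmetric] T_def[symmetric] step_pair tr rd mem using ac by auto
  also have "\<dots> \<longleftrightarrow> ?R"
    unfolding e_def[symmetric] using assms(2) by (auto simp: cstep_def)
  finally show ?thesis .
qed

lemma forced_code:
  assumes "cforced P n (p, \<sigma>) (p', \<sigma>')" "bounded_store A \<sigma>" "bounded_code A P"
  shows "forced (step (prefix_tm A P M)) n (p, map \<sigma> names @ replicate (num_tapes M - 1) blank_tape)
      (p', map \<sigma>' names @ replicate (num_tapes M - 1) blank_tape) \<and> bounded_store A \<sigma>'"
  using assms
proof (induction n arbitrary: p \<sigma>)
  case (Suc n)
  then obtain p1 \<sigma>1 where 1: "cstep P (p, \<sigma>) = Some (p1, \<sigma>1)" and 2: "cforced P n (p1, \<sigma>1) (p', \<sigma>')"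
    by auto
  have b: "bounded_store A \<sigma>1" using cstep_bounded Suc.prems 1 by blast
  have p: "p < length P" using 1 by (auto simp: cstep_def split: if_splits)
  show ?case
    using Suc.IH[OF 2 b Suc.prems(3)] step_code[OF Suc.prems(2) p] 1
    by (auto intro!: exI[of _ "p1"])
qed auto

text \<open>An equivalence is needed here: every choice of \<open>M\<close> must remain available,
  for acceptance, and no other may arise, for the time bound on all computations.\<close>

lemma step_tail:
  assumes "length pre = 7" "set (map read_tape pre) \<subseteq> {..<A}" "wf_tm M"
  shows "step (prefix_tm A P M) (embed_state M (length P) q, pre @ ts) c' \<longleftrightarrow>
    (\<exists>q' ts'. step M (q, ts) (q', ts') \<and> c' = (embed_state M (length P) q', pre @ ts'))"
    (is "?L \<longleftrightarrow> ?R")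
proof -
  let ?\<phi> = "embed_state M (length P)"
  define rs where "rs = map read_tape pre"
  have st: "map2 act_tape (map (\<lambda>a. (a, Stay)) rs @ bs) (pre @ ts) = pre @ map2 act_tape bs ts" for bs
  proof -
    have "map2 act_tape (map (\<lambda>a. (a, Stay)) (map read_tape pre)) pre = pre"
    proof (rule nth_equalityI)
      fix i assume i: "i < length (map2 act_tape (map (\<lambda>a. (a, Stay)) (map read_tape pre)) pre)"
      then show "map2 act_tape (map (\<lambda>a. (a, Stay)) (map read_tape pre)) pre ! i = pre ! i"
        by (cases "pre ! i") auto
    qed simp
    then show ?thesis by (simp add: rs_def)
  qed
  have tr: "(?\<phi> q, rs @ as, p', bs) \<in> transitions (prefix_tm A P M) \<longleftrightarrow>
     (\<exists>q' bs'. (q, as, q', bs') \<in> transitions M \<and> p' = ?\<phi> q' \<and> bs = map (\<lambda>a. (a, Stay)) (rs) @ bs')"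
    (is "?A \<longleftrightarrow> ?B") for as p' bs
  proof
    assume ?A
    then have "(?\<phi> q, rs @ as, p', bs) \<in> tail_transitions A M (length P)"
      by (auto simp: prefix_tm_def code_transitions_def)
    then obtain q0 as0 q' bs' pre0 where *: "?\<phi> q = ?\<phi> q0" "rs @ as = pre0 @ as0"
      "p' = ?\<phi> q'" "bs = map (\<lambda>a. (a, Stay)) pre0 @ bs'" "(q0, as0, q', bs') \<in> transitions M" "length pre0 = 7"
      unfolding tail_transitions_def by blast
    then have "q0 = q" "rs = pre0" "as = as0" using assms(1) by (auto simp: embed_state_inj rs_def)
    with * show ?B by auto
  next
    assume ?B
    then show ?A using assms(1,2) by (fastforce simp: prefix_tm_def tail_transitions_def rs_def)
  qed
  have "?L \<longleftrightarrow> (\<exists>q' bs'. (q, map read_tape ts, q', bs') \<in> transitions M \<and>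
      c' = (?\<phi> q', map2 act_tape (map (\<lambda>a. (a, Stay)) rs @ bs') (pre @ ts)))"
    unfolding step_pair map_append rs_def[symmetric] tr by blast
  also have "\<dots> \<longleftrightarrow> ?R"
    unfolding st step_pair by blast
  finally show ?thesis .
qed

lemma relpowp_tail:
  assumes "length pre = 7" "set (map read_tape pre) \<subseteq> {..<A}" "wf_tm M"
  shows "(step (prefix_tm A P M) ^^ t) (embed_state M (length P) q, pre @ ts) c' \<longleftrightarrow>
    (\<exists>q' ts'. (step M ^^ t) (q, ts) (q', ts') \<and> c' = (embed_state M (length P) q', pre @ ts'))"
proof (induction t arbitrary: c')
  case (Suc t)
  have "(step (prefix_tm A P M) ^^ Suc t) (embed_state M (length P) q, pre @ ts) c' \<longleftrightarrow>
     (\<exists>c. (step (prefix_tm A P M) ^^ t) (embed_state M (length P) q, pre @ ts) c \<and> step (prefix_tm A P M) c c')"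
    unfolding relpowp.simps relcompp_apply ..
  also have "\<dots> \<longleftrightarrow> (\<exists>q' ts'. (step M ^^ t) (q, ts) (q', ts') \<and>
      step (prefix_tm A P M) (embed_state M (length P) q', pre @ ts') c')"
    unfolding Suc.IH by blast
  also have "\<dots> \<longleftrightarrow> (\<exists>q' ts'. (step M ^^ Suc t) (q, ts) (q', ts') \<and> c' = (embed_state M (length P) q', pre @ ts'))"
  proof -
    have "(step M ^^ Suc t) (q, ts) (q', ts') \<longleftrightarrow>
        (\<exists>q1 ts1. (step M ^^ t) (q, ts) (q1, ts1) \<and> step M (q1, ts1) (q', ts'))" for q' ts'
      by (auto simp: relcompp_apply)
    then show ?thesis unfolding step_tail[OF assms] by blast
  qed
  finally show ?case .
qed auto

definition init_store :: "bool list \<Rightarrow> store" where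
  "init_store w = (\<lambda>_. blank_tape)(Inp := input_tape w)"

lemma init_config_prefix_tm:
  assumes "wf_tm M"
  shows "init_config (prefix_tm A P M) w = (0, map (init_store w) names @ replicate (num_tapes M - 1) blank_tape)"
proof -
  have "7 + num_tapes M - 1 = 7 + (num_tapes M - 1)" using assms by (auto simp: wf_tm_def)
  then have "replicate (7 + num_tapes M - 1) blank_tape = replicate 7 blank_tape @ replicate (num_tapes M - 1) blank_tape"
    by (simp only: replicate_add)
  then show ?thesis
    by (simp add: init_config_def prefix_tm_def init_store_def names_def numeral_eq_Suc flip: blank_tape_def)
qed

section \<open>Reductions computed by programs in polynomial time\<close>

lemma poly_nat_mono: "(x::nat) \<le> y \<Longrightarrow> poly p x \<le> poly p y"
  by (induction p) (auto intro!: add_mono mult_mono)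

definition inside :: "nat \<Rightarrow> tape \<Rightarrow> bool" where
  "inside m t \<longleftrightarrow> \<bar>fst t\<bar> \<le> int m \<and> (\<forall>i. snd t i \<noteq> 0 \<longrightarrow> \<bar>i\<bar> \<le> int m)"

lemma inside_mono: "inside m t \<Longrightarrow> m \<le> m' \<Longrightarrow> inside m' t"
  unfolding inside_def by (meson of_nat_le_iff order_trans)

lemma inside_act: "inside m t \<Longrightarrow> inside (Suc m) (act_tape x t)"
proof -
  assume t: "inside m t"
  obtain h f where hf: "t = (h, f)" by fastforce
  obtain s d where sd: "x = (s, d)" by fastforce
  have "\<bar>offset d\<bar> \<le> 1" by (cases d) auto
  with t have "\<bar>h + offset d\<bar> \<le> int (Suc m)" unfolding hf inside_def by simp linarith
  moreover have "\<bar>i\<bar> \<le> int (Suc m)" if "(f(h := s)) i \<noteq> 0" for i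
  proof (cases "i = h")
    case True
    then show ?thesis using t by (simp add: hf inside_def)
  next
    case False
    then have "\<bar>i\<bar> \<le> int m" using t that by (simp add: hf inside_def)
    then show ?thesis by simp
  qed
  ultimately show ?thesis by (simp add: inside_def hf sd)
qed

lemma exec_inside:
  assumes "exec c \<sigma> n r" and "r = Some \<sigma>'" and "inside m (\<sigma> k)"
  shows "inside (m + n) (\<sigma>' k)"
  using assms
proof (induction arbitrary: m \<sigma>' rule: exec.induct)
  case (act g \<sigma> a)
  then show ?case by (auto simp: perform_def intro: inside_act)
next
  case (seq c \<sigma> n \<sigma>1 d n' r)
  show ?case
    using seq.IH(2)[OF seq.prems(1) seq.IH(1)[OF refl seq.prems(2)]] by (simp add: add.assoc)
next
  case (while_step b \<sigma> c n \<sigma>1 n' r)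
  show ?case
    using while_step.IH(2)[OF while_step.prems(1) while_step.IH(1)[OF refl while_step.prems(2)]]
    by (rule inside_mono) simp
next
  case (cond_true b \<sigma> c n r d)
  show ?case using cond_true.IH[OF cond_true.prems] by (rule inside_mono) simp
next
  case (cond_false b \<sigma> c n r d)
  show ?case using cond_false.IH[OF cond_false.prems] by (rule inside_mono) simp
next
  case (while_done b \<sigma> c)
  then show ?case by (auto intro: inside_mono)
qed auto

text \<open>The tape \<open>Out\<close> starts blank, and after \<open>n\<close> steps its nonblank
  cells lie at distance at most \<open>n\<close> from cell \<open>0\<close>. This turns the time
  bound of the second machine into one in terms of the original input.\<close>

lemma output_length:
  assumes "exec c (init_store w) n (Some \<sigma>)" and "\<sigma> Out = input_tape v"
  shows "length v \<le> Suc n"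
proof (rule ccontr)
  assume a: "\<not> length v \<le> Suc n"
  have "inside (0 + n) (\<sigma> Out)"
    by (rule exec_inside[OF assms(1) refl]) (auto simp: init_store_def blank_tape_def inside_def)
  then have "snd (\<sigma> Out) (int (length v) - 1) \<noteq> 0 \<Longrightarrow> \<bar>int (length v) - 1\<bar> \<le> int n"
    unfolding inside_def by simp
  with a have *: "snd (\<sigma> Out) (int (length v) - 1) = 0" by linarith
  have "snd (input_tape v) (int (length v) - 1) \<noteq> 0"
    using a by (auto simp: input_tape_def)
  with * assms(2) show False by simp
qed

lemma polytime_reduction:
  assumes M: "wf_tm M" and dec: "decides_in_polytime M L"
    and c: "bounded_com A c" "A \<ge> 3"
    and run: "\<And>w. \<exists>n \<le> poly T (length w).
      exec c (init_store w) n None \<and> w \<notin> L' \<or>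
      (\<exists>\<sigma> v. exec c (init_store w) n (Some \<sigma>) \<and> \<sigma> Out = input_tape v \<and> (w \<in> L' \<longleftrightarrow> v \<in> L))"
  shows "decides_in_polytime (prefix_tm A (compile c 0 (len c)) M) L'"
proof -
  define P where "P = compile c 0 (len c)"
  define M' where "M' = prefix_tm A P M"
  let ?e = "num_tapes M - 1"
  have lP: "length P = len c" by (simp add: P_def)
  have cP: "code_at P 0 (compile c 0 (len c))" by (simp add: code_at_def P_def)
  have bP: "bounded_code A P" using c bounded_compile P_def by blast
  have scans_to: "accept_state M' = embed_state M (length P) (accept_state M)" by (simp add: M'_def prefix_tm_def)
  have b0: "bounded_store A (init_store w)" for w
    using c(2) by (auto simp: bounded_store_def init_store_def input_tape_def blank_tape_def)
  obtain TM where TM: "\<And>w t c. (step M ^^ t) (init_config M w) c \<Longrightarrow> t \<le> poly TM (length w)"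
    using dec unfolding decides_in_polytime_def by blast
  have accM: "accepts M w \<longleftrightarrow> w \<in> L" for w using dec unfolding decides_in_polytime_def by blast
  \<comment> \<open>The program takes at most \<open>T\<close> steps and hence leaves an input of
    length at most \<open>T + 1\<close> for \<open>M\<close>.\<close>
  define T' where "T' = T + pcompose TM (T + 1)"
  have main: "(accepts M' w \<longleftrightarrow> w \<in> L') \<and> (\<forall>t d. (step M' ^^ t) (init_config M' w) d \<longrightarrow> t \<le> poly T' (length w))" for w
  proof -
    obtain n where n: "n \<le> poly T (length w)" and cases:
      "exec c (init_store w) n None \<and> w \<notin> L' \<or>
      (\<exists>\<sigma> v. exec c (init_store w) n (Some \<sigma>) \<and> \<sigma> Out = input_tape v \<and> (w \<in> L' \<longleftrightarrow> v \<in> L))"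
      using run[of w] by blast
    have ini: "init_config M' w = (0, map (init_store w) names @ replicate ?e blank_tape)"
      using init_config_prefix_tm[OF M] by (simp add: M'_def)
    from cases show ?thesis
    proof
      assume *: "exec c (init_store w) n None \<and> w \<notin> L'"
      then obtain s where "cforced P n (0, init_store w) s" "fst s < length P" "cstep P s = None"
        using compile_correct[of c "init_store w" n None P 0 "len c"] cP unfolding reaches_def option.case by blast
      then obtain p' \<sigma>' where f: "cforced P n (0, init_store w) (p', \<sigma>')" and p': "p' < length P"
        and stuck: "cstep P (p', \<sigma>') = None"
        by (cases s) auto
      let ?d = "(p', map \<sigma>' names @ replicate ?e blank_tape)"
      have F: "forced (step M') n (init_config M' w) ?d" and b: "bounded_store A \<sigma>'"
        using forced_code[OF f b0 bP] by (auto simp: M'_def ini[unfolded M'_def])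
      have halt: "\<not> step M' ?d x" for x
        using step_code[OF b p'] stuck by (auto simp: M'_def)
      have "t \<le> n \<and> (t < n \<and> (\<exists>e'. step M' e e') \<or> e = ?d)" if "(step M' ^^ t) (init_config M' w) e" for t e
      proof -
        from forced_relpowp[OF F that]
        consider "t < n" "\<exists>e'. step M' e e'" | "n \<le> t" "(step M' ^^ (t - n)) ?d e" by blast
        then show ?thesis
        proof cases
          case 2
          then have "t - n = 0" using halt by (metis not0_implies_Suc relpowp_Suc_E2)
          with 2 show ?thesis by auto
        qed auto
      qed
      note R = this
      have "\<not> accepts M' w"
      proof
        assume "accepts M' w"
        then obtain e t where e: "(step M' ^^ t) (init_config M' w) e" "fst e = accept_state M'" "\<nexists>e'. step M' e e'"
          unfolding accepts_def by (metis rtranclp_imp_relpowp)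
        then have "e = ?d" using R by blast
        \<comment> \<open>The stuck configuration has a state below \<open>length P\<close>; the
          accepting state is the image of a state of \<open>M\<close> and is at least
          \<open>length P\<close>.\<close>
        then show False using e(2) p' scans_to embed_state_ge[of "length P" M "accept_state M"] by simp
      qed
      moreover have "t \<le> poly T' (length w)" if "(step M' ^^ t) (init_config M' w) d" for t d
        using R[OF that] n by (auto simp: T'_def)
      ultimately show ?thesis using * by blast
    next
      assume "\<exists>\<sigma> v. exec c (init_store w) n (Some \<sigma>) \<and> \<sigma> Out = input_tape v \<and> (w \<in> L' \<longleftrightarrow> v \<in> L)"
      then obtain \<sigma> v where ex: "exec c (init_store w) n (Some \<sigma>)" and out: "\<sigma> Out = input_tape v"
        and iff: "w \<in> L' \<longleftrightarrow> v \<in> L" by blast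
      have f: "cforced P n (0, init_store w) (length P, \<sigma>)"
        using compile_correct[OF ex cP] lP by (simp add: reaches_def)
      define pre where "pre = map \<sigma> [Inp, Tok, Mode, Flag, Mats, Rows, Cols]"
      let ?d = "(embed_state M (length P) (start_state M), pre @ snd (init_config M v))"
      \<comment> \<open>The exit address is the image of the start state, and \<open>Out\<close>,
        the eighth tape, is the first tape of \<open>M\<close>. So the end of the program is
        literally the initial configuration of \<open>M\<close> on \<open>v\<close>, next to seven
        idle tapes.\<close>
      have d: "?d = (length P, map \<sigma> names @ replicate ?e blank_tape)"
        using out by (simp add: pre_def names_def embed_state_def init_config_def blank_tape_def)
      have F: "forced (step M') n (init_config M' w) ?d" and b: "bounded_store A \<sigma>"
        using forced_code[OF f b0 bP] unfolding d by (auto simp: M'_def ini[unfolded M'_def])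
      have pre7: "length pre = 7" "set (map read_tape pre) \<subseteq> {..<A}"
        using reads_bounded[OF b] by (auto simp: reads_def pre_def)
      have tail: "(step M' ^^ t) ?d c' \<longleftrightarrow>
          (\<exists>q' ts'. (step M ^^ t) (init_config M v) (q', ts') \<and> c' = (embed_state M (length P) q', pre @ ts'))" for t c'
        using relpowp_tail[OF pre7 M, where q = "start_state M" and ts = "snd (init_config M v)"]
        unfolding M'_def by (simp add: init_config_def)
      have halt: "(\<exists>x. step M' (embed_state M (length P) q', pre @ ts') x) \<longleftrightarrow> (\<exists>x. step M (q', ts') x)" for q' ts'
        using step_tail[OF pre7 M] unfolding M'_def by auto
      have lv: "length v \<le> Suc n" using output_length[OF ex out] .
      have "t \<le> poly T' (length w)" if "(step M' ^^ t) (init_config M' w) e" for t e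
      proof -
        from forced_relpowp[OF F that]
        consider "t < n" | "n \<le> t" "(step M' ^^ (t - n)) ?d e" by blast
        then show ?thesis
        proof cases
          case 1
          then show ?thesis using n by (simp add: T'_def)
        next
          case 2
          then have "t - n \<le> poly TM (length v)" using tail TM by blast
          also have "\<dots> \<le> poly TM (poly T (length w) + 1)"
            by (rule poly_nat_mono) (use lv n in simp)
          finally show ?thesis using n 2 by (simp add: T'_def poly_pcompose)
        qed
      qed
      moreover have "accepts M' w \<longleftrightarrow> accepts M v"
      proof
        assume "accepts M' w"
        then obtain e t where e: "(step M' ^^ t) (init_config M' w) e" "fst e = accept_state M'" "\<nexists>e'. step M' e e'"
          unfolding accepts_def by (metis rtranclp_imp_relpowp)
        from forced_relpowp[OF F e(1)] e(3) have "(step M' ^^ (t - n)) ?d e" by blast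
        then obtain q' ts' where q: "(step M ^^ (t - n)) (init_config M v) (q', ts')"
          "e = (embed_state M (length P) q', pre @ ts')"
          using tail by blast
        then have "q' = accept_state M" using e(2) scans_to by (simp add: embed_state_inj)
        moreover have "\<nexists>x. step M (q', ts') x" using halt e(3) q(2) by blast
        ultimately show "accepts M v" unfolding accepts_def using q(1) by (metis fst_conv relpowp_imp_rtranclp)
      next
        assume "accepts M v"
        then obtain t q' ts' where q: "(step M ^^ t) (init_config M v) (q', ts')" "q' = accept_state M"
          "\<nexists>x. step M (q', ts') x"
          unfolding accepts_def by (metis rtranclp_imp_relpowp prod.collapse)
        let ?e = "(embed_state M (length P) q', pre @ ts')"
        have "(step M' ^^ t) ?d ?e" using q(1) tail by blast
        then have "(step M')\<^sup>*\<^sup>* (init_config M' w) ?e"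
          using forced_relpowp_self[OF F] by (meson relpowp_imp_rtranclp rtranclp_trans)
        then show "accepts M' w" unfolding accepts_def using halt q(2,3) scans_to by (metis fst_conv)
      qed
      ultimately show ?thesis using accM iff by blast
    qed
  qed
  show ?thesis
    unfolding decides_in_polytime_def P_def[symmetric] M'_def[symmetric] using main by blast
qed

section \<open>Programs that write on the output tape\<close>

definition run :: "com \<Rightarrow> store \<Rightarrow> nat \<Rightarrow> store option \<Rightarrow> bool" where
  "run c \<sigma> t r \<longleftrightarrow> (\<exists>n\<le>t. exec c \<sigma> n r)"

lemma run_mono: "run c \<sigma> t r \<Longrightarrow> t \<le> t' \<Longrightarrow> run c \<sigma> t' r"
  unfolding run_def by (meson order_trans)

lemma run_act: "g (reads \<sigma>) = Some a \<Longrightarrow> perform a \<sigma> = \<sigma>' \<Longrightarrow> run (Act g) \<sigma> 1 (Some \<sigma>')"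
  unfolding run_def using exec.act by blast

lemma run_act_stuck: "g (reads \<sigma>) = None \<Longrightarrow> run (Act g) \<sigma> t None"
  unfolding run_def using exec.act_stuck by blast

lemma run_seq: "run c \<sigma> t (Some \<sigma>') \<Longrightarrow> run d \<sigma>' t' r \<Longrightarrow> run (c ;; d) \<sigma> (t + t') r"
  unfolding run_def using exec.seq by (meson add_mono)

lemma run_seq_stuck: "run c \<sigma> t None \<Longrightarrow> run (c ;; d) \<sigma> t None"
  unfolding run_def using exec.seq_stuck by blast

lemma run_cond:
  assumes "b (reads \<sigma>) \<Longrightarrow> run c \<sigma> t r" and "\<not> b (reads \<sigma>) \<Longrightarrow> run d \<sigma> t r"
  shows "run (Cond b c d) \<sigma> (Suc t) r"
  using assms exec.cond_true exec.cond_false unfolding run_def by (metis Suc_le_mono)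

lemma run_while_done: "\<not> b (reads \<sigma>) \<Longrightarrow> run (While b c) \<sigma> 1 (Some \<sigma>)"
  unfolding run_def using exec.while_done by blast

lemma run_while_step:
  "b (reads \<sigma>) \<Longrightarrow> run c \<sigma> t (Some \<sigma>') \<Longrightarrow> run (While b c) \<sigma>' t' r \<Longrightarrow> run (While b c) \<sigma> (Suc (t + t')) r"
  unfolding run_def using exec.while_step by (meson Suc_le_mono add_mono)

lemma run_while_stuck: "b (reads \<sigma>) \<Longrightarrow> run c \<sigma> t None \<Longrightarrow> run (While b c) \<sigma> (Suc t) None"
  unfolding run_def using exec.while_stuck by (meson Suc_le_mono)

section \<open>Tapes with a list of symbols from cell 0 on\<close>

definition tp :: "int \<Rightarrow> nat list \<Rightarrow> tape" where
  "tp p xs = (p, \<lambda>i. if 0 \<le> i \<and> nat i < length xs then xs ! nat i else 0)"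

lemma read_tp: "read_tape (tp p xs) = (if 0 \<le> p \<and> nat p < length xs then xs ! nat p else 0)"
  by (simp add: tp_def)

lemma read_tp_nat: "read_tape (tp (int p) xs) = (if p < length xs then xs ! p else 0)"
  by (simp add: tp_def)

lemma act_tp: "p < length xs \<Longrightarrow> act_tape (a, d) (tp (int p) xs) = tp (int p + offset d) (xs[p := a])"
  by (auto simp: tp_def fun_eq_iff)

lemma act_tp_append:
  "p = length xs \<Longrightarrow> act_tape (a, d) (tp (int p) xs) = tp (int p + offset d) (xs @ [a])"
  by (auto simp: tp_def fun_eq_iff nth_append)

lemma act_tp_keep: "act_tape (read_tape (tp p xs), d) (tp p xs) = tp (p + offset d) xs"
  by (auto simp: tp_def)

lemma fst_tp [simp]: "fst (tp p xs) = p"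
  by (simp add: tp_def)

lemma tp_nonzero:
  "0 \<notin> set xs \<Longrightarrow> snd (tp p xs) i \<noteq> 0 \<longleftrightarrow> 0 \<le> i \<and> i < int (length xs)"
proof -
  assume 0: "0 \<notin> set xs"
  have "xs ! nat i \<noteq> 0" if "nat i < length xs" using 0 nth_mem[OF that] by metis
  then show ?thesis by (auto simp: tp_def)
qed

definition bsym :: "bool \<Rightarrow> nat" where
  "bsym b = (if b then 2 else 1)"

lemma input_tape_tp: "input_tape w = tp 0 (map bsym w)"
  by (auto simp: input_tape_def tp_def fun_eq_iff bsym_def)

definition outt :: "bool list \<Rightarrow> tape" where
  "outt v = tp (int (length v)) (map bsym v)"

lemma read_outt [simp]: "read_tape (outt v) = 0"
  by (simp add: outt_def tp_def)

lemma act_outt: "act_tape (bsym b, Right) (outt v) = outt (v @ [b])"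
  by (simp add: outt_def act_tp_append add.commute)

lemma reads_upd: "reads (\<sigma>(k := t)) = (reads \<sigma>)(k := read_tape t)"
  by (auto simp: reads_def)

lemma perform_upd: "perform (a(k := x)) \<sigma> = (perform a \<sigma>)(k := act_tape x (\<sigma> k))"
  by (auto simp: perform_def)

text \<open>The output written so far is arbitrary and all other tapes are restored, so such
  programs compose by concatenating their outputs. The head of \<open>Out\<close> is always on a
  blank, which is why tests below are evaluated at
  \<open>(reads \<sigma>)(Out := 0)\<close>.\<close>

definition emits :: "com \<Rightarrow> store \<Rightarrow> nat \<Rightarrow> bool list \<Rightarrow> bool" where
  "emits c \<sigma> t s \<longleftrightarrow> (\<forall>v. run c (\<sigma>(Out := outt v)) t (Some (\<sigma>(Out := outt (v @ s)))))"

lemma emits_mono: "emits c \<sigma> t s \<Longrightarrow> t \<le> t' \<Longrightarrow> emits c \<sigma> t' s"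
  unfolding emits_def using run_mono by blast

lemma emits_seq: "emits c \<sigma> t s \<Longrightarrow> emits d \<sigma> t' s' \<Longrightarrow> emits (c ;; d) \<sigma> (t + t') (s @ s')"
  unfolding emits_def by (metis append.assoc run_seq)

lemma emits_cond:
  assumes "b ((reads \<sigma>)(Out := 0)) \<Longrightarrow> emits c \<sigma> t s" and "\<not> b ((reads \<sigma>)(Out := 0)) \<Longrightarrow> emits d \<sigma> t s"
  shows "emits (Cond b c d) \<sigma> (Suc t) s"
  using assms unfolding emits_def by (auto simp: reads_upd intro!: run_cond)

definition skip :: com where
  "skip = Act (\<lambda>r. Some (keep r))"

lemma run_skip: "run skip \<sigma> 1 (Some \<sigma>)"
  unfolding skip_def by (rule run_act) auto

definition put :: "((tname \<Rightarrow> nat) \<Rightarrow> bool) \<Rightarrow> com" where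
  "put f = Act (\<lambda>r. Some ((keep r)(Out := (bsym (f r), Right))))"

lemma emits_put: "emits (put f) \<sigma> 1 [f ((reads \<sigma>)(Out := 0))]"
  unfolding emits_def
proof
  fix v
  let ?\<sigma> = "\<sigma>(Out := outt v)"
  have "perform ((keep (reads ?\<sigma>))(Out := (bsym (f (reads ?\<sigma>)), Right))) ?\<sigma>
      = \<sigma>(Out := outt (v @ [f ((reads \<sigma>)(Out := 0))]))"
    unfolding perform_upd perform_keep by (simp add: act_outt reads_upd)
  then show "run (put f) ?\<sigma> 1 (Some (\<sigma>(Out := outt (v @ [f ((reads \<sigma>)(Out := 0))]))))"
    unfolding put_def by (rule run_act[OF refl])
qed

fun emit :: "bool list \<Rightarrow> com" where
  "emit [] = skip"
| "emit (b # bs) = put (\<lambda>_. b) ;; emit bs"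

lemma emits_emit: "emits (emit bs) \<sigma> (Suc (length bs)) bs"
proof (induction bs)
  case Nil
  then show ?case by (auto simp: emits_def intro: run_skip[unfolded One_nat_def])
next
  case (Cons b bs)
  show ?case using emits_seq[OF emits_put[of "\<lambda>_. b" \<sigma>] Cons.IH] by simp
qed

text \<open>Several heads may move together: the sweep over the variables \<open>y_r\<close> reads
  the marks of \<open>Rows\<close> and of \<open>Cols\<close> at the same index.\<close>

definition mv :: "tname set \<Rightarrow> move \<Rightarrow> com" where
  "mv K d = Act (\<lambda>r. Some (\<lambda>k. (r k, if k \<in> K then d else Stay)))"

definition heads :: "tname set \<Rightarrow> int \<Rightarrow> store \<Rightarrow> store" where
  "heads K i \<sigma> = (\<lambda>k. if k \<in> K then (i, snd (\<sigma> k)) else \<sigma> k)"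

lemma act_keep: "act_tape (read_tape t, d) t = (fst t + offset d, snd t)"
  by (cases t) simp

lemma run_mv: "run (mv K d) (heads K i \<sigma>) 1 (Some (heads K (i + offset d) \<sigma>))"
  unfolding mv_def
proof (rule run_act[OF refl], rule ext)
  fix k
  show "perform (\<lambda>k. (reads (heads K i \<sigma>) k, if k \<in> K then d else Stay)) (heads K i \<sigma>) k = heads K (i + offset d) \<sigma> k"
    by (cases "k \<in> K") (simp_all add: perform_def heads_def reads_def act_keep)
qed

lemma heads_Out: "Out \<notin> K \<Longrightarrow> heads K i (\<sigma>(Out := t)) = (heads K i \<sigma>)(Out := t)"
  by (auto simp: heads_def)

lemma reads_heads: "k \<in> K \<Longrightarrow> reads (heads K i \<sigma>) k = snd (\<sigma> k) i"
  by (simp add: heads_def reads_def)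

text \<open>The head may stand on the blank behind the last symbol, so one move to the left comes
  before the search. The search stops at the blank cell \<open>-1\<close>, and the last move leads
  to cell \<open>0\<close>. All heads in \<open>K\<close> follow the one of
  \<open>k\<close>.\<close>

definition rewind :: "tname set \<Rightarrow> tname \<Rightarrow> com" where
  "rewind K k = mv K Left ;; While (\<lambda>r. r k \<noteq> 0) (mv K Left) ;; mv K Right"

lemma run_rewind:
  assumes k: "k \<in> K" and supp: "\<And>i. snd (\<sigma> k) i \<noteq> 0 \<longleftrightarrow> 0 \<le> i \<and> i < int L" and j: "j \<le> L"
  shows "run (rewind K k) (heads K (int j) \<sigma>) (2 * j + 3) (Some (heads K 0 \<sigma>))"
proof -
  have loop: "run (While (\<lambda>r. r k \<noteq> 0) (mv K Left)) (heads K (int j - 1) \<sigma>) (2 * j + 1) (Some (heads K (-1) \<sigma>))"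
    using j
  proof (induction j)
    case 0
    have "reads (heads K (-1) \<sigma>) k = 0" using supp[of "-1"] k by (simp add: reads_heads)
    then show ?case using run_while_done[of "\<lambda>r. r k \<noteq> 0" "heads K (-1) \<sigma>"] by simp
  next
    case (Suc j)
    have "reads (heads K (int j) \<sigma>) k \<noteq> 0"
      using supp[of "int j"] k Suc.prems by (simp add: reads_heads)
    moreover have "run (mv K Left) (heads K (int j) \<sigma>) 1 (Some (heads K (int j - 1) \<sigma>))"
      using run_mv[of K Left "int j" \<sigma>] by simp
    moreover have "run (While (\<lambda>r. r k \<noteq> 0) (mv K Left)) (heads K (int j - 1) \<sigma>) (2 * j + 1) (Some (heads K (-1) \<sigma>))"
      using Suc by simp
    ultimately have "run (While (\<lambda>r. r k \<noteq> 0) (mv K Left)) (heads K (int j) \<sigma>) (Suc (1 + (2 * j + 1))) (Some (heads K (-1) \<sigma>))"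
      by (rule run_while_step)
    then show ?case by simp
  qed
  have "run (mv K Left) (heads K (int j) \<sigma>) 1 (Some (heads K (int j - 1) \<sigma>))"
    using run_mv[of K Left "int j" \<sigma>] by simp
  moreover have "run (mv K Right) (heads K (-1) \<sigma>) 1 (Some (heads K 0 \<sigma>))"
    using run_mv[of K Right "-1" \<sigma>] by simp
  ultimately have "run (rewind K k) (heads K (int j) \<sigma>) (1 + ((2 * j + 1) + 1)) (Some (heads K 0 \<sigma>))"
    unfolding rewind_def using loop by (intro run_seq)
  then show ?thesis by (simp add: numeral_eq_Suc)
qed

section \<open>Loops over cells and exponents\<close>

definition foreach :: "tname set \<Rightarrow> tname \<Rightarrow> com \<Rightarrow> com" where
  "foreach K k c = While (\<lambda>r. r k \<noteq> 0) (c ;; mv K Right) ;; rewind K k"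

text \<open>As the heads in \<open>K\<close> start at cell \<open>0\<close>, rewinding restores the
  store. The loop is thus again a program that only emits and can be nested in another loop.\<close>

lemma emits_foreach:
  assumes k: "k \<in> K" and K: "Out \<notin> K"
    and supp: "\<And>i. snd (\<sigma> k) i \<noteq> 0 \<longleftrightarrow> 0 \<le> i \<and> i < int L"
    and start: "heads K 0 \<sigma> = \<sigma>"
    and body: "\<And>i. i < L \<Longrightarrow> emits c (heads K (int i) \<sigma>) t (g i)"
  shows "emits (foreach K k c) \<sigma> (L * (t + 4) + 4) (concat (map g [0..<L]))"
  unfolding emits_def
proof
  fix v
  have loop: "run (While (\<lambda>r. r k \<noteq> 0) (c ;; mv K Right)) ((heads K (int i) \<sigma>)(Out := outt v)) ((L - i) * (t + 2) + 1)
      (Some ((heads K (int L) \<sigma>)(Out := outt (v @ concat (map g [i..<L])))))" if "i \<le> L" for i v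
    using that
  proof (induction "L - i" arbitrary: i v)
    case 0
    then have "i = L" by simp
    have "k \<noteq> Out" using k K by auto
    then have "reads ((heads K (int L) \<sigma>)(Out := outt v)) k = 0"
      using supp[of "int L"] k by (simp add: reads_upd reads_heads)
    then have "run (While (\<lambda>r. r k \<noteq> 0) (c ;; mv K Right)) ((heads K (int L) \<sigma>)(Out := outt v)) 1
        (Some ((heads K (int L) \<sigma>)(Out := outt v)))"
      by (intro run_while_done) simp
    then show ?case
      by (simp only: \<open>i = L\<close> diff_self_eq_0 mult_0 add_0 upt_rec[of L L] less_irrefl if_False list.map concat.simps append_Nil2)
  next
    case (Suc x)
    then have i: "i < L" by simp
    have "k \<noteq> Out" using k K by auto
    then have r: "reads ((heads K (int i) \<sigma>)(Out := outt v)) k \<noteq> 0"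
      using supp[of "int i"] k i by (simp add: reads_upd reads_heads)
    have 1: "run c ((heads K (int i) \<sigma>)(Out := outt v)) t (Some ((heads K (int i) \<sigma>)(Out := outt (v @ g i))))"
      using body[OF i] unfolding emits_def by blast
    have 2: "run (mv K Right) ((heads K (int i) \<sigma>)(Out := outt (v @ g i))) 1
        (Some ((heads K (int (Suc i)) \<sigma>)(Out := outt (v @ g i))))"
      using run_mv[of K Right "int i" "\<sigma>(Out := outt (v @ g i))"] K by (simp add: heads_Out add.commute)
    have 3: "run (While (\<lambda>r. r k \<noteq> 0) (c ;; mv K Right)) ((heads K (int (Suc i)) \<sigma>)(Out := outt (v @ g i)))
      ((L - Suc i) * (t + 2) + 1) (Some ((heads K (int L) \<sigma>)(Out := outt ((v @ g i) @ concat (map g [Suc i..<L])))))"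
      by (rule Suc(1)) (use Suc(2) i in auto)
    have "L - i = Suc (L - Suc i)" using i by simp
    then have "Suc ((t + 1) + ((L - Suc i) * (t + 2) + 1)) = (L - i) * (t + 2) + 1" by simp
    moreover have "(v @ g i) @ concat (map g [Suc i..<L]) = v @ concat (map g [i..<L])"
      using i by (simp add: upt_conv_Cons)
    ultimately show ?case
      using run_while_step[where b = "\<lambda>r. r k \<noteq> 0", OF r run_seq[OF 1 2] 3] by (simp only:)
  qed
  have rew: "run (rewind K k) ((heads K (int L) \<sigma>)(Out := outt w)) (2 * L + 3) (Some (\<sigma>(Out := outt w)))" for w
  proof -
    have "k \<noteq> Out" using k K by auto
    have "run (rewind K k) (heads K (int L) (\<sigma>(Out := outt w))) (2 * L + 3) (Some (heads K 0 (\<sigma>(Out := outt w))))"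
      by (rule run_rewind[OF k]) (use supp \<open>k \<noteq> Out\<close> in auto)
    then show ?thesis unfolding heads_Out[OF K] start .
  qed
  have "run (foreach K k c) (\<sigma>(Out := outt v)) ((L * (t + 2) + 1) + (2 * L + 3)) (Some (\<sigma>(Out := outt (v @ concat (map g [0..<L])))))"
    unfolding foreach_def using run_seq[OF loop[of 0 v] rew] start by simp
  then show "run (foreach K k c) (\<sigma>(Out := outt v)) (L * (t + 4) + 4) (Some (\<sigma>(Out := outt (v @ concat (map g [0..<L])))))"
    by (rule run_mono) (simp add: algebra_simps)
qed

text \<open>The exponents decided by marks are at most \<open>2\<close>; the value \<open>2\<close>
  arises for \<open>y_r\<close> in the monomials of diagonal entries.\<close>

definition emit_exp :: "((tname \<Rightarrow> nat) \<Rightarrow> nat) \<Rightarrow> com" where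
  "emit_exp h = Cond (\<lambda>r. h r = 0) (emit (enc_nat 0)) (Cond (\<lambda>r. h r = 1) (emit (enc_nat 1)) (emit (enc_nat 2)))"

lemma length_enc_nat_le: "n \<le> 2 \<Longrightarrow> length (enc_nat n) \<le> 8"
proof -
  assume "n \<le> 2"
  then consider "n = 0" | "n = 1" | "n = 2" by linarith
  then show ?thesis
    by cases (simp_all add: enc_nat_def enc_list_def bracket_def enc_bit_def binary.simps)
qed

lemma emits_emit_le: "length bs \<le> 8 \<Longrightarrow> emits (emit bs) \<sigma> 9 bs"
  using emits_mono[OF emits_emit] by simp

lemma emits_emit_exp:
  assumes "h ((reads \<sigma>)(Out := 0)) = n" and "n \<le> 2"
  shows "emits (emit_exp h) \<sigma> 12 (enc_nat n)"
proof -
  have "emits (emit_exp h) \<sigma> (Suc (Suc 9)) (enc_nat n)"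
    unfolding emit_exp_def
  proof (intro emits_cond)
    assume "h ((reads \<sigma>)(Out := 0)) = 0"
    then have "n = 0" using assms by simp
    then show "emits (emit (enc_nat 0)) \<sigma> (Suc 9) (enc_nat n)"
      using emits_mono[OF emits_emit_le[OF length_enc_nat_le[of 0]]] by simp
  next
    assume "h ((reads \<sigma>)(Out := 0)) = 1"
    then show "emits (emit (enc_nat 1)) \<sigma> 9 (enc_nat n)"
      using assms length_enc_nat_le[of 1] emits_emit_le by auto
  next
    assume "h ((reads \<sigma>)(Out := 0)) \<noteq> 0" "h ((reads \<sigma>)(Out := 0)) \<noteq> 1"
    then have "n = 2" using assms by auto
    then show "emits (emit (enc_nat 2)) \<sigma> 9 (enc_nat n)"
      using length_enc_nat_le[of 2] emits_emit_le by auto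
  qed
  then show ?thesis by (rule emits_mono) simp
qed

text \<open>\<open>Mats\<close>, \<open>Rows\<close> and \<open>Cols\<close> have one cell for every matrix, row and column; a \<open>2\<close> in a cell marks
  the index of the current entry. The variables of the polynomial are listed in the order
  \<open>e, (x\<^sub>i)\<^sub>i, (g\<^sub>i)\<^sub>i, (y\<^sub>r)\<^sub>r, (a\<^sub>r\<^sub>s)\<^sub>r\<^sub>,\<^sub>s\<close>; swapping \<open>p\<close> and \<open>q\<close> transposes the marked pair \<open>(r, s)\<close>.\<close>

definition sweep :: "com \<Rightarrow> com \<Rightarrow> com \<Rightarrow> com \<Rightarrow> com \<Rightarrow> tname \<Rightarrow> tname \<Rightarrow> com" where
  "sweep c cx cg cy ca p q = c ;; foreach {Mats} Mats cx ;; foreach {Mats} Mats cg ;;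
     foreach {Rows, Cols} Rows cy ;; foreach {p} p (foreach {q} q ca)"

lemma emits_sweep:
  assumes X: "\<sigma> Mats = tp 0 X" "0 \<notin> set X" "length X = n"
    and R: "\<sigma> Rows = tp 0 R" "0 \<notin> set R" "length R = m"
    and C: "\<sigma> Cols = tp 0 C" "0 \<notin> set C" "length C = m"
    and pq: "p \<noteq> q" "p = Rows \<or> p = Cols" "q = Rows \<or> q = Cols"
    and c: "emits c \<sigma> 12 s"
    and cx: "\<And>i. i < n \<Longrightarrow> emits cx (heads {Mats} (int i) \<sigma>) 12 (gx i)"
    and cg: "\<And>i. i < n \<Longrightarrow> emits cg (heads {Mats} (int i) \<sigma>) 12 (gg i)"
    and cy: "\<And>i. i < m \<Longrightarrow> emits cy (heads {Rows, Cols} (int i) \<sigma>) 12 (gy i)"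
    and ca: "\<And>i j. i < m \<Longrightarrow> j < m \<Longrightarrow> emits ca (heads {q} (int j) (heads {p} (int i) \<sigma>)) 12 (ga i j)"
    and Q: "n \<le> Q" "m \<le> Q" "Q \<ge> 1"
  shows "emits (sweep c cx cg cy ca p q) \<sigma> (120 * Q * Q)
    (s @ concat (map gx [0..<n]) @ concat (map gg [0..<n]) @ concat (map gy [0..<m]) @
      concat (map (\<lambda>i. concat (map (ga i) [0..<m])) [0..<m]))"
proof -
  have sX: "snd (\<sigma> Mats) i \<noteq> 0 \<longleftrightarrow> 0 \<le> i \<and> i < int n" for i using X tp_nonzero by metis
  have sR: "snd (\<sigma> Rows) i \<noteq> 0 \<longleftrightarrow> 0 \<le> i \<and> i < int m" for i using R tp_nonzero by metis
  have sC: "snd (\<sigma> Cols) i \<noteq> 0 \<longleftrightarrow> 0 \<le> i \<and> i < int m" for i using C tp_nonzero by metis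
  have h0: "heads K 0 \<sigma> = \<sigma>" if "K \<subseteq> {Mats, Rows, Cols}" for K
    using that X(1) R(1) C(1) by (auto simp: heads_def fun_eq_iff tp_def)
  have 1: "emits (foreach {Mats} Mats cx) \<sigma> (n * (12 + 4) + 4) (concat (map gx [0..<n]))"
    by (rule emits_foreach) (use sX h0 cx in auto)
  have 2: "emits (foreach {Mats} Mats cg) \<sigma> (n * (12 + 4) + 4) (concat (map gg [0..<n]))"
    by (rule emits_foreach) (use sX h0 cg in auto)
  have 3: "emits (foreach {Rows, Cols} Rows cy) \<sigma> (m * (12 + 4) + 4) (concat (map gy [0..<m]))"
    by (rule emits_foreach) (use sR h0 cy in auto)
  have sp: "snd (\<sigma> p) i \<noteq> 0 \<longleftrightarrow> 0 \<le> i \<and> i < int m" for i using pq sR sC by auto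
  have sq: "snd (\<sigma> q) i \<noteq> 0 \<longleftrightarrow> 0 \<le> i \<and> i < int m" for i using pq sR sC by auto
  have 4: "emits (foreach {p} p (foreach {q} q ca)) \<sigma> (m * ((m * (12 + 4) + 4) + 4) + 4)
      (concat (map (\<lambda>i. concat (map (ga i) [0..<m])) [0..<m]))"
  proof (rule emits_foreach)
    show "heads {p} 0 \<sigma> = \<sigma>" using h0 pq by auto
    fix i assume i: "i < m"
    show "emits (foreach {q} q ca) (heads {p} (int i) \<sigma>) (m * (12 + 4) + 4) (concat (map (ga i) [0..<m]))"
    proof (rule emits_foreach)
      show "heads {q} 0 (heads {p} (int i) \<sigma>) = heads {p} (int i) \<sigma>"
        using h0[of "{q}"] pq by (auto simp: heads_def fun_eq_iff split: if_splits)
      show "snd (heads {p} (int i) \<sigma> q) j \<noteq> 0 \<longleftrightarrow> 0 \<le> j \<and> j < int m" for j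
        using sq pq by (auto simp: heads_def)
    qed (use ca i pq in auto)
  qed (use sp pq in auto)
  have "emits (sweep c cx cg cy ca p q) \<sigma>
      (12 + ((n * (12 + 4) + 4) + ((n * (12 + 4) + 4) + ((m * (12 + 4) + 4) + (m * ((m * (12 + 4) + 4) + 4) + 4)))))
    (s @ concat (map gx [0..<n]) @ concat (map gg [0..<n]) @ concat (map gy [0..<m]) @
      concat (map (\<lambda>i. concat (map (ga i) [0..<m])) [0..<m]))"
    unfolding sweep_def by (intro emits_seq c 1 2 3 4)
  \<comment> \<open>The left side is \<open>28 + 32 n + 24 m + 16 m^2\<close>; its coefficients add
    up to \<open>100\<close>, and every monomial is at most \<open>Q * Q\<close>.\<close>
  moreover have "12 + ((n * (12 + 4) + 4) + ((n * (12 + 4) + 4) + ((m * (12 + 4) + 4) + (m * ((m * (12 + 4) + 4) + 4) + 4)))) \<le> 120 * Q * Q"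
  proof -
    define S where "S = Q * Q"
    have "Q \<le> S" "m * m \<le> S" using Q by (auto simp: S_def intro: mult_le_mono)
    then have "28 + 24 * m + 32 * n + 16 * (m * m) \<le> 120 * S" using Q by linarith
    then show ?thesis by (simp add: algebra_simps S_def)
  qed
  ultimately show ?thesis by (rule emits_mono)
qed

section \<open>Writing the terms of the polynomial\<close>

text \<open>The symbols \<open>1\<close> and \<open>2\<close> stand for the bits; a bracket is written as an odd (opening) or even
  (closing) symbol that also tells its nesting depth, from \<open>11, 12\<close> for the whole instance down to
  \<open>5, 6\<close> for a rational and \<open>3, 4\<close> for its numerator and denominator. The digits are not inspected,
  and copied verbatim into the polynomial: numbers in a non-canonical form, such as fractions that
  are not reduced, are thus rejected by the machine for \<open>CUBIC_SOP\<close>.\<close>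

definition code :: "nat \<Rightarrow> bool list" where
  "code s = [3 \<le> s, s = 2 \<or> 4 \<le> s \<and> even s]"

text \<open>The uninterpreted digits of the numerator, sign included, and of the
  denominator.\<close>

type_synonym raw = "bool list \<times> bool list"

definition rat_syms :: "raw \<Rightarrow> nat list" where
  "rat_syms x = [5, 3] @ map bsym (fst x) @ [4, 3] @ map bsym (snd x) @ [4, 6]"

definition row_syms :: "raw list \<Rightarrow> nat list" where
  "row_syms xs = [7] @ concat (map rat_syms xs) @ [8]"

definition mat_syms :: "raw list list \<Rightarrow> nat list" where
  "mat_syms xs = [9] @ concat (map row_syms xs) @ [10]"

definition all_syms :: "raw list list list \<Rightarrow> nat list" where
  "all_syms xs = [11] @ concat (map mat_syms xs) @ [12]"

definition raw_enc :: "raw \<Rightarrow> bool list" where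
  "raw_enc x = concat (map code (rat_syms x))"

definition emit_code :: com where
  "emit_code = put (\<lambda>r. 3 \<le> r Tok) ;; put (\<lambda>r. r Tok = 2 \<or> 4 \<le> r Tok \<and> even (r Tok))"

lemma emits_emit_code: "emits emit_code \<sigma> 2 (code (reads \<sigma> Tok))"
  using emits_seq[OF emits_put emits_put] unfolding emit_code_def code_def
  by (fastforce simp: numeral_eq_Suc elim: back_subst[where P = "emits _ _ _"])

lemma run_mv1: "\<sigma> k = tp p xs \<Longrightarrow> run (mv {k} d) \<sigma> 1 (Some (\<sigma>(k := tp (p + offset d) xs)))"
  unfolding mv_def
proof (rule run_act[OF refl], rule ext)
  fix j
  assume "\<sigma> k = tp p xs"
  then show "perform (\<lambda>j. (reads \<sigma> j, if j \<in> {k} then d else Stay)) \<sigma> j = (\<sigma>(k := tp (p + offset d) xs)) j"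
    by (cases "j = k") (simp_all add: perform_def reads_def act_tp_keep, simp add: act_keep)
qed

lemma run_rewind1:
  assumes "\<sigma> k = tp (int j) xs" "j \<le> length xs" "0 \<notin> set xs"
  shows "run (rewind {k} k) \<sigma> (2 * j + 3) (Some (\<sigma>(k := tp 0 xs)))"
proof -
  have "heads {k} (int j) \<sigma> = \<sigma>" "heads {k} 0 \<sigma> = \<sigma>(k := tp 0 xs)"
    using assms(1) by (auto simp: heads_def tp_def fun_eq_iff)
  moreover have "snd (\<sigma> k) i \<noteq> 0 \<longleftrightarrow> 0 \<le> i \<and> i < int (length xs)" for i
    using assms tp_nonzero by metis
  ultimately show ?thesis using run_rewind[of k "{k}" \<sigma> "length xs" j] assms(2) by simp
qed

lemma run_seek:
  assumes "\<sigma> k = tp p ys"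
    and "\<And>j. j < n \<Longrightarrow> read_tape (tp (p + int j * offset d) ys) \<noteq> s"
    and "read_tape (tp (p + int n * offset d) ys) = s"
  shows "run (While (\<lambda>r. r k \<noteq> s) (mv {k} d)) \<sigma> (2 * n + 1) (Some (\<sigma>(k := tp (p + int n * offset d) ys)))"
  using assms
proof (induction n arbitrary: \<sigma> p)
  case 0
  then have e: "\<sigma>(k := tp (p + int 0 * offset d) ys) = \<sigma>" "2 * 0 + 1 = (1::nat)" by auto
  have "\<not> reads \<sigma> k \<noteq> s" using 0 by (simp add: reads_def)
  then show ?case unfolding e by (rule run_while_done)
next
  case (Suc n)
  have 1: "reads \<sigma> k \<noteq> s" using Suc.prems(1) Suc.prems(2)[of 0] by (simp add: reads_def)
  have 2: "run (While (\<lambda>r. r k \<noteq> s) (mv {k} d)) (\<sigma>(k := tp (p + offset d) ys)) (2 * n + 1)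
      (Some ((\<sigma>(k := tp (p + offset d) ys))(k := tp (p + offset d + int n * offset d) ys)))"
  proof (rule Suc.IH)
    show "read_tape (tp (p + offset d + int j * offset d) ys) \<noteq> s" if "j < n" for j
      using Suc.prems(2)[of "Suc j"] that by (simp add: algebra_simps)
    show "read_tape (tp (p + offset d + int n * offset d) ys) = s"
      using Suc.prems(3) by (simp add: algebra_simps)
  qed simp
  have m: "run (mv {k} d) \<sigma> 1 (Some (\<sigma>(k := tp (p + offset d) ys)))"
    by (rule run_mv1[of \<sigma> k p ys]) (rule Suc.prems(1))
  have e: "p + offset d + int n * offset d = p + int (Suc n) * offset d" "Suc (1 + (2 * n + 1)) = 2 * Suc n + 1"
    by (simp_all add: algebra_simps)
  show ?case
    using run_while_step[where b = "\<lambda>r. r k \<noteq> s", OF 1 m 2] unfolding e fun_upd_upd .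
qed

text \<open>Within a rational, \<open>5\<close> occurs only as the first and \<open>6\<close> only
  as the last symbol, so they delimit the copying and the way back. Returning to the start matters
  because the coefficient is copied three times, once for each monomial of the entry.\<close>

definition copy_rat :: com where
  "copy_rat = While (\<lambda>r. r Tok \<noteq> 6) (emit_code ;; mv {Tok} Right) ;; emit_code ;;
     While (\<lambda>r. r Tok \<noteq> 5) (mv {Tok} Left)"

lemma run_copy_loop:
  assumes "\<sigma> Tok = tp (int (length pre)) (pre @ xs @ 6 # post)" "6 \<notin> set xs"
  shows "run (While (\<lambda>r. r Tok \<noteq> 6) (emit_code ;; mv {Tok} Right)) (\<sigma>(Out := outt v)) (4 * length xs + 1)
    (Some (\<sigma>(Tok := tp (int (length pre + length xs)) (pre @ xs @ 6 # post), Out := outt (v @ concat (map code xs)))))"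
  using assms
proof (induction xs arbitrary: pre v \<sigma>)
  case Nil
  then have e: "\<sigma>(Tok := tp (int (length pre + length ([]::nat list))) (pre @ [] @ 6 # post)) = \<sigma>"
    "v @ concat (map code []) = v" "4 * length ([]::nat list) + 1 = 1" by auto
  have "\<not> reads (\<sigma>(Out := outt v)) Tok \<noteq> 6" using Nil by (simp add: reads_def read_tp_nat)
  then show ?case unfolding e by (rule run_while_done)
next
  case (Cons x xs)
  have r: "reads \<sigma> Tok = x" using Cons.prems by (simp add: reads_def read_tp_nat)
  have 1: "run emit_code (\<sigma>(Out := outt v)) 2 (Some (\<sigma>(Out := outt (v @ code x))))"
    using emits_emit_code[of \<sigma>] unfolding emits_def r by blast
  let ?\<sigma> = "\<sigma>(Tok := tp (int (length (pre @ [x]))) ((pre @ [x]) @ xs @ 6 # post))"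
  have 2: "run (mv {Tok} Right) (\<sigma>(Out := outt (v @ code x))) 1 (Some (?\<sigma>(Out := outt (v @ code x))))"
    using run_mv1[of "\<sigma>(Out := outt (v @ code x))" Tok "int (length pre)" "pre @ (x # xs) @ 6 # post" Right] Cons.prems(1)
    by (simp add: add.commute fun_upd_twist)
  have 3: "run (While (\<lambda>r. r Tok \<noteq> 6) (emit_code ;; mv {Tok} Right)) (?\<sigma>(Out := outt (v @ code x))) (4 * length xs + 1)
    (Some (?\<sigma>(Tok := tp (int (length (pre @ [x]) + length xs)) ((pre @ [x]) @ xs @ 6 # post),
      Out := outt ((v @ code x) @ concat (map code xs)))))"
    by (rule Cons.IH) (use Cons.prems in auto)
  have r': "reads (\<sigma>(Out := outt v)) Tok \<noteq> 6" using r Cons.prems(2) by (auto simp: reads_upd)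
  have e: "pre @ (x # xs) @ 6 # post = (pre @ [x]) @ xs @ 6 # post"
    "length pre + length (x # xs) = length (pre @ [x]) + length xs"
    "v @ concat (map code (x # xs)) = (v @ code x) @ concat (map code xs)"
    "4 * length (x # xs) + 1 = Suc (2 + 1 + (4 * length xs + 1))" by simp_all
  show ?case
    using run_while_step[where b = "\<lambda>r. r Tok \<noteq> 6", OF r' run_seq[OF 1 2] 3] unfolding e fun_upd_upd .
qed

lemma bsym_neq: "bsym b \<noteq> 0" "s > 2 \<Longrightarrow> bsym b \<noteq> s"
  by (auto simp: bsym_def)

lemma emits_copy_rat:
  assumes tok: "\<sigma> Tok = tp (int (length pre)) (pre @ rat_syms x @ post)"
  shows "emits copy_rat \<sigma> (6 * length (rat_syms x)) (raw_enc x)"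
  unfolding emits_def
proof
  fix v
  define xs where "xs = [5, 3] @ map bsym (fst x) @ [4, 3] @ map bsym (snd x) @ [4]"
  have rs: "rat_syms x = xs @ [6]" by (simp add: rat_syms_def xs_def)
  have x6: "6 \<notin> set xs" using bsym_neq(2)[of 6] by (auto simp: xs_def dest: sym)
  have x5: "xs ! 0 = 5" "\<And>j. 0 < j \<Longrightarrow> j < length xs \<Longrightarrow> xs ! j \<noteq> 5"
  proof -
    show "xs ! 0 = 5" by (simp add: xs_def)
    fix j assume j: "0 < j" "j < length xs"
    have "xs ! j = tl xs ! (j - 1)" "j - 1 < length (tl xs)" using j by (auto simp: nth_tl)
    then have "xs ! j \<in> set (tl xs)" by (metis nth_mem)
    moreover have "5 \<notin> set (tl xs)" using bsym_neq(2)[of 5] by (auto simp: xs_def dest: sym)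
    ultimately show "xs ! j \<noteq> 5" by auto
  qed
  define ys where "ys = pre @ xs @ 6 # post"
  have tok': "\<sigma> Tok = tp (int (length pre)) (pre @ xs @ 6 # post)" using tok rs by simp
  define \<sigma>1 where "\<sigma>1 = \<sigma>(Tok := tp (int (length pre + length xs)) ys)"
  have 1: "run (While (\<lambda>r. r Tok \<noteq> 6) (emit_code ;; mv {Tok} Right)) (\<sigma>(Out := outt v)) (4 * length xs + 1)
    (Some (\<sigma>1(Out := outt (v @ concat (map code xs)))))"
    using run_copy_loop[of \<sigma>, OF tok' x6] unfolding \<sigma>1_def ys_def .
  have "reads \<sigma>1 Tok = 6" unfolding \<sigma>1_def reads_def fun_upd_same read_tp_nat by (simp add: ys_def nth_append)
  then have 2: "run emit_code (\<sigma>1(Out := outt (v @ concat (map code xs)))) 2 (Some (\<sigma>1(Out := outt (v @ raw_enc x))))"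
    using emits_emit_code[of \<sigma>1] unfolding emits_def by (simp add: raw_enc_def rs flip: append_assoc)
  have 3: "run (While (\<lambda>r. r Tok \<noteq> 5) (mv {Tok} Left)) (\<sigma>1(Out := outt (v @ raw_enc x))) (2 * length xs + 1)
     (Some ((\<sigma>1(Out := outt (v @ raw_enc x)))(Tok := tp (int (length pre + length xs) + int (length xs) * offset Left) ys)))"
  proof (rule run_seek)
    show "read_tape (tp (int (length pre + length xs) + int j * offset Left) ys) \<noteq> 5" if "j < length xs" for j
    proof -
      have "int (length pre + length xs) + int j * offset Left = int (length pre + (length xs - j))" using that by simp
      moreover have "read_tape (tp (int (length pre + (length xs - j))) ys) \<noteq> 5"
        unfolding read_tp_nat using x5(2)[of "length xs - j"] that by (cases j) (auto simp: ys_def nth_append)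
      ultimately show ?thesis by metis
    qed
    have "length xs > 0" by (simp add: xs_def)
    then show "read_tape (tp (int (length pre + length xs) + int (length xs) * offset Left) ys) = 5"
      using x5(1) by (simp add: read_tp_nat ys_def nth_append)
  qed (simp add: \<sigma>1_def)
  have "(\<sigma>1(Out := outt (v @ raw_enc x)))(Tok := tp (int (length pre + length xs) + int (length xs) * offset Left) ys)
      = \<sigma>(Out := outt (v @ raw_enc x))"
    using tok' by (auto simp: \<sigma>1_def ys_def fun_eq_iff)
  with run_seq[OF 1 run_seq[OF 2 3]] have
    "run copy_rat (\<sigma>(Out := outt v)) (4 * length xs + 1 + (2 + (2 * length xs + 1))) (Some (\<sigma>(Out := outt (v @ raw_enc x))))"
    unfolding copy_rat_def by simp
  then show "run copy_rat (\<sigma>(Out := outt v)) (6 * length (rat_syms x)) (Some (\<sigma>(Out := outt (v @ raw_enc x))))"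
    by (rule run_mono) (simp add: rs)
qed

section \<open>Terms with copied coefficients\<close>

definition raw_term :: "bool list \<Rightarrow> nat list \<Rightarrow> bool list" where
  "raw_term c es = bracket (c @ enc_list enc_nat es)"

definition exps :: "nat \<Rightarrow> nat \<Rightarrow> nat \<Rightarrow> (nat \<Rightarrow> nat) \<Rightarrow> (nat \<Rightarrow> nat) \<Rightarrow> (nat \<Rightarrow> nat) \<Rightarrow> (nat \<Rightarrow> nat \<Rightarrow> nat) \<Rightarrow> nat list" where
  "exps n m e gx gg gy ga = e # map gx [0..<n] @ map gg [0..<n] @ map gy [0..<m] @
     concat (map (\<lambda>i. map (ga i) [0..<m]) [0..<m])"

definition term_prog :: "com \<Rightarrow> com \<Rightarrow> com" where
  "term_prog c d = emit [True, False] ;; c ;; emit [True, False] ;; d ;; emit [True, True, True, True]"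

definition vec_prog :: "nat \<Rightarrow> ((tname \<Rightarrow> nat) \<Rightarrow> nat) \<Rightarrow> ((tname \<Rightarrow> nat) \<Rightarrow> nat) \<Rightarrow> ((tname \<Rightarrow> nat) \<Rightarrow> nat) \<Rightarrow>
    ((tname \<Rightarrow> nat) \<Rightarrow> nat) \<Rightarrow> tname \<Rightarrow> tname \<Rightarrow> com" where
  "vec_prog e hx hg hy ha = sweep (emit (enc_nat e)) (emit_exp hx) (emit_exp hg) (emit_exp hy) (emit_exp ha)"

lemma emits_term_prog:
  assumes "emits c \<sigma> t s" "emits d \<sigma> t' (concat (map enc_nat es))"
  shows "emits (term_prog c d) \<sigma> (t + t' + 11) (raw_term s es)"
proof -
  have "emits (term_prog c d) \<sigma> (Suc (length [True, False]) + (t + (Suc (length [True, False]) + (t' + Suc (length [True, True, True, True])))))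
     ([True, False] @ s @ [True, False] @ concat (map enc_nat es) @ [True, True, True, True])"
    unfolding term_prog_def by (intro emits_seq emits_emit assms)
  then show ?thesis
    by (simp add: raw_term_def bracket_def enc_list_def add_ac numeral_eq_Suc)
qed

lemma emits_vec_prog:
  assumes X: "\<sigma> Mats = tp 0 X" "0 \<notin> set X" "length X = n"
    and R: "\<sigma> Rows = tp 0 R" "0 \<notin> set R" "length R = m"
    and C: "\<sigma> Cols = tp 0 C" "0 \<notin> set C" "length C = m"
    and pq: "p \<noteq> q" "p = Rows \<or> p = Cols" "q = Rows \<or> q = Cols"
    and e: "e \<le> 2"
    and hx: "\<And>i. i < n \<Longrightarrow> hx ((reads \<sigma>)(Out := 0, Mats := X ! i)) = gx i \<and> gx i \<le> 2"
    and hg: "\<And>i. i < n \<Longrightarrow> hg ((reads \<sigma>)(Out := 0, Mats := X ! i)) = gg i \<and> gg i \<le> 2"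
    and hy: "\<And>i. i < m \<Longrightarrow> hy ((reads \<sigma>)(Out := 0, Rows := R ! i, Cols := C ! i)) = gy i \<and> gy i \<le> 2"
    and ha: "\<And>i j. i < m \<Longrightarrow> j < m \<Longrightarrow>
      ha (if p = Rows then (reads \<sigma>)(Out := 0, Rows := R ! i, Cols := C ! j) else (reads \<sigma>)(Out := 0, Rows := R ! j, Cols := C ! i)) = ga i j \<and> ga i j \<le> 2"
    and Q: "n \<le> Q" "m \<le> Q" "Q \<ge> 1"
  shows "emits (vec_prog e hx hg hy ha p q) \<sigma> (120 * Q * Q) (concat (map enc_nat (exps n m e gx gg gy ga)))"
proof -
  have tpn: "snd (tp 0 xs) (int i) = xs ! i" if "i < length xs" for xs i
    using that by (simp add: tp_def)
  have "emits (vec_prog e hx hg hy ha p q) \<sigma> (120 * Q * Q)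
     (enc_nat e @ concat (map (\<lambda>i. enc_nat (gx i)) [0..<n]) @ concat (map (\<lambda>i. enc_nat (gg i)) [0..<n]) @
      concat (map (\<lambda>i. enc_nat (gy i)) [0..<m]) @
      concat (map (\<lambda>i. concat (map (\<lambda>j. enc_nat (ga i j)) [0..<m])) [0..<m]))"
    unfolding vec_prog_def
  proof (rule emits_sweep[OF X R C pq _ _ _ _ _ Q])
    show "emits (emit (enc_nat e)) \<sigma> 12 (enc_nat e)"
      using length_enc_nat_le[OF e] by (intro emits_mono[OF emits_emit]) simp
    show "emits (emit_exp hx) (heads {Mats} (int i) \<sigma>) 12 (enc_nat (gx i))" if "i < n" for i
    proof (rule emits_emit_exp)
      have "(reads (heads {Mats} (int i) \<sigma>))(Out := 0) = (reads \<sigma>)(Out := 0, Mats := X ! i)"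
        using X that tpn by (auto simp: fun_eq_iff heads_def reads_def)
      then show "hx ((reads (heads {Mats} (int i) \<sigma>))(Out := 0)) = gx i" using hx[OF that] by simp
    qed (use hx[OF that] in simp)
    show "emits (emit_exp hg) (heads {Mats} (int i) \<sigma>) 12 (enc_nat (gg i))" if "i < n" for i
    proof (rule emits_emit_exp)
      have "(reads (heads {Mats} (int i) \<sigma>))(Out := 0) = (reads \<sigma>)(Out := 0, Mats := X ! i)"
        using X that tpn by (auto simp: fun_eq_iff heads_def reads_def)
      then show "hg ((reads (heads {Mats} (int i) \<sigma>))(Out := 0)) = gg i" using hg[OF that] by simp
    qed (use hg[OF that] in simp)
    show "emits (emit_exp hy) (heads {Rows, Cols} (int i) \<sigma>) 12 (enc_nat (gy i))" if "i < m" for i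
    proof (rule emits_emit_exp)
      have "(reads (heads {Rows, Cols} (int i) \<sigma>))(Out := 0) = (reads \<sigma>)(Out := 0, Rows := R ! i, Cols := C ! i)"
        using R C that tpn by (auto simp: fun_eq_iff heads_def reads_def)
      then show "hy ((reads (heads {Rows, Cols} (int i) \<sigma>))(Out := 0)) = gy i" using hy[OF that] by simp
    qed (use hy[OF that] in simp)
    show "emits (emit_exp ha) (heads {q} (int j) (heads {p} (int i) \<sigma>)) 12 (enc_nat (ga i j))" if "i < m" "j < m" for i j
    proof (rule emits_emit_exp)
      have "(reads (heads {q} (int j) (heads {p} (int i) \<sigma>)))(Out := 0) =
        (if p = Rows then (reads \<sigma>)(Out := 0, Rows := R ! i, Cols := C ! j) else (reads \<sigma>)(Out := 0, Rows := R ! j, Cols := C ! i))"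
        using R C pq that tpn by (auto simp: fun_eq_iff heads_def reads_def)
      then show "ha ((reads (heads {q} (int j) (heads {p} (int i) \<sigma>)))(Out := 0)) = ga i j" using ha[OF that] by simp
    qed (use ha[OF that] in simp)
  qed
  moreover have "concat (map f (concat (map g xs))) = concat (map (\<lambda>x. concat (map f (g x))) xs)"
    for f :: "nat \<Rightarrow> bool list" and g :: "nat \<Rightarrow> nat list" and xs
    by (induction xs) auto
  ultimately show ?thesis
    by (simp add: exps_def o_def)
qed

text \<open>A normal form for stores: an update of one of these six tapes is absorbed into an
  argument, so the stores along a chain of runs stay terms of the same shape.\<close>

definition stg :: "store \<Rightarrow> tape \<Rightarrow> tape \<Rightarrow> tape \<Rightarrow> tape \<Rightarrow> tape \<Rightarrow> tape \<Rightarrow> store" where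
  "stg \<rho> tok fl ma ro co ou = \<rho>(Tok := tok, Flag := fl, Mats := ma, Rows := ro, Cols := co, Out := ou)"

lemma stg_upd [simp]:
  "(stg \<rho> tok fl ma ro co ou)(Tok := x) = stg \<rho> x fl ma ro co ou"
  "(stg \<rho> tok fl ma ro co ou)(Flag := x) = stg \<rho> tok x ma ro co ou"
  "(stg \<rho> tok fl ma ro co ou)(Mats := x) = stg \<rho> tok fl x ro co ou"
  "(stg \<rho> tok fl ma ro co ou)(Rows := x) = stg \<rho> tok fl ma x co ou"
  "(stg \<rho> tok fl ma ro co ou)(Cols := x) = stg \<rho> tok fl ma ro x ou"
  "(stg \<rho> tok fl ma ro co ou)(Out := x) = stg \<rho> tok fl ma ro co x"
  by (auto simp: stg_def fun_eq_iff)

lemma stg_sel [simp]: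
  "stg \<rho> tok fl ma ro co ou Tok = tok" "stg \<rho> tok fl ma ro co ou Flag = fl"
  "stg \<rho> tok fl ma ro co ou Mats = ma" "stg \<rho> tok fl ma ro co ou Rows = ro"
  "stg \<rho> tok fl ma ro co ou Cols = co" "stg \<rho> tok fl ma ro co ou Out = ou"
  by (auto simp: stg_def)

lemma reads_stg [simp]:
  "reads (stg \<rho> tok fl ma ro co ou) Tok = read_tape tok" "reads (stg \<rho> tok fl ma ro co ou) Flag = read_tape fl"
  "reads (stg \<rho> tok fl ma ro co ou) Mats = read_tape ma" "reads (stg \<rho> tok fl ma ro co ou) Rows = read_tape ro"
  "reads (stg \<rho> tok fl ma ro co ou) Cols = read_tape co"
  by (auto simp: reads_def)

lemma emits_stg:
  "emits c (stg \<rho> tok fl ma ro co ou) t s \<Longrightarrow>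
    run c (stg \<rho> tok fl ma ro co (outt v)) t (Some (stg \<rho> tok fl ma ro co (outt (v @ s))))"
  by (simp add: emits_def)

section \<open>The terms of one matrix entry\<close>

definition guard :: "((tname \<Rightarrow> nat) \<Rightarrow> bool) \<Rightarrow> com" where
  "guard b = Act (\<lambda>r. if b r then Some (keep r) else None)"

lemma run_guard: "b (reads \<sigma>) \<Longrightarrow> run (guard b) \<sigma> 1 (Some \<sigma>)"
  unfolding guard_def by (rule run_act) auto

lemma run_guard_stuck: "\<not> b (reads \<sigma>) \<Longrightarrow> run (guard b) \<sigma> t None"
  unfolding guard_def by (rule run_act_stuck) auto

text \<open>Getting stuck off the ones is the bounds check: an entry in a row or column beyond the
  size meets a blank on \<open>Rows\<close> or \<open>Cols\<close>.\<close>

definition mark :: com where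
  "mark = Act (\<lambda>r. if r Mats = 1 \<and> r Rows = 1 \<and> r Cols = 1
     then Some ((keep r)(Mats := (2, Stay), Rows := (2, Stay), Cols := (2, Stay))) else None)"

definition unmark :: com where
  "unmark = Act (\<lambda>r. Some ((keep r)(Mats := (1, Stay), Rows := (1, Stay), Cols := (1, Right))))"

text \<open>\<open>Flag\<close> is nonzero except while the matrix \<open>A\<^sub>0\<close> is processed.\<close>

definition mark_x :: "(tname \<Rightarrow> nat) \<Rightarrow> nat" where
  "mark_x r = of_bool (r Mats = 2 \<and> r Flag \<noteq> 0)"

definition mark_g :: "(tname \<Rightarrow> nat) \<Rightarrow> nat" where
  "mark_g r = of_bool (r Mats = 2)"

definition mark_y :: "(tname \<Rightarrow> nat) \<Rightarrow> nat" where
  "mark_y r = of_bool (r Rows = 2) + of_bool (r Cols = 2)"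

definition mark_a :: "(tname \<Rightarrow> nat) \<Rightarrow> nat" where
  "mark_a r = of_bool (r Rows = 2 \<and> r Cols = 2)"

abbreviation no_mark :: "(tname \<Rightarrow> nat) \<Rightarrow> nat" where
  "no_mark \<equiv> \<lambda>_. 0"

text \<open>Between entries, the head positions on \<open>Mats\<close>, \<open>Rows\<close> and
  \<open>Cols\<close> are the indices \<open>i, r, s\<close>. The sweeps need these heads
  themselves, so meanwhile the indices are kept as marks in the tape contents, and the heads find
  them again afterwards. Removing the marks advances \<open>Cols\<close> to the next column.\<close>

definition entry :: com where
  "entry = mark ;; rewind {Mats} Mats ;; rewind {Rows} Rows ;; rewind {Cols} Cols ;;
     term_prog copy_rat (vec_prog 0 mark_x no_mark mark_y no_mark Rows Cols) ;;
     term_prog copy_rat (vec_prog 0 no_mark mark_g no_mark mark_a Rows Cols) ;;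
     term_prog copy_rat (vec_prog 1 no_mark mark_g no_mark mark_a Cols Rows) ;;
     While (\<lambda>r. r Mats \<noteq> 2) (mv {Mats} Right) ;;
     While (\<lambda>r. r Rows \<noteq> 2) (mv {Rows} Right) ;;
     While (\<lambda>r. r Cols \<noteq> 2) (mv {Cols} Right) ;; unmark ;;
     While (\<lambda>r. r Tok \<noteq> 6) (mv {Tok} Right) ;; mv {Tok} Right"

text \<open>The monomials \<open>x\<^sub>i y\<^sub>r y\<^sub>s\<close> (without \<open>x\<^sub>i\<close> if \<open>i = 0\<close>), \<open>g\<^sub>i a\<^sub>r\<^sub>s\<close> and \<open>e g\<^sub>i a\<^sub>s\<^sub>r\<close>.\<close>

definition exps1 :: "nat \<Rightarrow> nat \<Rightarrow> nat \<Rightarrow> nat \<Rightarrow> nat \<Rightarrow> nat list" where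
  "exps1 n m i r s = exps n m 0 (\<lambda>j. of_bool (j = i \<and> 0 < i)) (\<lambda>_. 0) (\<lambda>j. of_bool (j = r) + of_bool (j = s)) (\<lambda>_ _. 0)"

definition exps2 :: "nat \<Rightarrow> nat \<Rightarrow> nat \<Rightarrow> nat \<Rightarrow> nat \<Rightarrow> nat list" where
  "exps2 n m i r s = exps n m 0 (\<lambda>_. 0) (\<lambda>j. of_bool (j = i)) (\<lambda>_. 0) (\<lambda>p q. of_bool (p = r \<and> q = s))"

definition exps3 :: "nat \<Rightarrow> nat \<Rightarrow> nat \<Rightarrow> nat \<Rightarrow> nat \<Rightarrow> nat list" where
  "exps3 n m i r s = exps n m 1 (\<lambda>_. 0) (\<lambda>j. of_bool (j = i)) (\<lambda>_. 0) (\<lambda>p q. of_bool (p = s \<and> q = r))"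

definition entry_out :: "nat \<Rightarrow> nat \<Rightarrow> nat \<Rightarrow> nat \<Rightarrow> nat \<Rightarrow> raw \<Rightarrow> bool list" where
  "entry_out n m i r s x = raw_term (raw_enc x) (exps1 n m i r s) @ raw_term (raw_enc x) (exps2 n m i r s) @
     raw_term (raw_enc x) (exps3 n m i r s)"

abbreviation ones :: "nat \<Rightarrow> nat list" where
  "ones n \<equiv> replicate n 1"

definition flg :: "bool \<Rightarrow> tape" where
  "flg f = tp 0 (if f then [1] else [])"

lemma read_flg [simp]: "read_tape (flg f) = of_bool f"
  by (simp add: flg_def read_tp)

lemma read_mark:
  "i < n \<Longrightarrow> read_tape (tp (0 + int j * offset Right) ((ones n)[i := 2])) = 2 \<longleftrightarrow> j = i"
  by (auto simp: tp_def nth_list_update)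

lemma run_seek_mark:
  assumes "i < n" "\<sigma> k = tp 0 ((ones n)[i := 2])"
  shows "run (While (\<lambda>r. r k \<noteq> 2) (mv {k} Right)) \<sigma> (2 * i + 1) (Some (\<sigma>(k := tp (int i) ((ones n)[i := 2]))))"
  using run_seek[of \<sigma> k 0 "(ones n)[i := 2]" i Right 2] assms read_mark[OF assms(1)] by auto

lemma zero_notin_marked: "0 \<notin> set ((ones n)[i := 2])"
  using set_update_subset_insert[of "ones n" i 2] by auto

lemma marked_back: "(xs[i := (2::nat)])[i := 1] = xs[i := 1]" "(ones n)[i := 1] = ones n"
proof -
  show "(ones n)[i := 1] = ones n"
  proof (rule nth_equalityI)
    show "(ones n)[i := 1] ! j = ones n ! j" if "j < length ((ones n)[i := 1])" for j
      using that by (cases "j = i") auto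
  qed simp
qed simp

lemma run_entry:
  assumes b: "i < n" "r < m" "s < m" and ys: "ys = pre @ rat_syms x @ post"
    and Q: "n \<le> Q" "m \<le> Q" "length ys \<le> Q"
  shows "run entry (stg \<rho> (tp (int (length pre)) ys) (flg (0 < i)) (tp (int i) (ones n)) (tp (int r) (ones m)) (tp (int s) (ones m)) (outt v))
    (500 * Q * Q)
    (Some (stg \<rho> (tp (int (length pre + length (rat_syms x))) ys) (flg (0 < i)) (tp (int i) (ones n)) (tp (int r) (ones m))
      (tp (int (Suc s)) (ones m)) (outt (v @ entry_out n m i r s x))))"
proof -
  define X where "X = (ones n)[i := 2]"
  define R where "R = (ones m)[r := 2]"
  define C where "C = (ones m)[s := 2]"
  define R' where "R' = length (rat_syms x)"
  have lens: "length X = n" "length R = m" "length C = m" by (simp_all add: X_def R_def C_def)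
  have nz: "0 \<notin> set X" "0 \<notin> set R" "0 \<notin> set C"
    unfolding X_def R_def C_def by (rule zero_notin_marked)+
  let ?tok = "tp (int (length pre)) ys" and ?fl = "flg (0 < i)"
  let ?M = "\<lambda>v. stg \<rho> ?tok ?fl (tp 0 X) (tp 0 R) (tp 0 C) (outt v)"
  let ?\<sigma> = "?M []"
  have 1: "run mark (stg \<rho> ?tok ?fl (tp (int i) (ones n)) (tp (int r) (ones m)) (tp (int s) (ones m)) (outt v)) 1
      (Some (stg \<rho> ?tok ?fl (tp (int i) X) (tp (int r) R) (tp (int s) C) (outt v)))"
    unfolding mark_def
    by (rule run_act[where a = "(keep (reads (stg \<rho> ?tok ?fl (tp (int i) (ones n)) (tp (int r) (ones m)) (tp (int s) (ones m)) (outt v))))(Mats := (2, Stay), Rows := (2, Stay), Cols := (2, Stay))"])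
      (use b in \<open>simp_all add: perform_upd act_tp read_tp_nat X_def R_def C_def\<close>)
  have 2: "run (rewind {Mats} Mats) (stg \<rho> ?tok ?fl (tp (int i) X) (tp (int r) R) (tp (int s) C) (outt v)) (2 * i + 3)
      (Some (stg \<rho> ?tok ?fl (tp 0 X) (tp (int r) R) (tp (int s) C) (outt v)))"
    using run_rewind1[of "stg \<rho> ?tok ?fl (tp (int i) X) (tp (int r) R) (tp (int s) C) (outt v)" Mats i X] b lens nz by simp
  have 3: "run (rewind {Rows} Rows) (stg \<rho> ?tok ?fl (tp 0 X) (tp (int r) R) (tp (int s) C) (outt v)) (2 * r + 3)
      (Some (stg \<rho> ?tok ?fl (tp 0 X) (tp 0 R) (tp (int s) C) (outt v)))"
    using run_rewind1[of "stg \<rho> ?tok ?fl (tp 0 X) (tp (int r) R) (tp (int s) C) (outt v)" Rows r R] b lens nz by simp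
  have 4: "run (rewind {Cols} Cols) (stg \<rho> ?tok ?fl (tp 0 X) (tp 0 R) (tp (int s) C) (outt v)) (2 * s + 3) (Some (?M v))"
    using run_rewind1[of "stg \<rho> ?tok ?fl (tp 0 X) (tp 0 R) (tp (int s) C) (outt v)" Cols s C] b lens nz by simp
  have cp: "emits copy_rat ?\<sigma> (6 * R') (raw_enc x)"
    unfolding R'_def by (rule emits_copy_rat[where pre = pre and post = post]) (simp add: ys)
  have Xn: "X ! j = (if j = i then 2 else 1)" if "j < n" for j using that by (auto simp: X_def nth_list_update)
  have Rn: "R ! j = (if j = r then 2 else 1)" if "j < m" for j using that by (auto simp: R_def nth_list_update)
  have Cn: "C ! j = (if j = s then 2 else 1)" if "j < m" for j using that by (auto simp: C_def nth_list_update)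
  have Q1: "Q \<ge> 1" using b Q by simp
  have v1: "emits (vec_prog 0 mark_x no_mark mark_y no_mark Rows Cols) ?\<sigma> (120 * Q * Q) (concat (map enc_nat (exps1 n m i r s)))"
    unfolding exps1_def
    by (rule emits_vec_prog[where X = X and R = R and C = C])
      (use lens nz Q Q1 Xn Rn Cn in \<open>auto simp: mark_x_def mark_y_def\<close>)
  have v2: "emits (vec_prog 0 no_mark mark_g no_mark mark_a Rows Cols) ?\<sigma> (120 * Q * Q) (concat (map enc_nat (exps2 n m i r s)))"
    unfolding exps2_def
    by (rule emits_vec_prog[where X = X and R = R and C = C])
      (use lens nz Q Q1 Xn Rn Cn in \<open>auto simp: mark_g_def mark_a_def\<close>)
  have v3: "emits (vec_prog 1 no_mark mark_g no_mark mark_a Cols Rows) ?\<sigma> (120 * Q * Q) (concat (map enc_nat (exps3 n m i r s)))"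
    unfolding exps3_def
    by (rule emits_vec_prog[where X = X and R = R and C = C])
      (use lens nz Q Q1 Xn Rn Cn in \<open>auto simp: mark_g_def mark_a_def\<close>)
  note T = emits_stg[OF emits_term_prog[OF cp v1]] emits_stg[OF emits_term_prog[OF cp v2]] emits_stg[OF emits_term_prog[OF cp v3]]
  define w where "w = v @ entry_out n m i r s x"
  have w: "((v @ raw_term (raw_enc x) (exps1 n m i r s)) @ raw_term (raw_enc x) (exps2 n m i r s)) @ raw_term (raw_enc x) (exps3 n m i r s) = w"
    by (simp add: w_def entry_out_def)
  have 5: "run (While (\<lambda>r. r Mats \<noteq> 2) (mv {Mats} Right)) (?M w) (2 * i + 1) (Some (stg \<rho> ?tok ?fl (tp (int i) X) (tp 0 R) (tp 0 C) (outt w)))"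
    using run_seek_mark[of i n "?M w" Mats] b by (simp add: X_def)
  have 6: "run (While (\<lambda>r. r Rows \<noteq> 2) (mv {Rows} Right)) (stg \<rho> ?tok ?fl (tp (int i) X) (tp 0 R) (tp 0 C) (outt w)) (2 * r + 1) (Some (stg \<rho> ?tok ?fl (tp (int i) X) (tp (int r) R) (tp 0 C) (outt w)))"
    using run_seek_mark[of r m "stg \<rho> ?tok ?fl (tp (int i) X) (tp 0 R) (tp 0 C) (outt w)" Rows] b by (simp add: R_def)
  have 7: "run (While (\<lambda>r. r Cols \<noteq> 2) (mv {Cols} Right)) (stg \<rho> ?tok ?fl (tp (int i) X) (tp (int r) R) (tp 0 C) (outt w)) (2 * s + 1) (Some (stg \<rho> ?tok ?fl (tp (int i) X) (tp (int r) R) (tp (int s) C) (outt w)))"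
    using run_seek_mark[of s m "stg \<rho> ?tok ?fl (tp (int i) X) (tp (int r) R) (tp 0 C) (outt w)" Cols] b by (simp add: C_def)
  have 8: "run unmark (stg \<rho> ?tok ?fl (tp (int i) X) (tp (int r) R) (tp (int s) C) (outt w)) 1
     (Some (stg \<rho> ?tok ?fl (tp (int i) (ones n)) (tp (int r) (ones m)) (tp (int (Suc s)) (ones m)) (outt w)))"
    unfolding unmark_def
    by (rule run_act[where a = "(keep (reads (stg \<rho> ?tok ?fl (tp (int i) X) (tp (int r) R) (tp (int s) C) (outt w))))(Mats := (1, Stay), Rows := (1, Stay), Cols := (1, Right))"])
      (use b in \<open>simp_all add: perform_upd act_tp X_def R_def C_def marked_back add.commute flip: One_nat_def\<close>)
  let ?N = "\<lambda>tok. stg \<rho> tok ?fl (tp (int i) (ones n)) (tp (int r) (ones m)) (tp (int (Suc s)) (ones m)) (outt w)"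
  \<comment> \<open>The search for the closing \<open>6\<close> stops on the last symbol of the
    rational, at distance \<open>R' - 1\<close>; one more move leaves it.\<close>
  define k where "k = R' - 1"
  have k: "R' = Suc k" by (simp add: k_def R'_def rat_syms_def)
  have 9: "run (While (\<lambda>r. r Tok \<noteq> 6) (mv {Tok} Right)) (?N ?tok) (2 * k + 1) (Some (?N (tp (int (length pre) + int k) ys)))"
  proof -
    have rd: "read_tape (tp (int (length pre) + int j * offset Right) ys) = rat_syms x ! j" if "j \<le> k" for j
    proof -
      have "int (length pre) + int j * offset Right = int (length pre + j)" by simp
      moreover have "j < length (rat_syms x)" using that k R'_def by simp
      ultimately show ?thesis by (simp only: read_tp_nat) (simp add: ys nth_append)
    qed
    have e: "rat_syms x = (butlast (rat_syms x)) @ [6]" "6 \<notin> set (butlast (rat_syms x))"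
      using bsym_neq(2)[of 6] by (auto simp: rat_syms_def butlast_append dest: sym)
    have lb: "length (butlast (rat_syms x)) = k" using k R'_def by simp
    have "rat_syms x ! j \<noteq> 6" if "j < k" for j
      using e(2) that nth_mem[of j "butlast (rat_syms x)"] lb by (metis nth_butlast)
    moreover have "rat_syms x ! k = 6"
      using e(1) lb by (metis nth_append_length)
    ultimately show ?thesis
      using run_seek[of "?N ?tok" Tok "int (length pre)" ys k Right 6] rd by simp
  qed
  have 10: "run (mv {Tok} Right) (?N (tp (int (length pre) + int k) ys)) 1 (Some (?N (tp (int (length pre + R')) ys)))"
  proof -
    have "int (length pre) + int k + offset Right = int (length pre + R')" by (simp add: k)
    then show ?thesis using run_mv1[of "?N (tp (int (length pre) + int k) ys)" Tok "int (length pre) + int k" ys Right]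
      by (simp only: stg_sel stg_upd)
  qed
  have R'Q: "R' \<le> Q" using Q ys by (simp add: R'_def)
  let ?t = "1 + (2 * i + 3 + (2 * r + 3 + (2 * s + 3 + (6 * R' + 120 * Q * Q + 11 + (6 * R' + 120 * Q * Q + 11 + (6 * R' + 120 * Q * Q + 11 +
    (2 * i + 1 + (2 * r + 1 + (2 * s + 1 + (1 + (2 * k + 1 + 1)))))))))))"
  have "run entry (stg \<rho> ?tok ?fl (tp (int i) (ones n)) (tp (int r) (ones m)) (tp (int s) (ones m)) (outt v)) ?t (Some (?N (tp (int (length pre + R')) ys)))"
    unfolding entry_def w[symmetric]
    by (rule run_seq[OF 1] run_seq[OF 2] run_seq[OF 3] run_seq[OF 4] run_seq[OF T(1)] run_seq[OF T(2)] run_seq[OF T(3)]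
      run_seq[OF 5[folded w]] run_seq[OF 6[folded w]] run_seq[OF 7[folded w]] run_seq[OF 8[folded w]] run_seq[OF 9[folded w]] 10[folded w])+
  \<comment> \<open>The three sweeps contribute \<open>3 * 120\<close>, and everything else is
    linear in \<open>Q\<close>.\<close>
  moreover have "?t \<le> 500 * Q * Q"
  proof -
    define S where "S = Q * Q"
    have S: "Q \<le> S" "120 * Q * Q = 120 * S" "500 * Q * Q = 500 * S" by (simp_all add: S_def)
    show ?thesis unfolding S(2,3) using b Q R'Q k S(1) Q1 by linarith
  qed
  ultimately show ?thesis unfolding w_def R'_def by (rule run_mono)
qed

section \<open>Rows, matrices and lists of matrices\<close>

definition row_prog :: com where
  "row_prog = mv {Tok} Right ;; While (\<lambda>r. r Tok = 5) entry ;; guard (\<lambda>r. r Cols = 0 \<and> r Rows = 1) ;;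
     rewind {Cols} Cols ;; mv {Tok} Right ;; mv {Rows} Right"

definition mat_prog :: com where
  "mat_prog = mv {Tok} Right ;; While (\<lambda>r. r Tok = 7) row_prog ;; guard (\<lambda>r. r Rows = 0) ;;
     rewind {Rows} Rows ;; mv {Tok} Right ;; mv {Mats} Right ;; Act (\<lambda>r. Some ((keep r)(Flag := (1, Stay))))"

definition row_out :: "nat \<Rightarrow> nat \<Rightarrow> nat \<Rightarrow> nat \<Rightarrow> nat \<Rightarrow> raw list \<Rightarrow> bool list" where
  "row_out n m i r s xs = concat (map (\<lambda>(s, x). entry_out n m i r s x) (List.enumerate s xs))"

definition mat_out :: "nat \<Rightarrow> nat \<Rightarrow> nat \<Rightarrow> nat \<Rightarrow> raw list list \<Rightarrow> bool list" where
  "mat_out n m i r xs = concat (map (\<lambda>(r, x). row_out n m i r 0 x) (List.enumerate r xs))"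

definition mats_out :: "nat \<Rightarrow> nat \<Rightarrow> nat \<Rightarrow> raw list list list \<Rightarrow> bool list" where
  "mats_out n m i xs = concat (map (\<lambda>(i, x). mat_out n m i 0 x) (List.enumerate i xs))"

lemma read_tp_mid: "p = length pre \<Longrightarrow> read_tape (tp (int p) (pre @ x # post)) = x"
  by (simp add: read_tp_nat)

lemma run_entry_stuck:
  "\<not> (r < m \<and> s < m) \<Longrightarrow> run entry (stg \<rho> tok fl ma (tp (int r) (ones m)) (tp (int s) (ones m)) ou) t None"
  unfolding entry_def mark_def
  by (intro run_seq_stuck run_act_stuck) (auto simp: read_tp_nat)

lemma run_mv_Tok: "run (mv {Tok} Right) (stg \<rho> (tp (int p) ys) fl ma ro co ou) 1 (Some (stg \<rho> (tp (int (Suc p)) ys) fl ma ro co ou))"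
  using run_mv1[of "stg \<rho> (tp (int p) ys) fl ma ro co ou" Tok "int p" ys Right] by (simp add: add.commute)

lemma run_mv_Rows: "run (mv {Rows} Right) (stg \<rho> tok fl ma (tp (int p) ys) co ou) 1 (Some (stg \<rho> tok fl ma (tp (int (Suc p)) ys) co ou))"
  using run_mv1[of "stg \<rho> tok fl ma (tp (int p) ys) co ou" Rows "int p" ys Right] by (simp add: add.commute)

lemma run_mv_Mats: "run (mv {Mats} Right) (stg \<rho> tok fl (tp (int p) ys) ro co ou) 1 (Some (stg \<rho> tok fl (tp (int (Suc p)) ys) ro co ou))"
  using run_mv1[of "stg \<rho> tok fl (tp (int p) ys) ro co ou" Mats "int p" ys Right] by (simp add: add.commute)

lemma run_rewind_Cols: "p \<le> m \<Longrightarrow> run (rewind {Cols} Cols) (stg \<rho> tok fl ma ro (tp (int p) (ones m)) ou) (2 * p + 3) (Some (stg \<rho> tok fl ma ro (tp (int 0) (ones m)) ou))"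
  using run_rewind1[of "stg \<rho> tok fl ma ro (tp (int p) (ones m)) ou" Cols p "ones m"] by simp

lemma run_rewind_Rows: "p \<le> m \<Longrightarrow> run (rewind {Rows} Rows) (stg \<rho> tok fl ma (tp (int p) (ones m)) co ou) (2 * p + 3) (Some (stg \<rho> tok fl ma (tp (int 0) (ones m)) co ou))"
  using run_rewind1[of "stg \<rho> tok fl ma (tp (int p) (ones m)) co ou" Rows p "ones m"] by simp

lemma rat_syms_Cons: "\<exists>u. rat_syms x = 5 # u"
  by (simp add: rat_syms_def)

lemma length_rat_syms_pos: "length (rat_syms x) \<ge> 1"
  by (simp add: rat_syms_def)

definition square :: "nat \<Rightarrow> raw list list \<Rightarrow> bool" where
  "square m xs \<longleftrightarrow> length xs = m \<and> (\<forall>x\<in>set xs. length x = m)"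

context
  fixes \<rho> :: store and n m Q :: nat and ys :: "nat list"
  assumes Q: "n \<le> Q" "m \<le> Q" "length ys \<le> Q"
begin

abbreviation cur :: "nat \<Rightarrow> nat \<Rightarrow> nat \<Rightarrow> nat \<Rightarrow> bool list \<Rightarrow> store" where
  "cur p i r s v \<equiv> stg \<rho> (tp (int p) ys) (flg (0 < i)) (tp (int i) (ones n)) (tp (int r) (ones m)) (tp (int s) (ones m)) (outt v)"

lemma run_entries:
  assumes "i < n" "r < m" "s \<le> m" "ys = pre @ concat (map rat_syms xs) @ c # post" "c \<noteq> 5"
  shows "run (While (\<lambda>r. r Tok = 5) entry) (cur (length pre) i r s v) (length xs * (500 * Q * Q + 1) + 1)
    (if s + length xs \<le> m then Some (cur (length pre + length (concat (map rat_syms xs))) i r (s + length xs) (v @ row_out n m i r s xs)) else None)"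
  using assms(3-)
proof (induction xs arbitrary: pre s v)
  case Nil
  have "\<not> reads (cur (length pre) i r s v) Tok = 5"
    using Nil read_tp_mid[of "length pre" pre c post] by simp
  then have "run (While (\<lambda>r. r Tok = 5) entry) (cur (length pre) i r s v) 1 (Some (cur (length pre) i r s v))"
    by (rule run_while_done)
  then show ?case using Nil by (simp add: row_out_def)
next
  case (Cons x xs)
  have ys: "ys = pre @ rat_syms x @ (concat (map rat_syms xs) @ c # post)" using Cons.prems by simp
  obtain u where u: "rat_syms x = 5 # u" using rat_syms_Cons by blast
  have rd: "reads (cur (length pre) i r s v) Tok = 5"
    unfolding reads_stg ys u append_Cons by (rule read_tp_mid) (rule refl)
  show ?case
  proof (cases "s < m")
    case False
    then have "run entry (cur (length pre) i r s v) (500 * Q * Q) None"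
      by (intro run_entry_stuck) simp
    from run_while_stuck[where b = "\<lambda>r. r Tok = 5", OF rd this]
    have "run (While (\<lambda>r. r Tok = 5) entry) (cur (length pre) i r s v) (length (x # xs) * (500 * Q * Q + 1) + 1) None"
      by (rule run_mono) simp
    then show ?thesis using False by simp
  next
    case True
    let ?v = "v @ entry_out n m i r s x"
    have 1: "run entry (cur (length pre) i r s v) (500 * Q * Q) (Some (cur (length pre + length (rat_syms x)) i r (Suc s) ?v))"
      using run_entry[OF assms(1,2) True ys Q] .
    have 2: "run (While (\<lambda>r. r Tok = 5) entry) (cur (length (pre @ rat_syms x)) i r (Suc s) ?v) (length xs * (500 * Q * Q + 1) + 1)
      (if Suc s + length xs \<le> m then Some (cur (length (pre @ rat_syms x) + length (concat (map rat_syms xs))) i r (Suc s + length xs)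
        (?v @ row_out n m i r (Suc s) xs)) else None)"
    proof (rule Cons.IH)
      show "Suc s \<le> m" using True by simp
      show "ys = (pre @ rat_syms x) @ concat (map rat_syms xs) @ c # post" unfolding ys append_assoc ..
      show "c \<noteq> 5" by (rule Cons.prems)
    qed
    have e: "length pre + length (rat_syms x) = length (pre @ rat_syms x)" by simp
    have "run (While (\<lambda>r. r Tok = 5) entry) (cur (length pre) i r s v) (Suc (500 * Q * Q + (length xs * (500 * Q * Q + 1) + 1)))
      (if Suc s + length xs \<le> m then Some (cur (length (pre @ rat_syms x) + length (concat (map rat_syms xs))) i r (Suc s + length xs)
        (?v @ row_out n m i r (Suc s) xs)) else None)"
      by (rule run_while_step[where b = "\<lambda>r. r Tok = 5", OF rd 1[unfolded e] 2])
    moreover have "length (pre @ rat_syms x) + length (concat (map rat_syms xs)) = length pre + length (concat (map rat_syms (x # xs)))"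
      "Suc s + length xs = s + length (x # xs)" "?v @ row_out n m i r (Suc s) xs = v @ row_out n m i r s (x # xs)"
      "Suc (500 * Q * Q + (length xs * (500 * Q * Q + 1) + 1)) = length (x # xs) * (500 * Q * Q + 1) + 1"
      by (simp_all add: row_out_def)
    ultimately show ?thesis by (simp only:)
  qed
qed

text \<open>Time is charged to the symbols of the input: each entry to a symbol of its rational, the
  rest of \<open>row_prog\<close> to the two brackets of the row. This keeps the bounds linear in
  the number of symbols under nesting.\<close>

lemma length_row_syms: "length (row_syms xs) = length (concat (map rat_syms xs)) + 2" "length xs + 2 \<le> length (row_syms xs)"
proof -
  show 1: "length (row_syms xs) = length (concat (map rat_syms xs)) + 2" by (simp add: row_syms_def)
  have "length xs \<le> length (concat (map rat_syms xs))"
    by (induction xs) (use length_rat_syms_pos in \<open>auto intro: order_trans add_mono\<close>)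
  then show "length xs + 2 \<le> length (row_syms xs)" using 1 by simp
qed

lemma run_row_prog:
  assumes "i < n" "r \<le> m" "ys = pre @ row_syms xs @ post"
  shows "run row_prog (cur (length pre) i r 0 v) (length (row_syms xs) * (510 * Q * Q))
    (if r < m \<and> length xs = m then Some (cur (length pre + length (row_syms xs)) i (Suc r) 0 (v @ row_out n m i r 0 xs)) else None)"
proof -
  let ?E = "500 * Q * Q + 1" and ?p = "Suc (length pre)"
  let ?q = "?p + length (concat (map rat_syms xs))"
  have Q1: "1 \<le> Q" using assms(1) Q by simp
  have ys: "ys = (pre @ [7]) @ concat (map rat_syms xs) @ 8 # post" using assms(3) by (simp add: row_syms_def)
  have p: "length (pre @ [7]) = ?p" by simp
  have bound: "1 + (length xs * ?E + 1 + (1 + (2 * m + 3 + (1 + 1)))) \<le> length (row_syms xs) * (510 * Q * Q)"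
  proof -
    define S where "S = Q * Q"
    have S: "Q \<le> S" "500 * Q * Q = 500 * S" "510 * Q * Q = 510 * S" by (simp_all add: S_def)
    have "length xs * (500 * S + 1) \<le> length xs * (510 * S)" using S(1) Q1 by (intro mult_le_mono2) linarith
    moreover have "1 + (1 + (1 + (2 * m + 3 + (1 + 1)))) \<le> 2 * (510 * S)" using S(1) Q Q1 by linarith
    ultimately have "1 + (length xs * (500 * S + 1) + 1 + (1 + (2 * m + 3 + (1 + 1)))) \<le> (length xs + 2) * (510 * S)"
      unfolding add_mult_distrib by linarith
    also have "\<dots> \<le> length (row_syms xs) * (510 * S)" using length_row_syms(2) by (rule mult_le_mono1)
    finally show ?thesis unfolding S .
  qed
  have 1: "run (mv {Tok} Right) (cur (length pre) i r 0 v) 1 (Some (cur ?p i r 0 v))" by (rule run_mv_Tok)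
  show ?thesis
  proof (cases "r < m")
    case False
    \<comment> \<open>A surplus row gets stuck in \<open>mark\<close> if it has an entry. An empty
      one is caught by the guard; for \<open>m = 0\<close> the test of \<open>Cols\<close> would let
      it pass, and the test of \<open>Rows\<close> stops it.\<close>
    show ?thesis
    proof (cases xs)
      case Nil
      have "\<not> reads (cur ?p i r 0 v) Tok = 5"
        using ys read_tp_mid[of ?p "pre @ [7]" 8 post] Nil by simp
      then have 2: "run (While (\<lambda>r. r Tok = 5) entry) (cur ?p i r 0 v) 1 (Some (cur ?p i r 0 v))"
        by (rule run_while_done)
      have 3: "run (guard (\<lambda>r. r Cols = 0 \<and> r Rows = 1)) (cur ?p i r 0 v) 1 None"
        by (rule run_guard_stuck) (use False in \<open>simp add: read_tp_nat\<close>)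
      have "run row_prog (cur (length pre) i r 0 v) (1 + (1 + 1)) None"
        unfolding row_prog_def by (rule run_seq[OF 1 run_seq[OF 2 run_seq_stuck[OF 3]]])
      then have "run row_prog (cur (length pre) i r 0 v) (length (row_syms xs) * (510 * Q * Q)) None"
        by (rule run_mono) (use bound in linarith)
      then show ?thesis using False by simp
    next
      case (Cons x xs')
      have "reads (cur ?p i r 0 v) Tok = 5"
        using ys read_tp_mid[of ?p "pre @ [7]" 5] Cons by (simp add: rat_syms_def)
      then have "run (While (\<lambda>r. r Tok = 5) entry) (cur ?p i r 0 v) (Suc 0) None"
        by (rule run_while_stuck) (rule run_entry_stuck, use False in simp)
      then have "run row_prog (cur (length pre) i r 0 v) (1 + Suc 0) None"
        unfolding row_prog_def by (intro run_seq[OF 1] run_seq_stuck)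
      then have "run row_prog (cur (length pre) i r 0 v) (length (row_syms xs) * (510 * Q * Q)) None"
        by (rule run_mono) (use bound in linarith)
      then show ?thesis using False by simp
    qed
  next
    case True
    have 2: "run (While (\<lambda>r. r Tok = 5) entry) (cur ?p i r 0 v) (length xs * ?E + 1)
      (if 0 + length xs \<le> m then Some (cur ?q i r (0 + length xs) (v @ row_out n m i r 0 xs)) else None)"
      using run_entries[OF assms(1) True _ ys, of 0 v] unfolding p by simp
    show ?thesis
    proof (cases "length xs \<le> m")
      case False
      with 2 have "run (While (\<lambda>r. r Tok = 5) entry) (cur ?p i r 0 v) (length xs * ?E + 1) None" by simp
      then have "run row_prog (cur (length pre) i r 0 v) (1 + (length xs * ?E + 1)) None"
        unfolding row_prog_def by (intro run_seq[OF 1] run_seq_stuck)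
      then have "run row_prog (cur (length pre) i r 0 v) (length (row_syms xs) * (510 * Q * Q)) None"
        by (rule run_mono) (use bound in linarith)
      then show ?thesis using False by simp
    next
      case le: True
      with 2 have 2: "run (While (\<lambda>r. r Tok = 5) entry) (cur ?p i r 0 v) (length xs * ?E + 1)
        (Some (cur ?q i r (length xs) (v @ row_out n m i r 0 xs)))" by simp
      show ?thesis
      proof (cases "length xs = m")
        case False
        have 3: "run (guard (\<lambda>r. r Cols = 0 \<and> r Rows = 1)) (cur ?q i r (length xs) (v @ row_out n m i r 0 xs)) 1 None"
          by (rule run_guard_stuck) (use False le in \<open>simp add: read_tp_nat\<close>)
        have "run row_prog (cur (length pre) i r 0 v) (1 + (length xs * ?E + 1 + 1)) None"
          unfolding row_prog_def by (rule run_seq[OF 1 run_seq[OF 2 run_seq_stuck[OF 3]]])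
        then have "run row_prog (cur (length pre) i r 0 v) (length (row_syms xs) * (510 * Q * Q)) None"
        by (rule run_mono) (use bound in linarith)
      then show ?thesis using False by simp
      next
        case eq: True
        have 3: "run (guard (\<lambda>r. r Cols = 0 \<and> r Rows = 1)) (cur ?q i r (length xs) (v @ row_out n m i r 0 xs)) 1
          (Some (cur ?q i r (length xs) (v @ row_out n m i r 0 xs)))"
          by (rule run_guard) (use eq True in \<open>simp add: read_tp_nat\<close>)
        have "run row_prog (cur (length pre) i r 0 v) (1 + (length xs * ?E + 1 + (1 + (2 * length xs + 3 + (1 + 1)))))
          (Some (stg \<rho> (tp (int (Suc ?q)) ys) (flg (0 < i)) (tp (int i) (ones n)) (tp (int (Suc r)) (ones m)) (tp (int 0) (ones m)) (outt (v @ row_out n m i r 0 xs))))"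
          unfolding row_prog_def
          by (rule run_seq[OF 1 run_seq[OF 2 run_seq[OF 3 run_seq[OF run_rewind_Cols[OF le] run_seq[OF run_mv_Tok run_mv_Rows]]]]])
        then have "run row_prog (cur (length pre) i r 0 v) (length (row_syms xs) * (510 * Q * Q))
          (Some (stg \<rho> (tp (int (Suc ?q)) ys) (flg (0 < i)) (tp (int i) (ones n)) (tp (int (Suc r)) (ones m)) (tp (int 0) (ones m)) (outt (v @ row_out n m i r 0 xs))))"
          by (rule run_mono) (use bound eq in linarith)
        moreover have e: "Suc ?q = length pre + length (row_syms xs)" by (simp add: length_row_syms(1))
        ultimately show ?thesis using True eq unfolding e by simp
      qed
    qed
  qed
qed

lemma row_syms_Cons: "\<exists>u. row_syms xs = 7 # u"
  by (simp add: row_syms_def)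

text \<open>Raising the constant from \<open>510\<close> to \<open>511\<close> grants each row at
  least \<open>Q * Q\<close> additional steps, which pay for the test of the loop. The same happens
  in \<open>run_mats\<close>.\<close>

lemma run_rows:
  assumes "i < n" "r \<le> m" "ys = pre @ concat (map row_syms xs) @ c # post" "c \<noteq> 7"
  shows "run (While (\<lambda>r. r Tok = 7) row_prog) (cur (length pre) i r 0 v) (length (concat (map row_syms xs)) * (511 * Q * Q) + 1)
    (if (\<forall>x\<in>set xs. length x = m) \<and> r + length xs \<le> m
     then Some (cur (length pre + length (concat (map row_syms xs))) i (r + length xs) 0 (v @ mat_out n m i r xs)) else None)"
  using assms(2-)
proof (induction xs arbitrary: pre r v)
  case Nil
  have "\<not> reads (cur (length pre) i r 0 v) Tok = 7"
    using Nil read_tp_mid[of "length pre" pre c post] by simp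
  then have "run (While (\<lambda>r. r Tok = 7) row_prog) (cur (length pre) i r 0 v) 1 (Some (cur (length pre) i r 0 v))"
    by (rule run_while_done)
  then show ?case using Nil by (simp add: mat_out_def)
next
  case (Cons x xs)
  have ys: "ys = pre @ row_syms x @ (concat (map row_syms xs) @ c # post)" using Cons.prems by simp
  obtain u where u: "row_syms x = 7 # u" using row_syms_Cons by blast
  have rd: "reads (cur (length pre) i r 0 v) Tok = 7"
    unfolding reads_stg ys u append_Cons by (rule read_tp_mid) (rule refl)
  have row: "run row_prog (cur (length pre) i r 0 v) (length (row_syms x) * (510 * Q * Q))
    (if r < m \<and> length x = m then Some (cur (length pre + length (row_syms x)) i (Suc r) 0 (v @ row_out n m i r 0 x)) else None)"
    by (rule run_row_prog[OF assms(1) Cons.prems(1) ys])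
  have bound: "Suc (length (row_syms x) * (510 * Q * Q) + (length (concat (map row_syms xs)) * (511 * Q * Q) + 1))
      \<le> length (concat (map row_syms (x # xs))) * (511 * Q * Q) + 1"
  proof -
    have "1 \<le> Q * Q" using assms(1) Q by (simp add: Suc_le_eq)
    moreover have "1 \<le> length (row_syms x)" using u by simp
    ultimately have "1 * 1 \<le> length (row_syms x) * (Q * Q)" by (rule mult_le_mono[rotated])
    then show ?thesis by (simp add: algebra_simps)
  qed
  show ?case
  proof (cases "r < m \<and> length x = m")
    case False
    with row have "run row_prog (cur (length pre) i r 0 v) (length (row_syms x) * (510 * Q * Q)) None"
      by (simp only: if_not_P[OF False] if_False)
    from run_while_stuck[where b = "\<lambda>r. r Tok = 7", OF rd this]
    have "run (While (\<lambda>r. r Tok = 7) row_prog) (cur (length pre) i r 0 v) (length (concat (map row_syms (x # xs))) * (511 * Q * Q) + 1) None"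
      by (rule run_mono) (use bound in simp)
    moreover have "\<not> ((\<forall>x\<in>set (x # xs). length x = m) \<and> r + length (x # xs) \<le> m)" using False by auto
    ultimately show ?thesis by (simp only: if_False)
  next
    case True
    let ?v = "v @ row_out n m i r 0 x"
    have 1: "run row_prog (cur (length pre) i r 0 v) (length (row_syms x) * (510 * Q * Q)) (Some (cur (length (pre @ row_syms x)) i (Suc r) 0 ?v))"
      using row True by simp
    have 2: "run (While (\<lambda>r. r Tok = 7) row_prog) (cur (length (pre @ row_syms x)) i (Suc r) 0 ?v) (length (concat (map row_syms xs)) * (511 * Q * Q) + 1)
      (if (\<forall>x\<in>set xs. length x = m) \<and> Suc r + length xs \<le> m
       then Some (cur (length (pre @ row_syms x) + length (concat (map row_syms xs))) i (Suc r + length xs) 0 (?v @ mat_out n m i (Suc r) xs)) else None)"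
    proof (rule Cons.IH)
      show "Suc r \<le> m" using True by simp
      show "ys = (pre @ row_syms x) @ concat (map row_syms xs) @ c # post" unfolding ys append_assoc ..
      show "c \<noteq> 7" by (rule Cons.prems)
    qed
    have 3: "run (While (\<lambda>r. r Tok = 7) row_prog) (cur (length pre) i r 0 v) (length (concat (map row_syms (x # xs))) * (511 * Q * Q) + 1)
      (if (\<forall>x\<in>set xs. length x = m) \<and> Suc r + length xs \<le> m
       then Some (cur (length (pre @ row_syms x) + length (concat (map row_syms xs))) i (Suc r + length xs) 0 (?v @ mat_out n m i (Suc r) xs)) else None)"
      by (rule run_mono[OF run_while_step[where b = "\<lambda>r. r Tok = 7", OF rd 1 2] bound])
    have e: "length (pre @ row_syms x) + length (concat (map row_syms xs)) = length pre + length (concat (map row_syms (x # xs)))"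
      "Suc r + length xs = r + length (x # xs)" "?v @ mat_out n m i (Suc r) xs = v @ mat_out n m i r (x # xs)"
      "(\<forall>x\<in>set xs. length x = m) \<longleftrightarrow> (\<forall>x\<in>set (x # xs). length x = m)"
      using True by (simp_all add: mat_out_def)
    show ?thesis using 3 unfolding e .
  qed
qed

lemma length_mat_syms: "length (mat_syms xs) = length (concat (map row_syms xs)) + 2"
  by (simp add: mat_syms_def)

lemma run_mat_prog:
  assumes "i < n" "ys = pre @ mat_syms xs @ post"
  shows "run mat_prog (cur (length pre) i 0 0 v) (length (mat_syms xs) * (512 * Q * Q))
    (if square m xs then Some (cur (length pre + length (mat_syms xs)) (Suc i) 0 0 (v @ mat_out n m i 0 xs)) else None)"
proof -
  let ?L = "length (concat (map row_syms xs))" and ?E = "511 * Q * Q" and ?p = "Suc (length pre)"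
  let ?q = "?p + ?L" and ?v = "v @ mat_out n m i 0 xs"
  have Q1: "1 \<le> Q" using assms(1) Q by simp
  have ys: "ys = (pre @ [9]) @ concat (map row_syms xs) @ 10 # post" using assms(2) by (simp add: mat_syms_def)
  have p: "length (pre @ [9]) = ?p" by simp
  have bound: "1 + (?L * ?E + 1 + (1 + (2 * m + 3 + (1 + (1 + 1))))) \<le> length (mat_syms xs) * (512 * Q * Q)"
  proof -
    define S where "S = Q * Q"
    have S: "Q \<le> S" "511 * Q * Q = 511 * S" "512 * Q * Q = 512 * S" by (simp_all add: S_def)
    have "?L * (511 * S) \<le> ?L * (512 * S)" by simp
    moreover have "1 + (1 + (1 + (2 * m + 3 + (1 + (1 + 1))))) \<le> 2 * (512 * S)" using S(1) Q Q1 by linarith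
    ultimately have "1 + (?L * (511 * S) + 1 + (1 + (2 * m + 3 + (1 + (1 + 1))))) \<le> (?L + 2) * (512 * S)"
      unfolding add_mult_distrib by linarith
    then show ?thesis unfolding S length_mat_syms .
  qed
  have 1: "run (mv {Tok} Right) (cur (length pre) i 0 0 v) 1 (Some (cur ?p i 0 0 v))" by (rule run_mv_Tok)
  have 2: "run (While (\<lambda>r. r Tok = 7) row_prog) (cur ?p i 0 0 v) (?L * ?E + 1)
      (if (\<forall>x\<in>set xs. length x = m) \<and> 0 + length xs \<le> m then Some (cur ?q i (0 + length xs) 0 ?v) else None)"
    using run_rows[OF assms(1) _ ys, of 0 v] unfolding p by simp
  show ?thesis
  proof (cases "(\<forall>x\<in>set xs. length x = m) \<and> length xs \<le> m")
    case False
    with 2 have "run (While (\<lambda>r. r Tok = 7) row_prog) (cur ?p i 0 0 v) (?L * ?E + 1) None" by (simp split: if_splits)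
    then have "run mat_prog (cur (length pre) i 0 0 v) (1 + (?L * ?E + 1)) None"
      unfolding mat_prog_def by (intro run_seq[OF 1] run_seq_stuck)
    then have "run mat_prog (cur (length pre) i 0 0 v) (length (mat_syms xs) * (512 * Q * Q)) None"
      by (rule run_mono) (use bound in linarith)
    moreover have "\<not> square m xs" using False by (auto simp: square_def)
    ultimately show ?thesis by simp
  next
    case True
    with 2 have 2: "run (While (\<lambda>r. r Tok = 7) row_prog) (cur ?p i 0 0 v) (?L * ?E + 1) (Some (cur ?q i (length xs) 0 ?v))" by simp
    show ?thesis
    proof (cases "length xs = m")
      case False
      have 3: "run (guard (\<lambda>r. r Rows = 0)) (cur ?q i (length xs) 0 ?v) 1 None"
        by (rule run_guard_stuck) (use False True in \<open>simp add: read_tp_nat\<close>)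
      have "run mat_prog (cur (length pre) i 0 0 v) (1 + (?L * ?E + 1 + 1)) None"
        unfolding mat_prog_def by (rule run_seq[OF 1 run_seq[OF 2 run_seq_stuck[OF 3]]])
      then have "run mat_prog (cur (length pre) i 0 0 v) (length (mat_syms xs) * (512 * Q * Q)) None"
        by (rule run_mono) (use bound in linarith)
      then show ?thesis using False by (simp add: square_def)
    next
      case eq: True
      have 3: "run (guard (\<lambda>r. r Rows = 0)) (cur ?q i (length xs) 0 ?v) 1 (Some (cur ?q i (length xs) 0 ?v))"
        by (rule run_guard) (use eq in \<open>simp add: read_tp_nat\<close>)
      let ?\<sigma> = "stg \<rho> (tp (int (Suc ?q)) ys) (flg (0 < i)) (tp (int (Suc i)) (ones n)) (tp (int 0) (ones m)) (tp (int 0) (ones m)) (outt ?v)"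
      have 4: "run (Act (\<lambda>r. Some ((keep r)(Flag := (1, Stay))))) ?\<sigma> 1 (Some (cur (Suc ?q) (Suc i) 0 0 ?v))"
      proof (rule run_act[OF refl])
        have "act_tape (1, Stay) (flg (0 < i)) = flg (0 < Suc i)"
          by (auto simp: flg_def tp_def fun_eq_iff)
        then show "perform ((keep (reads ?\<sigma>))(Flag := (1, Stay))) ?\<sigma> = cur (Suc ?q) (Suc i) 0 0 ?v"
          unfolding perform_upd perform_keep stg_sel by simp
      qed
      have "run mat_prog (cur (length pre) i 0 0 v) (1 + (?L * ?E + 1 + (1 + (2 * length xs + 3 + (1 + (1 + 1))))))
        (Some (cur (Suc ?q) (Suc i) 0 0 ?v))"
        unfolding mat_prog_def
        using run_seq[OF 1 run_seq[OF 2 run_seq[OF 3 run_seq[OF run_rewind_Rows run_seq[OF run_mv_Tok run_seq[OF run_mv_Mats 4]]]]]] eq by simp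
      then have "run mat_prog (cur (length pre) i 0 0 v) (length (mat_syms xs) * (512 * Q * Q)) (Some (cur (Suc ?q) (Suc i) 0 0 ?v))"
        by (rule run_mono) (use bound eq in simp)
      moreover have e: "Suc ?q = length pre + length (mat_syms xs)" by (simp add: length_mat_syms)
      moreover have "square m xs" using True eq by (simp add: square_def)
      ultimately show ?thesis unfolding e by simp
    qed
  qed
qed

lemma mat_syms_Cons: "\<exists>u. mat_syms xs = 9 # u"
  by (simp add: mat_syms_def)

lemma run_mats:
  assumes "i + length xs = n" "ys = pre @ concat (map mat_syms xs) @ c # post" "c \<noteq> 9" "1 \<le> Q"
  shows "run (While (\<lambda>r. r Tok = 9) mat_prog) (cur (length pre) i 0 0 v) (length (concat (map mat_syms xs)) * (513 * Q * Q) + 1)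
    (if \<forall>x\<in>set xs. square m x
     then Some (cur (length pre + length (concat (map mat_syms xs))) (i + length xs) 0 0 (v @ mats_out n m i xs)) else None)"
  using assms
proof (induction xs arbitrary: pre i v)
  case Nil
  have "\<not> reads (cur (length pre) i 0 0 v) Tok = 9"
    using Nil read_tp_mid[of "length pre" pre c post] by simp
  then have "run (While (\<lambda>r. r Tok = 9) mat_prog) (cur (length pre) i 0 0 v) 1 (Some (cur (length pre) i 0 0 v))"
    by (rule run_while_done)
  then show ?case using Nil by (simp add: mats_out_def)
next
  case (Cons x xs)
  have i: "i < n" using Cons.prems by simp
  have ys: "ys = pre @ mat_syms x @ (concat (map mat_syms xs) @ c # post)" using Cons.prems by simp
  obtain u where u: "mat_syms x = 9 # u" using mat_syms_Cons by blast
  have rd: "reads (cur (length pre) i 0 0 v) Tok = 9"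
    unfolding reads_stg ys u append_Cons by (rule read_tp_mid) (rule refl)
  have mat: "run mat_prog (cur (length pre) i 0 0 v) (length (mat_syms x) * (512 * Q * Q))
    (if square m x then Some (cur (length pre + length (mat_syms x)) (Suc i) 0 0 (v @ mat_out n m i 0 x)) else None)"
    by (rule run_mat_prog[OF i ys])
  have bound: "Suc (length (mat_syms x) * (512 * Q * Q) + (length (concat (map mat_syms xs)) * (513 * Q * Q) + 1))
      \<le> length (concat (map mat_syms (x # xs))) * (513 * Q * Q) + 1"
  proof -
    have "1 \<le> Q * Q" using Cons.prems by (simp add: Suc_le_eq)
    moreover have "1 \<le> length (mat_syms x)" using u by simp
    ultimately have "1 * 1 \<le> length (mat_syms x) * (Q * Q)" by (rule mult_le_mono[rotated])
    then show ?thesis by (simp add: algebra_simps)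
  qed
  show ?case
  proof (cases "square m x")
    case False
    with mat have "run mat_prog (cur (length pre) i 0 0 v) (length (mat_syms x) * (512 * Q * Q)) None"
      by simp
    from run_while_stuck[where b = "\<lambda>r. r Tok = 9", OF rd this]
    have "run (While (\<lambda>r. r Tok = 9) mat_prog) (cur (length pre) i 0 0 v) (length (concat (map mat_syms (x # xs))) * (513 * Q * Q) + 1) None"
      by (rule run_mono) (use bound in simp)
    moreover have "\<not> (\<forall>x\<in>set (x # xs). square m x)" using False by auto
    ultimately show ?thesis by (simp only: if_False)
  next
    case True
    let ?v = "v @ mat_out n m i 0 x"
    have 1: "run mat_prog (cur (length pre) i 0 0 v) (length (mat_syms x) * (512 * Q * Q)) (Some (cur (length (pre @ mat_syms x)) (Suc i) 0 0 ?v))"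
      using mat True by simp
    have 2: "run (While (\<lambda>r. r Tok = 9) mat_prog) (cur (length (pre @ mat_syms x)) (Suc i) 0 0 ?v) (length (concat (map mat_syms xs)) * (513 * Q * Q) + 1)
      (if \<forall>x\<in>set xs. square m x
       then Some (cur (length (pre @ mat_syms x) + length (concat (map mat_syms xs))) (Suc i + length xs) 0 0 (?v @ mats_out n m (Suc i) xs)) else None)"
    proof (rule Cons.IH)
      show "Suc i + length xs = n" using Cons.prems(1) by simp
      show "ys = (pre @ mat_syms x) @ concat (map mat_syms xs) @ c # post" unfolding ys append_assoc ..
      show "c \<noteq> 9" "1 \<le> Q" by (rule Cons.prems)+
    qed
    have 3: "run (While (\<lambda>r. r Tok = 9) mat_prog) (cur (length pre) i 0 0 v) (length (concat (map mat_syms (x # xs))) * (513 * Q * Q) + 1)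
      (if \<forall>x\<in>set xs. square m x
       then Some (cur (length (pre @ mat_syms x) + length (concat (map mat_syms xs))) (Suc i + length xs) 0 0 (?v @ mats_out n m (Suc i) xs)) else None)"
      by (rule run_mono[OF run_while_step[where b = "\<lambda>r. r Tok = 9", OF rd 1 2] bound])
    have e: "length (pre @ mat_syms x) + length (concat (map mat_syms xs)) = length pre + length (concat (map mat_syms (x # xs)))"
      "Suc i + length xs = i + length (x # xs)" "?v @ mats_out n m (Suc i) xs = v @ mats_out n m i (x # xs)"
      "(\<forall>x\<in>set xs. square m x) \<longleftrightarrow> (\<forall>x\<in>set (x # xs). square m x)"
      using True by (simp_all add: mats_out_def)
    show ?thesis using 3 unfolding e .
  qed
qed

end

section \<open>Parsing the input\<close>

text \<open>A finite automaton parses the input. State \<open>0\<close> is initial and \<open>9\<close> final; \<open>1, 2, 3\<close> are inside the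
  instance, a matrix, a row; \<open>4, \<dots>, 8\<close> are inside a rational: before, in and after the numerator, in and
  after the denominator. The output symbol goes to \<open>Tok\<close>.\<close>

fun delta :: "nat \<Rightarrow> bool \<Rightarrow> bool \<Rightarrow> (nat \<times> nat) option" where
  "delta m False b = (if m = 5 \<or> m = 7 then Some (m, bsym b) else None)"
| "delta m True False = (if m = 0 then Some (1, 11) else if m = 1 then Some (2, 9) else if m = 2 then Some (3, 7)
     else if m = 3 then Some (4, 5) else if m = 4 then Some (5, 3) else if m = 6 then Some (7, 3) else None)"
| "delta m True True = (if m = 1 then Some (9, 12) else if m = 2 then Some (1, 10) else if m = 3 then Some (2, 8)
     else if m = 5 then Some (6, 4) else if m = 7 then Some (8, 4) else if m = 8 then Some (3, 6) else None)"

fun scan :: "nat \<Rightarrow> bool list \<Rightarrow> (nat \<times> nat list) option" where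
  "scan m [] = Some (m, [])"
| "scan m [a] = None"
| "scan m (a # b # w) = (case delta m a b of None \<Rightarrow> None
     | Some (m', s) \<Rightarrow> map_option (\<lambda>(m'', L). (m'', s # L)) (scan m' w))"

text \<open>The state obeys the same bound as the symbols because it is stored as a symbol on the
  tape \<open>Mode\<close>.\<close>

lemma delta_code: "delta m a b = Some (m', s) \<Longrightarrow> code s = [a, b] \<and> s < 13 \<and> m' < 13"
  by (induction m a b rule: delta.induct) (auto simp: code_def bsym_def split: if_splits)

lemma scan_code: "scan m w = Some (m', L) \<Longrightarrow> concat (map code L) = w"
  by (induction m w arbitrary: L rule: scan.induct) (auto simp: delta_code split: option.splits)

text \<open>The symbols of an instance read up to a point where one bracket is still open;
  \<open>open2\<close> and \<open>open3\<close> are the analogues for two and three open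
  brackets.\<close>

definition open1 :: "raw list list list \<Rightarrow> nat list" where
  "open1 A = 11 # concat (map mat_syms A)"

definition open2 :: "raw list list list \<Rightarrow> raw list list \<Rightarrow> nat list" where
  "open2 A B = open1 A @ 9 # concat (map row_syms B)"

definition open3 :: "raw list list list \<Rightarrow> raw list list \<Rightarrow> raw list \<Rightarrow> nat list" where
  "open3 A B C = open2 A B @ 7 # concat (map rat_syms C)"

text \<open>The invariant of the automaton: for each state, the shape of the symbols produced so
  far.\<close>

inductive scanned :: "nat \<Rightarrow> nat list \<Rightarrow> bool" where
  "scanned 0 []"
| "scanned 1 (open1 A)"
| "scanned 2 (open2 A B)"
| "scanned 3 (open3 A B C)"
| "scanned 4 (open3 A B C @ [5])"
| "scanned 5 (open3 A B C @ [5, 3] @ map bsym p)"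
| "scanned 6 (open3 A B C @ [5, 3] @ map bsym p @ [4])"
| "scanned 7 (open3 A B C @ [5, 3] @ map bsym p @ [4, 3] @ map bsym q)"
| "scanned 8 (open3 A B C @ [5, 3] @ map bsym p @ [4, 3] @ map bsym q @ [4])"
| "scanned 9 (all_syms A)"

lemma scanned_eqs:
  "[11] = open1 []" "open1 A @ [9] = open2 A []" "open2 A B @ [7] = open3 A B []"
  "open1 A @ [12] = all_syms A" "open2 A B @ [10] = open1 (A @ [B])" "open3 A B C @ [8] = open2 A (B @ [C])"
  "open3 A B C @ [5, 3] @ map bsym p @ [4, 3] @ map bsym q @ [4, 6] = open3 A B (C @ [(p, q)])"
  by (simp_all add: open1_def open2_def open3_def all_syms_def mat_syms_def row_syms_def rat_syms_def)

lemma scanned_bit: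
  assumes "scanned m L" "delta m False b = Some (m', s)"
  shows "scanned m' (L @ [s])"
proof -
  from assms(2) have "m' = m" "s = bsym b" "m = 5 \<or> m = 7" by (auto split: if_splits)
  with assms(1) show ?thesis
  proof (cases rule: scanned.cases)
    case (6 A B C p)
    then show ?thesis using scanned.intros(6)[of A B C "p @ [b]"] \<open>m' = m\<close> \<open>s = bsym b\<close> by simp
  next
    case (8 A B C p q)
    then show ?thesis using scanned.intros(8)[of A B C p "q @ [b]"] \<open>m' = m\<close> \<open>s = bsym b\<close> by simp
  qed auto
qed

lemma scanned_open:
  assumes "scanned m L" "delta m True False = Some (m', s)"
  shows "scanned m' (L @ [s])"
  using assms
proof (cases rule: scanned.cases)
  case 1
  then show ?thesis using assms scanned.intros(2)[of "[]"] by (simp add: scanned_eqs(1))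
next
  case (2 A)
  then show ?thesis using assms scanned.intros(3)[of A "[]"] by (simp add: scanned_eqs)
next
  case (3 A B)
  then show ?thesis using assms scanned.intros(4)[of A B "[]"] by (simp add: scanned_eqs)
next
  case (4 A B C)
  then show ?thesis using assms scanned.intros(5)[of A B C] by simp
next
  case (5 A B C)
  then show ?thesis using assms scanned.intros(6)[of A B C "[]"] by simp
next
  case (7 A B C p)
  then show ?thesis using assms scanned.intros(8)[of A B C p "[]"] by simp
qed auto

lemma scanned_close:
  assumes "scanned m L" "delta m True True = Some (m', s)"
  shows "scanned m' (L @ [s])"
  using assms
proof (cases rule: scanned.cases)
  case (2 A)
  then show ?thesis using assms scanned.intros(10)[of A] by (simp add: scanned_eqs)
next
  case (3 A B)
  then show ?thesis using assms scanned.intros(2)[of "A @ [B]"] by (simp add: scanned_eqs)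
next
  case (4 A B C)
  then show ?thesis using assms scanned.intros(3)[of A "B @ [C]"] by (simp add: scanned_eqs)
next
  case (6 A B C p)
  then show ?thesis using assms scanned.intros(7)[of A B C p] by simp
next
  case (8 A B C p q)
  then show ?thesis using assms scanned.intros(9)[of A B C p q] by simp
next
  case (9 A B C p q)
  then show ?thesis using assms scanned.intros(4)[of A B "C @ [(p, q)]"] by (simp flip: scanned_eqs)
qed auto

lemma scanned_scan:
  "scanned m L \<Longrightarrow> scan m w = Some (m', L') \<Longrightarrow> scanned m' (L @ L')"
proof (induction m w arbitrary: L L' rule: scan.induct)
  case (3 m a b w)
  from 3(3) obtain m1 s L1 where 1: "delta m a b = Some (m1, s)" "scan m1 w = Some (m', L1)" "L' = s # L1"
    by (auto split: option.splits)
  have "scanned m1 (L @ [s])"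
  proof (cases a)
    case False
    then show ?thesis using scanned_bit[OF 3(2)] 1(1) by simp
  next
    case True
    then show ?thesis using scanned_open[OF 3(2)] scanned_close[OF 3(2)] 1(1) by (cases b) auto
  qed
  from 3(1)[OF 1(1) refl this 1(2)] show ?case using 1(3) by simp
qed auto

lemma scan_sound: "scan 0 w = Some (9, L) \<Longrightarrow> \<exists>xs. L = all_syms xs"
  using scanned_scan[OF scanned.intros(1), of w 9 L] by (auto elim: scanned.cases)

text \<open>This form composes along the bracket structure, since a complete rational, row or matrix
  leads the automaton from the state of its surroundings back to the same state.\<close>

definition scans_to :: "nat \<Rightarrow> nat list \<Rightarrow> nat \<Rightarrow> bool" where
  "scans_to m L m' \<longleftrightarrow> scan m (concat (map code L)) = Some (m', L)"

lemma scans_to_Nil: "scans_to m [] m"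
  by (simp add: scans_to_def)

lemma scans_to_Cons: "delta m (hd (code s)) (hd (tl (code s))) = Some (m1, s) \<Longrightarrow> scans_to m1 L m' \<Longrightarrow> scans_to m (s # L) m'"
  by (simp add: scans_to_def code_def)

lemma scan_append: "scan m u = Some (m1, L1) \<Longrightarrow>
    scan m (u @ v) = map_option (\<lambda>(m2, L2). (m2, L1 @ L2)) (scan m1 v)"
proof (induction m u arbitrary: L1 rule: scan.induct)
  case (1 m)
  then show ?case by (cases "scan m v") auto
next
  case (3 m a b w)
  then obtain m2 s L2 where 1: "delta m a b = Some (m2, s)" "scan m2 w = Some (m1, L2)" "L1 = s # L2"
    by (auto split: option.splits)
  from 3(1)[OF 1(1) refl 1(2)] 1 show ?case by (cases "scan m1 v") auto
qed auto

lemma scans_to_append: "scans_to m L m1 \<Longrightarrow> scans_to m1 L' m2 \<Longrightarrow> scans_to m (L @ L') m2"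
  by (simp add: scans_to_def scan_append)

lemma scans_to_bits: "m = 5 \<or> m = 7 \<Longrightarrow> scans_to m (map bsym p) m"
proof (induction p)
  case (Cons b p)
  then show ?case by (auto intro!: scans_to_Cons[where ?m1.0 = m] simp: code_def bsym_def)
qed (simp add: scans_to_Nil)

lemma scans_to_concat: "(\<And>x. scans_to m (f x) m) \<Longrightarrow> scans_to m (concat (map f xs)) m"
  by (induction xs) (auto simp: scans_to_Nil intro: scans_to_append)

lemma scans_to_single: "delta m (hd (code s)) (hd (tl (code s))) = Some (m1, s) \<Longrightarrow> scans_to m [s] m1"
  using scans_to_Cons scans_to_Nil by blast

lemma scans_to_rat: "scans_to 3 (rat_syms x) 3"
  unfolding rat_syms_def
  by (intro scans_to_append[of 3 _ 5] scans_to_append[of 5 _ 5] scans_to_append[of 5 _ 7] scans_to_append[of 7 _ 7] scans_to_bits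
      scans_to_Cons[of 3 5 4] scans_to_single[of 4 3 5] scans_to_Cons[of 5 4 6] scans_to_single[of 6 3 7] scans_to_Cons[of 7 4 8] scans_to_single[of 8 6 3])
    (auto simp: code_def)

lemma scans_to_row: "scans_to 2 (row_syms xs) 2"
  unfolding row_syms_def
  by (intro scans_to_append[of 2 _ 3] scans_to_append[of 3 _ 3] scans_to_concat scans_to_rat scans_to_single) (auto simp: code_def)

lemma scans_to_mat: "scans_to 1 (mat_syms xs) 1"
  unfolding mat_syms_def
  by (intro scans_to_append[of 1 _ 2] scans_to_append[of 2 _ 2] scans_to_concat scans_to_row scans_to_single) (auto simp: code_def)

lemma scan_complete: "scan 0 (concat (map code (all_syms xs))) = Some (9, all_syms xs)"
proof -
  have "scans_to 0 (all_syms xs) 9"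
    unfolding all_syms_def
    by (intro scans_to_append[of 0 _ 1] scans_to_append[of 1 _ 1] scans_to_concat scans_to_mat scans_to_single) (auto simp: code_def)
  then show ?thesis by (simp add: scans_to_def)
qed

section \<open>Counting matrices and rows during the scan\<close>

definition nmat :: "nat list \<Rightarrow> nat" where
  "nmat L = length (filter (\<lambda>s. s = 9) L)"

text \<open>The rows closed before the first matrix closes: this number of rows of
  \<open>A_0\<close> is taken as the size \<open>m\<close>, against which all row lengths and the
  other matrices are compared later.\<close>

definition nrow :: "nat list \<Rightarrow> nat" where
  "nrow L = length (filter (\<lambda>s. s = 8) (takeWhile (\<lambda>s. s \<noteq> 10) L))"

lemma nmat_snoc: "nmat (L @ [s]) = nmat L + of_bool (s = 9)"
  by (simp add: nmat_def)

text \<open>One bit, whether \<open>10\<close> has occurred, suffices to keep the count up to date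
  symbol by symbol; it is held on \<open>Flag\<close> during the scan.\<close>

lemma nrow_snoc: "nrow (L @ [s]) = nrow L + of_bool (s = 8 \<and> 10 \<notin> set L)"
proof (cases "10 \<in> set L")
  case True
  then show ?thesis by (auto simp: nrow_def)
next
  case False
  then have "takeWhile (\<lambda>s. s \<noteq> 10) (L @ xs) = L @ takeWhile (\<lambda>s. s \<noteq> 10) xs" for xs
    by (intro takeWhile_append2) auto
  from this[of "[s]"] this[of "[]"] False show ?thesis by (simp add: nrow_def del: takeWhile_eq_all_conv)
qed

lemma nmat_le: "nmat L \<le> length L"
  by (simp add: nmat_def)

lemma nrow_le: "nrow L \<le> length L"
  unfolding nrow_def by (meson length_filter_le length_takeWhile_le order_trans)

lemma notin_rat_syms: "c > 6 \<Longrightarrow> c \<notin> set (rat_syms x)"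
  using bsym_neq(2)[of c] by (auto simp: rat_syms_def dest: sym)

lemma notin_row_syms: "c > 8 \<Longrightarrow> c \<notin> set (row_syms x)"
  using notin_rat_syms[of c] by (auto simp: row_syms_def)

lemma filter_8_row: "filter (\<lambda>s. s = 8) (row_syms x) = [8]"
proof -
  have "filter (\<lambda>s. s = 8) (concat (map rat_syms x)) = []"
    using notin_rat_syms[of 8] by (auto simp: filter_empty_conv)
  then show ?thesis by (simp add: row_syms_def)
qed

lemma filter_9_mat: "filter (\<lambda>s. s = 9) (mat_syms x) = [9]"
proof -
  have "filter (\<lambda>s. s = 9) (concat (map row_syms x)) = []"
    using notin_row_syms[of 9] by (auto simp: filter_empty_conv)
  then show ?thesis by (simp add: mat_syms_def)
qed

lemma nmat_all: "nmat (all_syms xs) = length xs"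
proof -
  have "length (filter (\<lambda>s. s = 9) (concat (map mat_syms xs))) = length xs"
    by (induction xs) (auto simp: filter_9_mat)
  then show ?thesis by (simp add: nmat_def all_syms_def)
qed

lemma nrow_all: "xs \<noteq> [] \<Longrightarrow> nrow (all_syms xs) = length (hd xs)"
proof -
  assume "xs \<noteq> []"
  then obtain x xs' where xs: "xs = x # xs'" by (cases xs) auto
  define u where "u = concat (map mat_syms xs') @ [12]"
  have "takeWhile (\<lambda>s. s \<noteq> 10) (11 # 9 # concat (map row_syms x) @ 10 # u) = 11 # 9 # concat (map row_syms x)"
    using notin_row_syms[of 10] by (auto simp: takeWhile_append)
  moreover have "all_syms xs = 11 # 9 # concat (map row_syms x) @ 10 # u"
    by (simp add: xs all_syms_def mat_syms_def u_def)
  moreover have "length (filter (\<lambda>s. s = 8) (concat (map row_syms x))) = length x"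
    by (induction x) (auto simp: filter_8_row)
  ultimately show ?thesis by (simp add: nrow_def xs)
qed

text \<open>The first bit of a symbol waits in the cell of \<open>Tok\<close> that
  \<open>read2\<close> overwrites with the symbol itself.\<close>

definition read1 :: com where
  "read1 = Act (\<lambda>r. Some ((keep r)(Tok := (r Inp, Stay), Inp := (r Inp, Right))))"

text \<open>A blank in place of the second bit means an input of odd length, which is rejected.
  \<open>Rows\<close> and \<open>Cols\<close> receive the same number of cells because the matrices
  are to be square.\<close>

definition read2 :: com where
  "read2 = Act (\<lambda>r. if r Inp = 0 then None else case delta (r Mode) (r Tok = 2) (r Inp = 2) of None \<Rightarrow> None
     | Some (m, s) \<Rightarrow> Some ((keep r)(Inp := (r Inp, Right), Tok := (s, Right), Mode := (m, Stay),
         Mats := if s = 9 then (1, Right) else (r Mats, Stay),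
         Rows := if s = 8 \<and> r Flag = 0 then (1, Right) else (r Rows, Stay),
         Cols := if s = 8 \<and> r Flag = 0 then (1, Right) else (r Cols, Stay),
         Flag := if s = 10 then (1, Stay) else (r Flag, Stay))))"

lemma stg_Inp [simp]:
  "(stg \<rho> tok fl ma ro co ou)(Inp := x) = stg (\<rho>(Inp := x)) tok fl ma ro co ou"
  "(stg \<rho> tok fl ma ro co ou)(Mode := x) = stg (\<rho>(Mode := x)) tok fl ma ro co ou"
  "stg \<rho> tok fl ma ro co ou Inp = \<rho> Inp" "stg \<rho> tok fl ma ro co ou Mode = \<rho> Mode"
  "reads (stg \<rho> tok fl ma ro co ou) Inp = read_tape (\<rho> Inp)" "reads (stg \<rho> tok fl ma ro co ou) Mode = read_tape (\<rho> Mode)"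
  by (auto simp: stg_def fun_eq_iff reads_def)

definition rho :: "bool list \<Rightarrow> nat \<Rightarrow> nat \<Rightarrow> store" where
  "rho w p m = (\<lambda>_. blank_tape)(Inp := tp (int p) (map bsym w), Mode := tp 0 [m])"

lemma rho_sel [simp]: "rho w p m Inp = tp (int p) (map bsym w)" "rho w p m Mode = tp 0 [m]"
  by (simp_all add: rho_def)

lemma rho_upd [simp]: "(rho w p m)(Inp := tp (int q) (map bsym w)) = rho w q m" "(rho w p m)(Mode := tp 0 [m']) = rho w p m'"
  by (auto simp: rho_def fun_eq_iff)

definition scanst :: "bool list \<Rightarrow> nat \<Rightarrow> nat \<Rightarrow> nat list \<Rightarrow> store" where
  "scanst w p m L = stg (rho w p m) (tp (int (length L)) L) (flg (10 \<in> set L)) (tp (int (nmat L)) (ones (nmat L)))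
     (tp (int (nrow L)) (ones (nrow L))) (tp (int (nrow L)) (ones (nrow L))) (outt [])"

lemma act_ones: "act_tape (1, Right) (tp (int n) (ones n)) = tp (int (Suc n)) (ones (Suc n))"
  by (simp add: act_tp_append replicate_append_same add.commute)

lemma act_keep_Stay [simp]: "act_tape (read_tape t, Stay) t = t"
  by (cases t) simp

lemma map_bsym_upd: "p < length w \<Longrightarrow> (map bsym w)[p := bsym (w ! p)] = map bsym w"
  by (metis list_update_id map_update)

lemma bsym_pos [simp]: "0 < bsym b"
  by (simp add: bsym_def)

lemma run_read1:
  assumes "p < length w"
  shows "run read1 (scanst w p m L) 1 (Some ((scanst w (Suc p) m L)(Tok := tp (int (length L)) (L @ [bsym (w ! p)]))))"
  unfolding read1_def
proof (rule run_act[OF refl])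
  let ?s = "scanst w p m L"
  have r: "reads ?s Inp = bsym (w ! p)" using assms by (simp add: scanst_def read_tp_nat)
  have i: "act_tape (bsym (w ! p), Right) (tp (int p) (map bsym w)) = tp (int (Suc p)) (map bsym w)"
    using assms by (simp add: act_tp add.commute map_bsym_upd)
  show "perform ((keep (reads ?s))(Tok := (reads ?s Inp, Stay), Inp := (reads ?s Inp, Right))) ?s
    = (scanst w (Suc p) m L)(Tok := tp (int (length L)) (L @ [bsym (w ! p)]))"
    unfolding perform_upd perform_keep r unfolding scanst_def using i by (simp add: act_tp_append del: of_nat_Suc)
qed

lemma run_read2:
  assumes "p < length w"
  shows "run read2 ((scanst w p m L)(Tok := tp (int (length L)) (L @ [bsym a]))) 1
    (case delta m a (w ! p) of None \<Rightarrow> None | Some (m', s) \<Rightarrow> Some (scanst w (Suc p) m' (L @ [s])))"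
proof -
  let ?s = "(scanst w p m L)(Tok := tp (int (length L)) (L @ [bsym a]))"
  have r: "reads ?s Inp = bsym (w ! p)" "reads ?s Mode = m" "reads ?s Tok = bsym a" "reads ?s Flag = of_bool (10 \<in> set L)"
    using assms by (simp_all add: scanst_def read_tp_nat read_tp)
  have b: "(bsym b = 2) = b" "bsym b \<noteq> 0" for b by (auto simp: bsym_def)
  show ?thesis
  proof (cases "delta m a (w ! p)")
    case None
    have "run read2 ?s 1 None" unfolding read2_def
      by (rule run_act_stuck) (simp only: r b None option.case if_False)
    then show ?thesis using None by simp
  next
    case (Some y)
    then obtain m' s where d: "delta m a (w ! p) = Some (m', s)" by (cases y) auto
    have i: "act_tape (bsym (w ! p), Right) (tp (int p) (map bsym w)) = tp (int (Suc p)) (map bsym w)"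
      using assms by (simp add: act_tp add.commute map_bsym_upd)
    have t: "act_tape (s, Right) (tp (int (length L)) (L @ [bsym a])) = tp (int (length (L @ [s]))) (L @ [s])"
      by (simp add: act_tp add.commute)
    have md: "act_tape (m', Stay) (tp 0 [m]) = tp 0 [m']" using act_tp[of 0 "[m]" m' Stay] by simp
    have fl: "act_tape (if s = 10 then (1, Stay) else (of_bool (10 \<in> set L), Stay)) (flg (10 \<in> set L)) = flg (10 \<in> set (L @ [s]))"
      using act_keep_Stay[of "flg (10 \<in> set L)"] by (auto simp: flg_def tp_def fun_eq_iff)
    have ma: "act_tape (if s = 9 then (1, Right) else (read_tape (tp (int (nmat L)) (ones (nmat L))), Stay)) (tp (int (nmat L)) (ones (nmat L)))
      = tp (int (nmat (L @ [s]))) (ones (nmat (L @ [s])))"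
      using act_ones[of "nmat L"] by (auto simp: nmat_snoc add.commute)
    have ro: "act_tape (if s = 8 \<and> of_bool (10 \<in> set L) = (0::nat) then (1, Right) else (read_tape (tp (int (nrow L)) (ones (nrow L))), Stay)) (tp (int (nrow L)) (ones (nrow L)))
      = tp (int (nrow (L @ [s]))) (ones (nrow (L @ [s])))"
      using act_ones[of "nrow L"] by (auto simp: nrow_snoc add.commute)
    have rr: "reads ?s Mats = read_tape (tp (int (nmat L)) (ones (nmat L)))" "reads ?s Rows = read_tape (tp (int (nrow L)) (ones (nrow L)))"
      "reads ?s Cols = read_tape (tp (int (nrow L)) (ones (nrow L)))"
      by (simp_all add: scanst_def)
    let ?a = "(keep (reads ?s))(Inp := (bsym (w ! p), Right), Tok := (s, Right), Mode := (m', Stay),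
         Mats := if s = 9 then (1, Right) else (read_tape (tp (int (nmat L)) (ones (nmat L))), Stay),
         Rows := if s = 8 \<and> of_bool (10 \<in> set L) = (0::nat) then (1, Right) else (read_tape (tp (int (nrow L)) (ones (nrow L))), Stay),
         Cols := if s = 8 \<and> of_bool (10 \<in> set L) = (0::nat) then (1, Right) else (read_tape (tp (int (nrow L)) (ones (nrow L))), Stay),
         Flag := if s = 10 then (1, Stay) else (of_bool (10 \<in> set L), Stay))"
    have "run read2 ?s 1 (Some (scanst w (Suc p) m' (L @ [s])))"
      unfolding read2_def
    proof (rule run_act[where a = ?a])
      show "perform ?a ?s = scanst w (Suc p) m' (L @ [s])"
        unfolding perform_upd perform_keep
        by (simp only: scanst_def stg_upd stg_sel stg_Inp rho_sel rho_upd i t md fl ma ro)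
    qed (simp only: r rr b d option.case prod.case if_False)
    then show ?thesis using d by simp
  qed
qed

definition scan_prog :: com where
  "scan_prog = While (\<lambda>r. r Inp \<noteq> 0) (read1 ;; read2)"

lemma run_scan_prog:
  assumes "w = u @ w'"
  shows "run scan_prog (scanst w (length u) m L) (2 * length w' + 1)
    (case scan m w' of None \<Rightarrow> None | Some (m', L') \<Rightarrow> Some (scanst w (length w) m' (L @ L')))"
  using assms
proof (induction m w' arbitrary: u L rule: scan.induct)
  case (1 m)
  have "\<not> reads (scanst w (length u) m L) Inp \<noteq> 0" using 1 by (simp add: scanst_def read_tp_nat)
  then have "run scan_prog (scanst w (length u) m L) 1 (Some (scanst w (length u) m L))"
    unfolding scan_prog_def by (rule run_while_done)
  then show ?case using 1 by simp
next
  case (2 m a)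
  have r: "reads (scanst w (length u) m L) Inp \<noteq> 0" using 2 by (simp add: scanst_def read_tp_nat nth_append)
  have 1: "run read1 (scanst w (length u) m L) 1 (Some ((scanst w (Suc (length u)) m L)(Tok := tp (int (length L)) (L @ [bsym a]))))"
    using run_read1[of "length u" w m L] 2 by simp
  have 2: "run read2 ((scanst w (Suc (length u)) m L)(Tok := tp (int (length L)) (L @ [bsym a]))) 1 None"
    unfolding read2_def by (rule run_act_stuck) (use 2 in \<open>simp add: scanst_def read_tp_nat del: of_nat_Suc\<close>)
  have "run scan_prog (scanst w (length u) m L) (Suc (1 + 1)) None"
    unfolding scan_prog_def by (rule run_while_stuck[where b = "\<lambda>r. r Inp \<noteq> 0", OF r run_seq[OF 1 2]])
  then show ?case by (simp add: numeral_eq_Suc)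
next
  case (3 m a b w')
  let ?u = "u @ [a, b]"
  have r: "reads (scanst w (length u) m L) Inp \<noteq> 0" using 3(2) by (simp add: scanst_def read_tp_nat nth_append)
  have 1: "run read1 (scanst w (length u) m L) 1 (Some ((scanst w (Suc (length u)) m L)(Tok := tp (int (length L)) (L @ [bsym a]))))"
    using run_read1[of "length u" w m L] 3(2) by simp
  have wb: "w ! Suc (length u) = b" "Suc (length u) < length w" using 3(2) by (auto simp: nth_append)
  have 2: "run read2 ((scanst w (Suc (length u)) m L)(Tok := tp (int (length L)) (L @ [bsym a]))) 1
    (case delta m a b of None \<Rightarrow> None | Some (m', s) \<Rightarrow> Some (scanst w (length ?u) m' (L @ [s])))"
  proof -
    have "length ?u = Suc (Suc (length u))" by simp
    then show ?thesis using run_read2[OF wb(2), of m L a] wb(1) by (simp only:)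
  qed
  show ?case
  proof (cases "delta m a b")
    case None
    with 2 have 2: "run read2 ((scanst w (Suc (length u)) m L)(Tok := tp (int (length L)) (L @ [bsym a]))) 1 None" by simp
    have "run scan_prog (scanst w (length u) m L) (Suc (1 + 1)) None"
      unfolding scan_prog_def by (rule run_while_stuck[where b = "\<lambda>r. r Inp \<noteq> 0", OF r run_seq[OF 1 2]])
    then have "run scan_prog (scanst w (length u) m L) (2 * length (a # b # w') + 1) None"
      by (rule run_mono) simp
    then show ?thesis using None by simp
  next
    case (Some y)
    then obtain m' s where d: "delta m a b = Some (m', s)" by (cases y) auto
    with 2 have 2: "run read2 ((scanst w (Suc (length u)) m L)(Tok := tp (int (length L)) (L @ [bsym a]))) 1
      (Some (scanst w (length ?u) m' (L @ [s])))" by simp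
    have IH: "run scan_prog (scanst w (length ?u) m' (L @ [s])) (2 * length w' + 1)
      (case scan m' w' of None \<Rightarrow> None | Some (m'', L') \<Rightarrow> Some (scanst w (length w) m'' ((L @ [s]) @ L')))"
      by (rule 3(1)[OF d refl]) (use 3(2) in simp)
    have "run scan_prog (scanst w (length u) m L) (Suc ((1 + 1) + (2 * length w' + 1)))
      (case scan m' w' of None \<Rightarrow> None | Some (m'', L') \<Rightarrow> Some (scanst w (length w) m'' ((L @ [s]) @ L')))"
      using run_while_step[where b = "\<lambda>r. r Inp \<noteq> 0", OF r run_seq[OF 1 2] IH[unfolded scan_prog_def]] unfolding scan_prog_def .
    then have "run scan_prog (scanst w (length u) m L) (2 * length (a # b # w') + 1)
      (case scan m' w' of None \<Rightarrow> None | Some (m'', L') \<Rightarrow> Some (scanst w (length w) m'' ((L @ [s]) @ L')))"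
      by (rule run_mono) simp
    then show ?thesis using d by (cases "scan m' w'") auto
  qed
qed

lemma init_store_scanst: "init_store w = scanst w 0 0 []"
  by (auto simp: init_store_def scanst_def rho_def stg_def fun_eq_iff input_tape_tp nmat_def nrow_def
      blank_tape_def flg_def outt_def tp_def)

section \<open>The reduction\<close>

text \<open>The final state \<open>9\<close> certifies the bracket structure. The test of
  \<open>Mats\<close> demands at least one matrix, as \<open>A_0\<close> is part of every instance.
  \<open>Flag\<close> is cleared because its role changes: from here on it tells whether
  \<open>A_0\<close> has been processed.\<close>

definition prep_prog :: com where
  "prep_prog = guard (\<lambda>r. r Mode = 9) ;; rewind {Tok} Tok ;; rewind {Mats} Mats ;; rewind {Rows} Rows ;; rewind {Cols} Cols ;;
     Act (\<lambda>r. if r Mats = 1 then Some ((keep r)(Flag := (0, Stay))) else None)"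

abbreviation unary_prog :: com where
  "unary_prog \<equiv> emit (enc_bit True)"

text \<open>A sweep visits each variable exactly once; writing the same digit at every visit gives
  the number of variables in unary.\<close>

definition header_prog :: com where
  "header_prog = emit [True, False, True, False] ;;
     sweep unary_prog unary_prog unary_prog unary_prog unary_prog Rows Cols ;; emit [True, True, True, False] ;;
     term_prog (emit (enc_rat 1)) (vec_prog 2 no_mark no_mark no_mark no_mark Rows Cols) ;;
     term_prog (emit (enc_rat 2)) (vec_prog 1 no_mark no_mark no_mark no_mark Rows Cols)"

definition reduce_prog :: com where
  "reduce_prog = scan_prog ;; prep_prog ;; header_prog ;; mv {Tok} Right ;; While (\<lambda>r. r Tok = 9) mat_prog ;;
     emit [True, True, True, True] ;; rewind {Out} Out"

definition num_vars :: "nat \<Rightarrow> nat \<Rightarrow> nat" where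
  "num_vars n m = Suc (2 * n + m + m * m)"

definition const_exps :: "nat \<Rightarrow> nat \<Rightarrow> nat \<Rightarrow> nat list" where
  "const_exps n m e = exps n m e (\<lambda>_. 0) (\<lambda>_. 0) (\<lambda>_. 0) (\<lambda>_ _. 0)"

definition header_out :: "nat \<Rightarrow> nat \<Rightarrow> bool list" where
  "header_out n m = [True, False] @ enc_list enc_bit (replicate (num_vars n m) True) @ [True, False] @
     raw_term (enc_rat 1) (const_exps n m 2) @ raw_term (enc_rat 2) (const_exps n m 1)"

definition reduction :: "nat \<Rightarrow> nat \<Rightarrow> raw list list list \<Rightarrow> bool list" where
  "reduction n m xs = header_out n m @ mats_out n m 0 xs @ [True, True, True, True]"

text \<open>The terms \<open>e\<^sup>2\<close> and \<open>2 e\<close> of the header have constant coefficients, whose encodings need not be computed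
  for the time bound.\<close>

definition kappa :: nat where
  "kappa = length (enc_rat 1) + length (enc_rat 2)"

lemma emits_header:
  assumes \<sigma>: "\<sigma> = stg \<rho> tok fl (tp 0 (ones n)) (tp 0 (ones m)) (tp 0 (ones m)) ou"
    and Q: "n \<le> Q" "m \<le> Q" "1 \<le> Q"
  shows "emits header_prog \<sigma> (360 * Q * Q + kappa + 40) (header_out n m)"
proof -
  have u: "emits unary_prog \<tau> 12 (enc_bit True)" for \<tau>
    by (rule emits_mono[OF emits_emit]) (simp add: enc_bit_def)
  have 1: "emits (sweep unary_prog unary_prog unary_prog unary_prog unary_prog Rows Cols) \<sigma> (120 * Q * Q)
    (enc_bit True @ concat (map (\<lambda>_. enc_bit True) [0..<n]) @ concat (map (\<lambda>_. enc_bit True) [0..<n]) @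
      concat (map (\<lambda>_. enc_bit True) [0..<m]) @ concat (map (\<lambda>i. concat (map (\<lambda>_. enc_bit True) [0..<m])) [0..<m]))"
    by (rule emits_sweep[where X = "ones n" and R = "ones m" and C = "ones m"]) (use u Q in \<open>simp_all add: \<sigma>\<close>)
  have e: "concat (map (\<lambda>_. enc_bit True) [0..<k]) = concat (map enc_bit (replicate k True))" for k
    by (induction k) (auto simp: replicate_append_same[symmetric])
  have e2: "concat (map (\<lambda>i. concat (map enc_bit (replicate m True))) [0..<k]) = concat (map enc_bit (replicate (k * m) True))" for k
    by (induction k) (simp_all add: replicate_add add.commute[of m])
  have eq: "enc_bit True @ concat (map (\<lambda>_. enc_bit True) [0..<n]) @ concat (map (\<lambda>_. enc_bit True) [0..<n]) @
      concat (map (\<lambda>_. enc_bit True) [0..<m]) @ concat (map (\<lambda>i. concat (map (\<lambda>_. enc_bit True) [0..<m])) [0..<m])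
    = concat (map enc_bit (replicate (num_vars n m) True))"
    unfolding e e2 num_vars_def by (simp add: mult_2 replicate_add)
  have v: "emits (vec_prog k no_mark no_mark no_mark no_mark Rows Cols) \<sigma> (120 * Q * Q) (concat (map enc_nat (const_exps n m k)))" if "k \<le> 2" for k
    unfolding const_exps_def
    by (rule emits_vec_prog[where X = "ones n" and R = "ones m" and C = "ones m"]) (use Q that in \<open>simp_all add: \<sigma>\<close>)
  have "emits header_prog \<sigma> (Suc (length [True, False, True, False]) + (120 * Q * Q + (Suc (length [True, True, True, False]) +
      ((Suc (length (enc_rat 1)) + 120 * Q * Q + 11) + (Suc (length (enc_rat 2)) + 120 * Q * Q + 11)))))
    ([True, False, True, False] @ concat (map enc_bit (replicate (num_vars n m) True)) @ [True, True, True, False] @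
      raw_term (enc_rat 1) (const_exps n m 2) @ raw_term (enc_rat 2) (const_exps n m 1))"
    unfolding header_prog_def
    by (intro emits_seq emits_emit emits_term_prog 1[unfolded eq] v) auto
  then have "emits header_prog \<sigma> (Suc (length [True, False, True, False]) + (120 * Q * Q + (Suc (length [True, True, True, False]) +
      ((Suc (length (enc_rat 1)) + 120 * Q * Q + 11) + (Suc (length (enc_rat 2)) + 120 * Q * Q + 11)))))
    (header_out n m)"
    by (simp add: header_out_def enc_list_def bracket_def)
  then show ?thesis
    by (rule emits_mono) (simp add: kappa_def)
qed

text \<open>It bounds the final rewinding of \<open>Out\<close> by the time spent before, so the
  length of the output need not be computed.\<close>

lemma length_out_le:
  assumes "run c (init_store w) t (Some \<sigma>)" "\<sigma> Out = outt v"
  shows "length v \<le> t"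
proof -
  obtain n where n: "n \<le> t" "exec c (init_store w) n (Some \<sigma>)" using assms(1) unfolding run_def by blast
  have "inside (0 + n) (\<sigma> Out)"
    by (rule exec_inside[OF n(2) refl]) (auto simp: init_store_def blank_tape_def inside_def)
  then show ?thesis using assms(2) n(1) by (auto simp: inside_def outt_def)
qed

lemma run_prep:
  assumes L: "0 \<notin> set L" "length L \<le> Q"
  shows "run prep_prog (scanst w p m L) (8 * Q + 20)
    (if m = 9 \<and> 0 < nmat L then Some (stg (rho w p m) (tp (int 0) L) (flg False) (tp (int 0) (ones (nmat L))) (tp (int 0) (ones (nrow L)))
       (tp (int 0) (ones (nrow L))) (outt [])) else None)"
proof (cases "m = 9")
  case False
  have "\<not> reads (scanst w p m L) Mode = 9" using False by (simp add: scanst_def read_tp)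
  then have "run prep_prog (scanst w p m L) (8 * Q + 20) None"
    unfolding prep_prog_def by (intro run_seq_stuck run_guard_stuck)
  then show ?thesis using False by simp
next
  case True
  have le: "nmat L \<le> Q" "nrow L \<le> Q" using nmat_le[of L] nrow_le[of L] L by auto
  let ?n = "nmat L" and ?m = "nrow L" and ?f = "flg (10 \<in> set L)"
  have 1: "run (guard (\<lambda>r. r Mode = 9)) (scanst w p m L) 1 (Some (scanst w p m L))"
    by (rule run_guard) (simp add: scanst_def read_tp True)
  have 2: "run (rewind {Tok} Tok) (scanst w p m L) (2 * length L + 3)
     (Some (stg (rho w p m) (tp (int 0) L) ?f (tp (int ?n) (ones ?n)) (tp (int ?m) (ones ?m)) (tp (int ?m) (ones ?m)) (outt [])))"
    using run_rewind1[of "scanst w p m L" Tok "length L" L] L by (simp add: scanst_def)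
  have 3: "run (rewind {Mats} Mats) (stg (rho w p m) (tp (int 0) L) ?f (tp (int ?n) (ones ?n)) (tp (int ?m) (ones ?m)) (tp (int ?m) (ones ?m)) (outt [])) (2 * ?n + 3)
     (Some (stg (rho w p m) (tp (int 0) L) ?f (tp (int 0) (ones ?n)) (tp (int ?m) (ones ?m)) (tp (int ?m) (ones ?m)) (outt [])))"
    using run_rewind1[of "stg (rho w p m) (tp (int 0) L) ?f (tp (int ?n) (ones ?n)) (tp (int ?m) (ones ?m)) (tp (int ?m) (ones ?m)) (outt [])" Mats ?n "ones ?n"] by simp
  let ?\<sigma> = "stg (rho w p m) (tp (int 0) L) ?f (tp (int 0) (ones ?n)) (tp (int 0) (ones ?m)) (tp (int 0) (ones ?m)) (outt [])"
  let ?g = "\<lambda>r. if r Mats = 1 then Some ((keep r)(Flag := (0, Stay))) else None"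
  have 4: "run (Act ?g) ?\<sigma> 1 (if 0 < ?n then Some (?\<sigma>(Flag := flg False)) else None)"
  proof (cases "0 < ?n")
    case True
    have "act_tape (0, Stay) ?f = flg False" by (auto simp: flg_def tp_def fun_eq_iff)
    then have "perform ((keep (reads ?\<sigma>))(Flag := (0, Stay))) ?\<sigma> = ?\<sigma>(Flag := flg False)"
      unfolding perform_upd perform_keep stg_sel by simp
    then have "run (Act ?g) ?\<sigma> 1 (Some (?\<sigma>(Flag := flg False)))"
      by (rule run_act[rotated]) (use True in \<open>simp add: read_tp\<close>)
    then show ?thesis using True by simp
  next
    case False
    have "run (Act ?g) ?\<sigma> 1 None" by (rule run_act_stuck) (use False in \<open>simp add: read_tp\<close>)
    then show ?thesis using False by simp
  qed
  have "run prep_prog (scanst w p m L) (1 + (2 * length L + 3 + (2 * ?n + 3 + (2 * ?m + 3 + (2 * ?m + 3 + 1)))))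
    (if 0 < ?n then Some (?\<sigma>(Flag := flg False)) else None)"
    unfolding prep_prog_def
    by (rule run_seq[OF 1 run_seq[OF 2 run_seq[OF 3 run_seq[OF run_rewind_Rows run_seq[OF run_rewind_Cols 4]]]]]) auto
  then have "run prep_prog (scanst w p m L) (8 * Q + 20) (if 0 < ?n then Some (?\<sigma>(Flag := flg False)) else None)"
    by (rule run_mono) (use le L in linarith)
  then show ?thesis using True by (cases "0 < ?n") simp_all
qed

text \<open>Cubic, since every input symbol is charged with at most \<open>513 * Q * Q\<close>
  steps. Rewinding \<open>Out\<close> costs about twice the time spent before, whence the factor
  \<open>3\<close> at \<open>kappa\<close>.\<close>

definition time_poly :: "nat poly" where
  "time_poly = [:3 * kappa + 1000, 100, 2000, 2000:]"

lemma zero_notin_all_syms: "0 \<notin> set (all_syms xs)"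
proof -
  have "0 \<notin> set (rat_syms x)" for x by (auto simp: rat_syms_def bsym_def split: if_splits)
  then show ?thesis by (auto simp: all_syms_def mat_syms_def row_syms_def)
qed

lemma length_codes: "length (concat (map code L)) = 2 * length L"
  by (induction L) (auto simp: code_def)

lemma run_reduce_prog_parsed:
  assumes w: "w = concat (map code (all_syms xs))" and xs: "xs \<noteq> []"
  shows "if \<forall>x\<in>set xs. square (length (hd xs)) x
    then \<exists>\<sigma>. run reduce_prog (init_store w) (poly time_poly (length w)) (Some \<sigma>) \<and>
      \<sigma> Out = input_tape (reduction (length xs) (length (hd xs)) xs)
    else run reduce_prog (init_store w) (poly time_poly (length w)) None"
proof -
  define L where "L = all_syms xs"
  define Q where "Q = length w"
  define n where "n = length xs"
  define m where "m = length (hd xs)"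
  have n: "nmat L = n" and m: "nrow L = m" using nmat_all nrow_all xs by (auto simp: L_def n_def m_def)
  have LQ: "2 * length L = Q" using length_codes w by (simp add: Q_def L_def)
  have Q: "n \<le> Q" "m \<le> Q" "length L \<le> Q" using nmat_le[of L] nrow_le[of L] n m LQ by auto
  have n1: "0 < n" "1 \<le> Q" using xs Q n_def by (cases xs; auto)+
  have L0: "0 \<notin> set L" unfolding L_def by (rule zero_notin_all_syms)
  have s: "scan 0 w = Some (9, L)" unfolding w L_def by (rule scan_complete)
  have 1: "run scan_prog (init_store w) (2 * Q + 1) (Some (scanst w (length w) 9 L))"
    using run_scan_prog[of w "[]" w 0 "[]"] s by (simp add: init_store_scanst Q_def)
  let ?\<rho> = "rho w (length w) 9"
  let ?S = "\<lambda>p i v. stg ?\<rho> (tp (int p) L) (flg (0 < i)) (tp (int i) (ones n)) (tp (int 0) (ones m)) (tp (int 0) (ones m)) (outt v)"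
  let ?h = "header_out n m"
  have 2: "run prep_prog (scanst w (length w) 9 L) (8 * Q + 20) (Some (?S 0 0 []))"
    using run_prep[OF L0 Q(3), of w "length w" 9] n m n1 by simp
  have 3: "run header_prog (?S 0 0 []) (360 * Q * Q + kappa + 40) (Some (?S 0 0 ?h))"
    using emits_stg[OF emits_header[OF refl Q(1,2) n1(2)], of ?\<rho> "tp (int 0) L" "flg False" "[]"] by simp
  have 4: "run (mv {Tok} Right) (?S 0 0 ?h) 1 (Some (?S (Suc 0) 0 ?h))"
    by (rule run_mv_Tok)
  let ?c = "concat (map mat_syms xs)" and ?mats = "While (\<lambda>r. r Tok = 9) mat_prog"
  let ?v = "?h @ mats_out n m 0 xs"
  let ?tm = "length (?c) * (513 * Q * Q) + 1"
  have Ls: "L = [11] @ ?c @ 12 # []" by (simp add: L_def all_syms_def)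
  have 5: "run ?mats (?S (length [11::nat]) 0 ?h) ?tm
    (if \<forall>x\<in>set xs. square m x then Some (?S (length [11::nat] + length ?c) (0 + length xs) ?v) else None)"
    by (rule run_mats[OF Q _ Ls]) (use n1 n_def in auto)
  define S where "S = Q * Q"
  define U where "U = Q * (Q * Q)"
  have "length ?c * (513 * Q * Q) \<le> Q * (513 * Q * Q)"
    by (rule mult_le_mono1) (use LQ Ls in simp)
  then have c: "length ?c * (513 * Q * Q) \<le> 513 * U" by (simp add: U_def algebra_simps)
  have p: "poly time_poly (length w) = 3 * kappa + 1000 + 100 * Q + 2000 * S + 2000 * U" "360 * Q * Q = 360 * S"
    by (simp_all add: time_poly_def Q_def[symmetric] S_def U_def algebra_simps)
  show ?thesis
  proof (cases "\<forall>x\<in>set xs. square m x")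
    case False
    from 5[unfolded if_not_P[OF False]] have 5: "run ?mats (?S (Suc 0) 0 ?h) ?tm None" by simp
    have "run reduce_prog (init_store w) (2 * Q + 1 + (8 * Q + 20 + (360 * Q * Q + kappa + 40 + (1 + ?tm)))) None"
      unfolding reduce_prog_def
      by (rule run_seq[OF 1 run_seq[OF 2 run_seq[OF 3 run_seq[OF 4 run_seq_stuck[OF 5]]]]])
    then have "run reduce_prog (init_store w) (poly time_poly (length w)) None"
      by (rule run_mono) (use c in \<open>unfold p, linarith\<close>)
    then show ?thesis using False unfolding m_def by (simp only: if_False)
  next
    case True
    from 5[unfolded if_P[OF True]] have 5: "run ?mats (?S (Suc 0) 0 ?h) ?tm (Some (?S (Suc 0 + length ?c) n ?v))"
      by (simp add: n_def)
    let ?o = "?v @ [True, True, True, True]"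
    let ?\<sigma> = "?S (Suc 0 + length ?c) n ?o"
    have 6: "run (emit [True, True, True, True]) (?S (Suc 0 + length ?c) n ?v) 5 (Some ?\<sigma>)"
      by (rule run_mono[OF emits_stg[OF emits_emit]]) simp
    let ?t0 = "2 * Q + 1 + (8 * Q + 20 + (360 * Q * Q + kappa + 40 + (1 + (?tm + 5))))"
    have pre: "run (scan_prog ;; prep_prog ;; header_prog ;; mv {Tok} Right ;; ?mats ;; emit [True, True, True, True])
      (init_store w) ?t0 (Some ?\<sigma>)"
      by (rule run_seq[OF 1 run_seq[OF 2 run_seq[OF 3 run_seq[OF 4 run_seq[OF 5 6]]]]])
    have lo: "length ?o \<le> ?t0" by (rule length_out_le[OF pre]) simp
    have 7: "run (rewind {Out} Out) ?\<sigma> (2 * length ?o + 3) (Some (?\<sigma>(Out := tp 0 (map bsym ?o))))"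
      by (rule run_rewind1) (auto simp: outt_def bsym_def)
    have "run reduce_prog (init_store w)
      (2 * Q + 1 + (8 * Q + 20 + (360 * Q * Q + kappa + 40 + (1 + (?tm + (5 + (2 * length ?o + 3)))))))
      (Some (?\<sigma>(Out := tp 0 (map bsym ?o))))"
      unfolding reduce_prog_def
      by (rule run_seq[OF 1 run_seq[OF 2 run_seq[OF 3 run_seq[OF 4 run_seq[OF 5 run_seq[OF 6 7]]]]]])
    then have "run reduce_prog (init_store w) (poly time_poly (length w)) (Some (?\<sigma>(Out := tp 0 (map bsym ?o))))"
      by (rule run_mono) (use lo c in \<open>unfold p, linarith\<close>)
    moreover have "(?\<sigma>(Out := tp 0 (map bsym ?o))) Out = input_tape (reduction (length xs) (length (hd xs)) xs)"
      by (simp add: input_tape_tp reduction_def n_def m_def)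
    ultimately show ?thesis using True unfolding m_def[symmetric] if_P[OF True] by blast
  qed
qed

lemma run_reduce_prog:
  assumes "w = concat (map code (all_syms xs))" "xs \<noteq> []" "\<forall>x\<in>set xs. square (length (hd xs)) x"
  shows "\<exists>\<sigma>. run reduce_prog (init_store w) (poly time_poly (length w)) (Some \<sigma>) \<and>
    \<sigma> Out = input_tape (reduction (length xs) (length (hd xs)) xs)"
  using run_reduce_prog_parsed[OF assms(1,2)] unfolding if_P[OF assms(3)] .

lemma run_reduce_prog_stuck:
  assumes "\<And>xs. w = concat (map code (all_syms xs)) \<Longrightarrow> xs \<noteq> [] \<Longrightarrow> \<not> (\<forall>x\<in>set xs. square (length (hd xs)) x)"
  shows "run reduce_prog (init_store w) (poly time_poly (length w)) None"
proof -
  define Q where "Q = length w"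
  have p: "poly time_poly (length w) = 3 * kappa + 1000 + 100 * Q + 2000 * (Q * Q) + 2000 * (Q * (Q * Q))"
    by (simp add: time_poly_def Q_def[symmetric] algebra_simps)
  have scan: "run scan_prog (init_store w) (2 * Q + 1)
      (case scan 0 w of None \<Rightarrow> None | Some (m', L') \<Rightarrow> Some (scanst w (length w) m' L'))"
    using run_scan_prog[of w "[]" w 0 "[]"] unfolding append_Nil list.size init_store_scanst Q_def by simp
  show ?thesis
  proof (cases "scan 0 w")
    case None
    with scan have "run scan_prog (init_store w) (2 * Q + 1) None" by simp
    then have "run reduce_prog (init_store w) (2 * Q + 1) None"
      unfolding reduce_prog_def by (rule run_seq_stuck)
    then show ?thesis by (rule run_mono) (simp add: p)
  next
    case (Some y)
    then obtain m' L where s: "scan 0 w = Some (m', L)" by (cases y) auto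
    with scan have 1: "run scan_prog (init_store w) (2 * Q + 1) (Some (scanst w (length w) m' L))" by simp
    have wL: "w = concat (map code L)" using scan_code[OF s] ..
    show ?thesis
    proof (cases "m' = 9 \<and> L \<noteq> all_syms []")
      case True
      then obtain xs where L: "L = all_syms xs" using scan_sound s by blast
      with True have xs: "xs \<noteq> []" by auto
      have w: "w = concat (map code (all_syms xs))" using wL L by simp
      from run_reduce_prog_parsed[OF w xs] show ?thesis unfolding if_not_P[OF assms[OF w xs]] .
    next
      case False
      have L: "length L \<le> Q" "0 \<notin> set L" if "L = all_syms []"
        using length_codes[of L] wL zero_notin_all_syms that by (auto simp: Q_def)
      have "run prep_prog (scanst w (length w) m' L) (8 * Q + 20) None"
      proof (cases "m' = 9")
        case True
        \<comment> \<open>The empty list has the right bracket structure but no \<open>A_0\<close>;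
          with \<open>Mats\<close> blank the program gets stuck.\<close>
        with False have "L = all_syms []" by simp
        then show ?thesis using run_prep[OF L(2,1), of w "length w" m'] nmat_all[of "[]"] by simp
      next
        case False
        then show ?thesis unfolding prep_prog_def
          by (intro run_seq_stuck run_guard_stuck) (simp add: scanst_def read_tp)
      qed
      then have "run reduce_prog (init_store w) (2 * Q + 1 + (8 * Q + 20)) None"
        unfolding reduce_prog_def by (rule run_seq[OF 1 run_seq_stuck])
      then show ?thesis by (rule run_mono) (simp add: p)
    qed
  qed
qed

lemma bounded_emit: "bounded_com 13 (emit bs)"
  by (induction bs) (auto simp: skip_def put_def keep_def bsym_def)

lemma bounded_reduce_prog: "bounded_com 13 reduce_prog"
proof -
  have "fst (if s = 9 then (1, Right) else (r, Stay)) < 13" if "r < 13" for s r :: nat using that by simp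
  have rd: "bounded_com 13 read2"
    unfolding read2_def bounded_com.simps
  proof (intro allI impI)
    fix r :: "tname \<Rightarrow> nat" and a :: action and k
    assume r: "\<forall>k. r k < 13" and g: "(if r Inp = 0 then None else case delta (r Mode) (r Tok = 2) (r Inp = 2) of None \<Rightarrow> None
     | Some (m, s) \<Rightarrow> Some ((keep r)(Inp := (r Inp, Right), Tok := (s, Right), Mode := (m, Stay),
         Mats := if s = 9 then (1, Right) else (r Mats, Stay),
         Rows := if s = 8 \<and> r Flag = 0 then (1, Right) else (r Rows, Stay),
         Cols := if s = 8 \<and> r Flag = 0 then (1, Right) else (r Cols, Stay),
         Flag := if s = 10 then (1, Stay) else (r Flag, Stay)))) = Some a"
    then obtain m s where d: "delta (r Mode) (r Tok = 2) (r Inp = 2) = Some (m, s)" by (auto split: if_splits option.splits)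
    have "s < 13" "m < 13" using delta_code[OF d] by auto
    with g d r show "fst (a k) < 13" by (cases k) (auto simp: keep_def split: if_splits)
  qed
  have others: "bounded_com 13 (mv K d)" "bounded_com 13 (rewind K k)" "bounded_com 13 (guard b)" "bounded_com 13 read1" "bounded_com 13 mark"
    "bounded_com 13 unmark" "bounded_com 13 (put f)" "bounded_com 13 skip" for K d k b f
    by (auto simp: mv_def rewind_def guard_def read1_def mark_def unmark_def put_def skip_def keep_def bsym_def split: if_splits)
  show ?thesis
    unfolding reduce_prog_def scan_prog_def prep_prog_def header_prog_def mat_prog_def row_prog_def entry_def term_prog_def vec_prog_def
      sweep_def foreach_def copy_rat_def emit_code_def emit_exp_def
    by (auto simp: others rd bounded_emit keep_def split: if_splits)
qed

section \<open>Unique readability\<close>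

text \<open>The second clause says that no code word starts like the closing bracket. It makes the
  end of a bracketed list recognizable, so that the property passes from the items to lists of
  them.\<close>

definition selfdelim :: "('a \<Rightarrow> bool list) \<Rightarrow> bool" where
  "selfdelim e \<longleftrightarrow> (\<forall>x y a b. e x @ a = e y @ b \<longrightarrow> x = y \<and> a = b) \<and> (\<forall>x a b. e x @ a \<noteq> [True, True] @ b)"

lemma selfdelimD: "selfdelim e \<Longrightarrow> e x @ a = e y @ b \<Longrightarrow> x = y \<and> a = b"
  unfolding selfdelim_def by blast

lemma selfdelim_close: "selfdelim e \<Longrightarrow> e x @ a \<noteq> [True, True] @ b"
  unfolding selfdelim_def by blast

lemma selfdelim_inj: "selfdelim e \<Longrightarrow> e x = e y \<Longrightarrow> x = y"
  using selfdelimD[of e x "[]" y "[]"] by simp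

lemma selfdelim_bit: "selfdelim enc_bit"
  by (auto simp: selfdelim_def enc_bit_def)

lemma concat_selfdelim:
  assumes e: "selfdelim e"
  shows "concat (map e xs) @ [True, True] @ a = concat (map e ys) @ [True, True] @ b \<Longrightarrow> xs = ys \<and> a = b"
proof (induction xs arbitrary: ys)
  case Nil
  then show ?case
  proof (cases ys)
    case (Cons y ys')
    then show ?thesis
      using Nil selfdelim_close[OF e, of y "concat (map e ys') @ [True, True] @ b" a] by simp
  qed simp
next
  case (Cons x xs)
  show ?case
  proof (cases ys)
    case Nil
    then show ?thesis
      using Cons.prems selfdelim_close[OF e, of x "concat (map e xs) @ [True, True] @ a" b] by simp
  next
    case ys: (Cons y ys')
    then have "e x @ (concat (map e xs) @ [True, True] @ a) = e y @ (concat (map e ys') @ [True, True] @ b)"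
      using Cons.prems by simp
    from selfdelimD[OF e this] Cons.IH[of ys'] ys show ?thesis by simp
  qed
qed

lemma selfdelim_list:
  assumes "selfdelim e"
  shows "selfdelim (enc_list e)"
  unfolding selfdelim_def
proof (rule conjI; intro allI impI)
  fix xs ys a b
  assume "enc_list e xs @ a = enc_list e ys @ b"
  then have "concat (map e xs) @ [True, True] @ a = concat (map e ys) @ [True, True] @ b"
    by (simp add: enc_list_def bracket_def)
  from concat_selfdelim[OF assms this] show "xs = ys \<and> a = b" .
next
  show "enc_list e xs @ a \<noteq> [True, True] @ b" for xs a b
    by (simp add: enc_list_def bracket_def)
qed

lemma selfdelim_pair:
  assumes "selfdelim e" "selfdelim f"
  shows "selfdelim (\<lambda>(x, y). bracket (e x @ f y))"
  unfolding selfdelim_def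
proof (intro conjI allI impI)
  fix p q a b
  assume "(case p of (x, y) \<Rightarrow> bracket (e x @ f y)) @ a = (case q of (x, y) \<Rightarrow> bracket (e x @ f y)) @ b"
  then have "e (fst p) @ (f (snd p) @ [True, True] @ a) = e (fst q) @ (f (snd q) @ [True, True] @ b)"
    by (simp add: bracket_def split: prod.splits)
  from selfdelimD[OF assms(1) this] have 1: "fst p = fst q" and 2: "f (snd p) @ [True, True] @ a = f (snd q) @ [True, True] @ b"
    by blast+
  from selfdelimD[OF assms(2) 2] have "snd p = snd q" "a = b" by simp_all
  with 1 show "p = q" "a = b" by (simp_all add: prod_eq_iff)
qed (auto simp: bracket_def)

lemma selfdelim_comp:
  assumes e: "selfdelim e" and f: "inj f"
  shows "selfdelim (\<lambda>x. e (f x))"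
  unfolding selfdelim_def
proof (rule conjI; intro allI impI)
  fix x y a b
  assume "e (f x) @ a = e (f y) @ b"
  from selfdelimD[OF e this] have "f x = f y" "a = b" by simp_all
  with f show "x = y \<and> a = b" by (simp add: inj_eq)
next
  show "e (f x) @ a \<noteq> [True, True] @ b" for x a b by (rule selfdelim_close[OF e])
qed

lemma binary_rec: "binary 0 = []" "0 < n \<Longrightarrow> binary n = binary (n div 2) @ [odd n]"
  by (subst binary.simps, simp) (subst binary.simps, simp)

lemma binary_inj: "binary n = binary k \<Longrightarrow> n = k"
proof (induction n arbitrary: k rule: less_induct)
  case (less n)
  show ?case
  proof (cases "n = 0 \<or> k = 0")
    case True
    then show ?thesis using less.prems binary_rec(2)[of n] binary_rec(2)[of k] by (cases "n = 0"; cases "k = 0") (auto simp: binary_rec(1))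
  next
    case False
    then have "binary (n div 2) @ [odd n] = binary (k div 2) @ [odd k]"
      using less.prems binary_rec(2)[of n] binary_rec(2)[of k] by simp
    then have 1: "binary (n div 2) = binary (k div 2)" and 2: "odd n = odd k" by simp_all
    have "n div 2 < n" using False by simp
    from less.IH[OF this 1] 2 show ?thesis by presburger
  qed
qed

lemma selfdelim_nat: "selfdelim enc_nat"
proof -
  have "inj binary" by (rule injI) (rule binary_inj)
  from selfdelim_comp[OF selfdelim_list[OF selfdelim_bit] this] show ?thesis
    by (simp add: enc_nat_def[abs_def])
qed

definition enc_raw :: "raw \<Rightarrow> bool list" where
  "enc_raw = (\<lambda>(p, q). bracket (enc_list enc_bit p @ enc_list enc_bit q))"

lemma selfdelim_raw: "selfdelim enc_raw"
  unfolding enc_raw_def by (intro selfdelim_pair selfdelim_list selfdelim_bit)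

text \<open>The canonical digits of a rational. A pair outside the range of this function is a
  number in a non-canonical form, such as a fraction that is not reduced.\<close>

definition raw_of :: "rat \<Rightarrow> raw" where
  "raw_of r = (case quotient_of r of (p, q) \<Rightarrow> ((p < 0) # binary (nat \<bar>p\<bar>), binary (nat q)))"

lemma enc_rat_raw: "enc_rat r = enc_raw (raw_of r)"
  by (simp add: enc_rat_def enc_raw_def raw_of_def enc_int_def enc_nat_def split: prod.splits)

lemma raw_of_inj: "inj raw_of"
proof (rule injI)
  fix r s
  assume eq: "raw_of r = raw_of s"
  obtain p q where r: "quotient_of r = (p, q)" by fastforce
  obtain p' q' where s: "quotient_of s = (p', q')" by fastforce
  have pos: "q > 0" "q' > 0" using quotient_of_denom_pos r s by auto
  from eq have "(p < 0) = (p' < 0)" "nat \<bar>p\<bar> = nat \<bar>p'\<bar>" "nat q = nat q'"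
    by (auto simp: raw_of_def r s intro: binary_inj)
  with pos have "p = p'" "q = q'" by auto
  with r s show "r = s" by (metis quotient_of_inject)
qed

lemma code_bits: "concat (map code (map bsym p)) = concat (map enc_bit p)"
  by (induction p) (auto simp: code_def enc_bit_def bsym_def)

lemma code_simps: "code 3 = [True, False]" "code 4 = [True, True]" "code 5 = [True, False]" "code 6 = [True, True]"
  "code 7 = [True, False]" "code 8 = [True, True]" "code 9 = [True, False]" "code 10 = [True, True]"
  "code 11 = [True, False]" "code 12 = [True, True]"
  by (auto simp: code_def)

lemma raw_enc: "raw_enc x = enc_raw x"
  by (simp add: raw_enc_def enc_raw_def rat_syms_def code_simps code_bits[unfolded map_map] enc_list_def bracket_def
      split: prod.splits)

lemma code_all: "concat (map code (all_syms xs)) = enc_list (enc_list (enc_list enc_raw)) xs"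
proof -
  have 0: "concat (map code (concat (map f xs))) = concat (map (\<lambda>x. concat (map code (f x))) xs)"
    for f :: "'b \<Rightarrow> nat list" and xs
    by (induction xs) auto
  have 1: "concat (map code (row_syms x)) = enc_list enc_raw x" for x
    by (simp add: row_syms_def enc_list_def bracket_def code_simps 0 raw_enc[unfolded raw_enc_def])
  have 2: "concat (map code (mat_syms x)) = enc_list (enc_list enc_raw) x" for x
    by (simp add: mat_syms_def enc_list_def[of "enc_list enc_raw"] bracket_def code_simps 0 1)
  show ?thesis
    by (simp add: all_syms_def enc_list_def[of "enc_list (enc_list enc_raw)"] bracket_def code_simps 0 2)
qed

section \<open>The output as the encoding of a list of terms\<close>

definition enc_rterm :: "raw \<times> nat list \<Rightarrow> bool list" where
  "enc_rterm = (\<lambda>(x, es). bracket (enc_raw x @ enc_list enc_nat es))"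

lemma selfdelim_rterm: "selfdelim enc_rterm"
  unfolding enc_rterm_def by (intro selfdelim_pair selfdelim_list selfdelim_raw selfdelim_nat)

lemma enc_term_rterm: "enc_term t = enc_rterm (map_prod raw_of id t)"
  by (cases t) (simp add: enc_term_def enc_rterm_def enc_rat_raw)

lemma raw_term_rterm: "raw_term (raw_enc x) es = enc_rterm (x, es)"
  by (simp add: raw_term_def enc_rterm_def raw_enc)

text \<open>The coefficients have an arbitrary type, because the same list is needed with raw
  digits, as the program copies them, and with rationals, as the polynomial requires.\<close>

definition entry_terms :: "nat \<Rightarrow> nat \<Rightarrow> nat \<Rightarrow> nat \<Rightarrow> nat \<Rightarrow> 'a \<Rightarrow> ('a \<times> nat list) list" where
  "entry_terms n m i r s x = [(x, exps1 n m i r s), (x, exps2 n m i r s), (x, exps3 n m i r s)]"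

definition row_terms :: "nat \<Rightarrow> nat \<Rightarrow> nat \<Rightarrow> nat \<Rightarrow> nat \<Rightarrow> 'a list \<Rightarrow> ('a \<times> nat list) list" where
  "row_terms n m i r s xs = concat (map (\<lambda>(s, x). entry_terms n m i r s x) (List.enumerate s xs))"

definition mat_terms :: "nat \<Rightarrow> nat \<Rightarrow> nat \<Rightarrow> nat \<Rightarrow> 'a list list \<Rightarrow> ('a \<times> nat list) list" where
  "mat_terms n m i r xs = concat (map (\<lambda>(r, x). row_terms n m i r 0 x) (List.enumerate r xs))"

definition all_terms :: "nat \<Rightarrow> nat \<Rightarrow> nat \<Rightarrow> 'a list list list \<Rightarrow> ('a \<times> nat list) list" where
  "all_terms n m i xs = concat (map (\<lambda>(i, x). mat_terms n m i 0 x) (List.enumerate i xs))"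

lemma row_terms_simps:
  "row_terms n m i r s [] = []"
  "row_terms n m i r s (x # xs) = entry_terms n m i r s x @ row_terms n m i r (Suc s) xs"
  by (simp_all add: row_terms_def)

lemma mat_terms_simps:
  "mat_terms n m i r [] = []"
  "mat_terms n m i r (x # xs) = row_terms n m i r 0 x @ mat_terms n m i (Suc r) xs"
  by (simp_all add: mat_terms_def)

lemma all_terms_simps:
  "all_terms n m i [] = []"
  "all_terms n m i (x # xs) = mat_terms n m i 0 x @ all_terms n m (Suc i) xs"
  by (simp_all add: all_terms_def)

lemma out_simps:
  "row_out n m i r s [] = []"
  "row_out n m i r s (x # xs) = entry_out n m i r s x @ row_out n m i r (Suc s) xs"
  "mat_out n m i r [] = []"
  "mat_out n m i r (y # ys) = row_out n m i r 0 y @ mat_out n m i (Suc r) ys"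
  "mats_out n m i [] = []"
  "mats_out n m i (z # zs) = mat_out n m i 0 z @ mats_out n m (Suc i) zs"
  by (simp_all add: row_out_def mat_out_def mats_out_def)

lemma entry_out_terms: "entry_out n m i r s x = concat (map enc_rterm (entry_terms n m i r s x))"
  by (simp add: entry_out_def entry_terms_def raw_term_rterm)

lemma row_out_terms: "row_out n m i r s xs = concat (map enc_rterm (row_terms n m i r s xs))"
  by (induction xs arbitrary: s) (simp_all add: out_simps row_terms_simps entry_out_terms)

lemma mat_out_terms: "mat_out n m i r xs = concat (map enc_rterm (mat_terms n m i r xs))"
  by (induction xs arbitrary: r) (simp_all add: out_simps mat_terms_simps row_out_terms)

lemma mats_out_terms: "mats_out n m i xs = concat (map enc_rterm (all_terms n m i xs))"
  by (induction xs arbitrary: i) (simp_all add: out_simps all_terms_simps mat_out_terms)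

lemma entry_terms_map: "map (map_prod f id) (entry_terms n m i r s x) = entry_terms n m i r s (f x)"
  by (simp add: entry_terms_def)

lemma row_terms_map: "map (map_prod f id) (row_terms n m i r s xs) = row_terms n m i r s (map f xs)"
  by (induction xs arbitrary: s) (simp_all add: row_terms_simps entry_terms_map)

lemma mat_terms_map: "map (map_prod f id) (mat_terms n m i r xs) = mat_terms n m i r (map (map f) xs)"
  by (induction xs arbitrary: r) (simp_all add: mat_terms_simps row_terms_map)

lemma all_terms_map: "map (map_prod f id) (all_terms n m i xs) = all_terms n m i (map (map (map f)) xs)"
  by (induction xs arbitrary: i) (simp_all add: all_terms_simps mat_terms_map)

definition poly_terms :: "nat \<Rightarrow> nat \<Rightarrow> rat list list list \<Rightarrow> poly_term list" where
  "poly_terms n m xs = (1, const_exps n m 2) # (2, const_exps n m 1) # all_terms n m 0 xs"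

lemma reduction_eq: "reduction n m xs = bracket (enc_list enc_bit (replicate (num_vars n m) True) @
    enc_list enc_rterm ((raw_of 1, const_exps n m 2) # (raw_of 2, const_exps n m 1) # all_terms n m 0 xs))"
proof -
  have "raw_term (enc_rat c) es = enc_rterm (raw_of c, es)" for c es
    by (simp add: raw_term_def enc_rterm_def enc_rat_raw)
  then show ?thesis
    by (simp add: reduction_def header_out_def mats_out_terms enc_list_def[of enc_rterm] bracket_def)
qed

lemma enc_list_map: "enc_list e (map f xs) = enc_list (\<lambda>x. e (f x)) xs"
  by (simp add: enc_list_def o_def)

lemma enc_poly_raw: "enc_poly N ps = bracket (enc_list enc_bit (replicate N True) @ enc_list enc_rterm (map (map_prod raw_of id) ps))"
proof -
  have "enc_term = (\<lambda>t. enc_rterm (map_prod raw_of id t))" by (rule ext) (rule enc_term_rterm)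
  then show ?thesis by (simp add: enc_poly_def enc_list_map)
qed

lemma reduction_poly: "reduction n m (map (map (map raw_of)) xs) = enc_poly (num_vars n m) (poly_terms n m xs)"
  by (simp add: reduction_eq enc_poly_raw poly_terms_def all_terms_map)

lemma in_concat_map: "y \<in> set xs \<Longrightarrow> z \<in> set (f y) \<Longrightarrow> z \<in> set (concat (map f xs))"
  by auto

text \<open>Every entry of the input occurs as the coefficient of some term. If the output is the
  encoding of a polynomial at all, unique readability forces each raw number into the range of
  \<open>raw_of\<close>. This is why the program need not inspect digits.\<close>

lemma reduction_is_poly:
  assumes "reduction n m xs = enc_poly N ps"
  shows "\<exists>ys. xs = map (map (map raw_of)) ys \<and> N = num_vars n m \<and> ps = poly_terms n m ys"
proof -
  let ?ts = "(raw_of 1, const_exps n m 2) # (raw_of 2, const_exps n m 1) # all_terms n m 0 xs"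
  have "selfdelim (\<lambda>(x, y). bracket (enc_list enc_bit x @ enc_list enc_rterm y))"
    by (intro selfdelim_pair selfdelim_list selfdelim_bit selfdelim_rterm)
  note inj = selfdelim_inj[OF this, of "(replicate (num_vars n m) True, ?ts)" "(replicate N True, map (map_prod raw_of id) ps)", unfolded prod.case]
  have "(replicate (num_vars n m) True, ?ts) = (replicate N True, map (map_prod raw_of id) ps)"
    by (rule inj) (use assms in \<open>unfold reduction_eq enc_poly_raw\<close>)
  then have rep: "replicate (num_vars n m) True = replicate N True" and ts: "?ts = map (map_prod raw_of id) ps"
    by blast+
  have N: "N = num_vars n m" using arg_cong[OF rep, of length] by simp
  have range: "x \<in> range raw_of" if mem: "y \<in> set xs" "z \<in> set y" "x \<in> set z" for x y z
  proof -
    obtain i where i: "i < length xs" "xs ! i = y" using mem(1) unfolding in_set_conv_nth by blast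
    obtain r where r: "r < length y" "y ! r = z" using mem(2) unfolding in_set_conv_nth by blast
    obtain s where s: "s < length z" "z ! s = x" using mem(3) unfolding in_set_conv_nth by blast
    have e: "(i, y) \<in> set (List.enumerate 0 xs)" "(r, z) \<in> set (List.enumerate 0 y)" "(s, x) \<in> set (List.enumerate 0 z)"
      unfolding in_set_enumerate_eq using i r s by simp_all
    have "(x, exps1 n m i r s) \<in> set (entry_terms n m i r s x)" by (simp add: entry_terms_def)
    then have "(x, exps1 n m i r s) \<in> set (row_terms n m i r 0 z)"
      unfolding row_terms_def by (intro in_concat_map[OF e(3)]) simp
    then have "(x, exps1 n m i r s) \<in> set (mat_terms n m i 0 y)"
      unfolding mat_terms_def by (intro in_concat_map[OF e(2)]) simp
    then have "(x, exps1 n m i r s) \<in> set (all_terms n m 0 xs)"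
      unfolding all_terms_def by (intro in_concat_map[OF e(1)]) simp
    then have "(x, exps1 n m i r s) \<in> set (map (map_prod raw_of id) ps)" unfolding ts[symmetric] by simp
    then obtain t where "(x, exps1 n m i r s) = map_prod raw_of id t" unfolding set_map by (elim imageE)
    then have "x = raw_of (fst t)" by (cases t) simp
    then show ?thesis by simp
  qed
  define ys where "ys = map (map (map (inv_into UNIV raw_of))) xs"
  have 1: "map (map raw_of) (map (map (inv_into UNIV raw_of)) y) = y" if y: "y \<in> set xs" for y
  proof -
    have "map raw_of (map (inv_into UNIV raw_of) z) = z" if z: "z \<in> set y" for z
      unfolding map_map o_def
    proof (rule map_idI)
      fix x assume "x \<in> set z"
      then show "raw_of (inv_into UNIV raw_of x) = x" by (intro f_inv_into_f range[OF y z])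
    qed
    then show ?thesis unfolding map_map[of "map raw_of"] o_def by (rule map_idI)
  qed
  have "map (map (map raw_of)) ys = xs"
    unfolding ys_def map_map[of "map (map raw_of)"] o_def using 1 by (rule map_idI)
  then have xs: "xs = map (map (map raw_of)) ys" by simp
  have "map (map_prod raw_of id) (poly_terms n m ys) = ?ts"
    unfolding poly_terms_def list.map all_terms_map xs[symmetric] by simp
  then have "map (map_prod raw_of id) (poly_terms n m ys) = map (map_prod raw_of id) ps" using ts by simp
  moreover have "inj (map (map_prod raw_of (id :: nat list \<Rightarrow> nat list)))"
    using raw_of_inj by (intro inj_mapI prod.inj_map) auto
  ultimately have "poly_terms n m ys = ps" by (rule injD[rotated])
  then show ?thesis using xs N by (intro exI[of _ ys]) simp
qed

lemma enc_mat_raw: "enc_mat A = enc_list (enc_list enc_raw) (map (map raw_of) (mat_to_list A))"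
proof -
  have "enc_rat = (\<lambda>r. enc_raw (raw_of r))" by (rule ext) (rule enc_rat_raw)
  then show ?thesis by (simp add: enc_mat_def enc_list_map)
qed

lemma enc_sdp: "enc_list enc_mat As = concat (map code (all_syms (map (\<lambda>A. map (map raw_of) (mat_to_list A)) As)))"
proof -
  have "enc_mat = (\<lambda>A. enc_list (enc_list enc_raw) (map (map raw_of) (mat_to_list A)))"
    by (rule ext) (rule enc_mat_raw)
  then show ?thesis unfolding code_all enc_list_map by simp
qed

lemma code_all_inj: "concat (map code (all_syms xs)) = concat (map code (all_syms ys)) \<Longrightarrow> xs = ys"
  unfolding code_all
  by (rule selfdelim_inj[OF selfdelim_list[OF selfdelim_list[OF selfdelim_list[OF selfdelim_raw]]]])

section \<open>Second-order points of the polynomial\<close>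

text \<open>The index \<open>N\<close> stands for the constant \<open>1\<close>, so that all monomials are products of three coordinates.\<close>

definition cv :: "nat \<Rightarrow> real vec \<Rightarrow> nat \<Rightarrow> real" where
  "cv N x k = (if k < N then x $ k else 1)"

text \<open>Directions are extended by \<open>0\<close>, not by \<open>1\<close>, since the constant
  coordinate does not vary.\<close>

definition dv :: "nat \<Rightarrow> real vec \<Rightarrow> nat \<Rightarrow> real" where
  "dv N u k = (if k < N then u $ k else 0)"

type_synonym quad = "rat \<times> nat \<times> nat \<times> nat"

definition trilin :: "nat \<Rightarrow> quad list \<Rightarrow> real vec \<Rightarrow> real" where
  "trilin N qs x = (\<Sum>(c, i, j, k) \<leftarrow> qs. of_rat c * (cv N x i * cv N x j * cv N x k))"

definition exps_of :: "nat \<Rightarrow> nat \<Rightarrow> nat \<Rightarrow> nat \<Rightarrow> nat list" where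
  "exps_of N i j k = map (\<lambda>l. of_bool (l = i) + of_bool (l = j) + of_bool (l = k)) [0..<N]"

definition quad_term :: "nat \<Rightarrow> quad \<Rightarrow> poly_term" where
  "quad_term N = (\<lambda>(c, i, j, k). (c, exps_of N i j k))"

lemma prod_power_of_bool: fixes i N :: nat shows "(\<Prod>l<N. f l ^ of_bool (l = i)) = (if i < N then f i else (1::real))"
proof -
  have "(\<Prod>l<N. f l ^ of_bool (l = i)) = (\<Prod>l<N. if l = i then f l else 1)"
    by (intro prod.cong) auto
  then show ?thesis by (simp add: prod.delta)
qed

lemma eval_quad_terms: "eval_terms N (map (quad_term N) qs) x = trilin N qs x"
proof -
  have "(\<Prod>l<N. x $ l ^ (exps_of N i j k ! l)) = cv N x i * cv N x j * cv N x k" for i j k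
  proof -
    have "(\<Prod>l<N. x $ l ^ (exps_of N i j k ! l)) =
        (\<Prod>l<N. x $ l ^ of_bool (l = i) * x $ l ^ of_bool (l = j) * x $ l ^ of_bool (l = k))"
      by (intro prod.cong) (auto simp: exps_of_def power_add simp del: of_bool_eq_iff)
    then show ?thesis
      by (simp only: prod.distrib prod_power_of_bool cv_def)
  qed
  then show ?thesis
    by (simp add: eval_terms_def trilin_def quad_term_def split_def o_def)
qed

lemma sum_list_of_bool_le: "sum_list (map (\<lambda>l. of_bool (l = i)) [0..<N]) \<le> (1::nat)"
  by (induction N) auto

lemma cubic_quad_terms: "cubic_terms N (map (quad_term N) qs)"
proof -
  have "sum_list (exps_of N i j k) \<le> 3" for i j k
  proof -
    have "sum_list (exps_of N i j k) = sum_list (map (\<lambda>l. of_bool (l = i)) [0..<N]) +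
      sum_list (map (\<lambda>l. of_bool (l = j)) [0..<N]) + sum_list (map (\<lambda>l. of_bool (l = k)) [0..<N])"
      unfolding exps_of_def by (simp add: sum_list_addf)
    then show ?thesis
      using sum_list_of_bool_le[of i N] sum_list_of_bool_le[of j N] sum_list_of_bool_le[of k N] by linarith
  qed
  then show ?thesis by (auto simp: cubic_terms_def quad_term_def exps_of_def)
qed

section \<open>Gradient and Hessian of sums of triple products\<close>

definition trilin1 :: "nat \<Rightarrow> quad list \<Rightarrow> nat \<Rightarrow> real vec \<Rightarrow> real" where
  "trilin1 N qs l x = (\<Sum>(c, i, j, k) \<leftarrow> qs. of_rat c * (of_bool (i = l) * (cv N x j * cv N x k) +
     of_bool (j = l) * (cv N x i * cv N x k) + of_bool (k = l) * (cv N x i * cv N x j)))"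

definition trilin2 :: "nat \<Rightarrow> quad list \<Rightarrow> nat \<Rightarrow> nat \<Rightarrow> real vec \<Rightarrow> real" where
  "trilin2 N qs l p x = (\<Sum>(c, i, j, k) \<leftarrow> qs. of_rat c * (
     of_bool (i = l) * (of_bool (j = p) * cv N x k + of_bool (k = p) * cv N x j) +
     of_bool (j = l) * (of_bool (i = p) * cv N x k + of_bool (k = p) * cv N x i) +
     of_bool (k = l) * (of_bool (i = p) * cv N x j + of_bool (j = p) * cv N x i)))"

lemma cv_line:
  assumes "x \<in> carrier_vec N" "l < N"
  shows "cv N (x + t \<cdot>\<^sub>v unit_vec N l) k = cv N x k + t * of_bool (k = l)"
  using assms by (auto simp: cv_def)

lemma deriv_cv:
  assumes "x \<in> carrier_vec N" "l < N"
  shows "((\<lambda>t. cv N (x + t \<cdot>\<^sub>v unit_vec N l) k) has_real_derivative of_bool (k = l)) (at 0)"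
  unfolding cv_line[OF assms] by (auto intro!: derivative_eq_intros)

lemma partial_trilin:
  assumes "x \<in> carrier_vec N" "l < N"
  shows "partial N l (trilin N qs) x = trilin1 N qs l x"
proof -
  have x0: "x + 0 \<cdot>\<^sub>v unit_vec N l = x" using assms by auto
  have "((\<lambda>t. trilin N qs (x + t \<cdot>\<^sub>v unit_vec N l)) has_real_derivative trilin1 N qs l x) (at 0)"
  proof (induction qs)
    case Nil
    then show ?case by (simp add: trilin_def trilin1_def)
  next
    case (Cons q qs)
    obtain c i j k where q: "q = (c, i, j, k)" by (cases q) auto
    have "((\<lambda>t. of_rat c * (cv N (x + t \<cdot>\<^sub>v unit_vec N l) i * cv N (x + t \<cdot>\<^sub>v unit_vec N l) j * cv N (x + t \<cdot>\<^sub>v unit_vec N l) k)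
        + trilin N qs (x + t \<cdot>\<^sub>v unit_vec N l)) has_real_derivative
      of_rat c * (of_bool (i = l) * (cv N x j * cv N x k) +
     of_bool (j = l) * (cv N x i * cv N x k) + of_bool (k = l) * (cv N x i * cv N x j)) + trilin1 N qs l x) (at 0)"
      by (rule derivative_eq_intros deriv_cv[OF assms] Cons.IH refl)+ (simp add: x0 algebra_simps)
    then show ?case by (simp add: trilin_def trilin1_def q)
  qed
  then show ?thesis unfolding partial_def by (rule DERIV_imp_deriv)
qed

lemma partial_partial_trilin:
  assumes "x \<in> carrier_vec N" "l < N" "p < N"
  shows "partial N p (partial N l (trilin N qs)) x = trilin2 N qs l p x"
proof -
  have x0: "x + 0 \<cdot>\<^sub>v unit_vec N p = x" using assms by auto
  have "((\<lambda>t. trilin1 N qs l (x + t \<cdot>\<^sub>v unit_vec N p)) has_real_derivative trilin2 N qs l p x) (at 0)"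
  proof (induction qs)
    case Nil
    then show ?case by (simp add: trilin1_def trilin2_def)
  next
    case (Cons q qs)
    obtain c i j k where q: "q = (c, i, j, k)" by (cases q) auto
    let ?x = "\<lambda>t. x + t \<cdot>\<^sub>v unit_vec N p"
    have "((\<lambda>t. of_rat c * (of_bool (i = l) * (cv N (?x t) j * cv N (?x t) k) +
     of_bool (j = l) * (cv N (?x t) i * cv N (?x t) k) + of_bool (k = l) * (cv N (?x t) i * cv N (?x t) j))
        + trilin1 N qs l (?x t)) has_real_derivative
      of_rat c * (
     of_bool (i = l) * (of_bool (j = p) * cv N x k + of_bool (k = p) * cv N x j) +
     of_bool (j = l) * (of_bool (i = p) * cv N x k + of_bool (k = p) * cv N x i) +
     of_bool (k = l) * (of_bool (i = p) * cv N x j + of_bool (j = p) * cv N x i)) + trilin2 N qs l p x) (at 0)"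
      by (rule derivative_eq_intros deriv_cv[OF assms(1,3)] Cons.IH refl)+ (simp add: x0 algebra_simps)
    then show ?case by (simp add: trilin1_def trilin2_def q)
  qed
  \<comment> \<open>The inner derivative must be known along the whole line through
    \<open>x\<close>, because the outer one differentiates it there.\<close>
  moreover have "partial N l (trilin N qs) (x + t \<cdot>\<^sub>v unit_vec N p) = trilin1 N qs l (x + t \<cdot>\<^sub>v unit_vec N p)" for t
    using assms by (intro partial_trilin) auto
  ultimately show ?thesis
    unfolding partial_def[of N p] by (simp add: DERIV_imp_deriv)
qed

text \<open>Half the quadratic form of the Hessian: the coefficient of \<open>t^2\<close> in the
  polynomial along the line \<open>x + t u\<close>.\<close>

definition quadform :: "nat \<Rightarrow> quad list \<Rightarrow> real vec \<Rightarrow> real vec \<Rightarrow> real" where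
  "quadform N qs x u = (\<Sum>(c, i, j, k) \<leftarrow> qs. of_rat c * (dv N u i * dv N u j * cv N x k +
     dv N u i * cv N x j * dv N u k + cv N x i * dv N u j * dv N u k))"

lemma sum_dv: "(\<Sum>p<N. of_bool (i = p) * u $ p) = dv N u i"
  by (simp add: dv_def of_bool_def if_distrib[of "\<lambda>c. c * _"] cong: if_cong)

lemma hessian_form:
  assumes x: "x \<in> carrier_vec N" and u: "u \<in> carrier_vec N"
  shows "u \<bullet> (hessian N (trilin N qs) x *\<^sub>v u) = 2 * quadform N qs x u"
proof -
  have "u \<bullet> (hessian N (trilin N qs) x *\<^sub>v u) = (\<Sum>p<N. u $ p * (\<Sum>l<N. trilin2 N qs l p x * u $ l))"
    using u x by (auto simp: scalar_prod_def hessian_def partial_partial_trilin atLeast0LessThan intro!: sum.cong)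
  also have "\<dots> = 2 * quadform N qs x u"
  proof (induction qs)
    case Nil
    then show ?case by (simp add: trilin2_def quadform_def)
  next
    case (Cons q qs)
    obtain c i j k where q: "q = (c, i, j, k)" by (cases q) auto
    let ?h = "\<lambda>l p. (of_bool (i = l) * (of_bool (j = p) * cv N x k + of_bool (k = p) * cv N x j) +
     of_bool (j = l) * (of_bool (i = p) * cv N x k + of_bool (k = p) * cv N x i) +
     of_bool (k = l) * (of_bool (i = p) * cv N x j + of_bool (j = p) * cv N x i))"
    have 1: "(\<Sum>l<N. ?h l p * u $ l) = dv N u i * (of_bool (j = p) * cv N x k + of_bool (k = p) * cv N x j) +
     dv N u j * (of_bool (i = p) * cv N x k + of_bool (k = p) * cv N x i) +
     dv N u k * (of_bool (i = p) * cv N x j + of_bool (j = p) * cv N x i)" for p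
    proof -
      have "(\<Sum>l<N. ?h l p * u $ l) =
        (\<Sum>l<N. (of_bool (i = l) * u $ l) * (of_bool (j = p) * cv N x k + of_bool (k = p) * cv N x j) +
        (of_bool (j = l) * u $ l) * (of_bool (i = p) * cv N x k + of_bool (k = p) * cv N x i) +
        (of_bool (k = l) * u $ l) * (of_bool (i = p) * cv N x j + of_bool (j = p) * cv N x i))"
        by (intro sum.cong) (auto simp: algebra_simps)
      then show ?thesis by (simp only: sum.distrib sum_dv flip: sum_distrib_right)
    qed
    have 2: "(\<Sum>p<N. u $ p * (\<Sum>l<N. ?h l p * u $ l)) =
      2 * (dv N u i * dv N u j * cv N x k + dv N u i * cv N x j * dv N u k + cv N x i * dv N u j * dv N u k)"
    proof -
      have "(\<Sum>p<N. u $ p * (\<Sum>l<N. ?h l p * u $ l)) =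
        (\<Sum>p<N. (of_bool (i = p) * u $ p) * (dv N u j * cv N x k + dv N u k * cv N x j) +
          (of_bool (j = p) * u $ p) * (dv N u i * cv N x k + dv N u k * cv N x i) +
          (of_bool (k = p) * u $ p) * (dv N u i * cv N x j + dv N u j * cv N x i))"
        unfolding 1 by (intro sum.cong) (auto simp: algebra_simps)
      also have "\<dots> = dv N u i * (dv N u j * cv N x k + dv N u k * cv N x j) +
          dv N u j * (dv N u i * cv N x k + dv N u k * cv N x i) + dv N u k * (dv N u i * cv N x j + dv N u j * cv N x i)"
        by (simp only: sum.distrib sum_dv flip: sum_distrib_right)
      finally show ?thesis by (simp add: algebra_simps)
    qed
    have "trilin2 N (q # qs) l p x = of_rat c * ?h l p + trilin2 N qs l p x" for l p
      by (simp add: trilin2_def q)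
    then have "(\<Sum>p<N. u $ p * (\<Sum>l<N. trilin2 N (q # qs) l p x * u $ l)) =
       of_rat c * (\<Sum>p<N. u $ p * (\<Sum>l<N. ?h l p * u $ l)) + (\<Sum>p<N. u $ p * (\<Sum>l<N. trilin2 N qs l p x * u $ l))"
      by (simp add: sum.distrib sum_distrib_left distrib_left distrib_right mult_ac)
    then show ?case unfolding 2 Cons.IH by (simp add: quadform_def q algebra_simps)
  qed
  finally show ?thesis .
qed

lemma hessian_symmetric: "x \<in> carrier_vec N \<Longrightarrow> (hessian N (trilin N qs) x)\<^sup>T = hessian N (trilin N qs) x"
proof -
  assume x: "x \<in> carrier_vec N"
  have sym: "trilin2 N qs l p x = trilin2 N qs p l x" for l p
    unfolding trilin2_def by (intro arg_cong[where f = sum_list] map_cong refl) (auto simp: algebra_simps)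
  show ?thesis
    by (rule eq_matI) (use x sym in \<open>auto simp: hessian_def partial_partial_trilin\<close>)
qed

lemma second_order_point_trilin:
  "second_order_point N (trilin N qs) x \<longleftrightarrow> x \<in> carrier_vec N \<and> (\<forall>l<N. trilin1 N qs l x = 0) \<and>
     (\<forall>u\<in>carrier_vec N. quadform N qs x u \<ge> 0)"
proof (cases "x \<in> carrier_vec N")
  case True
  have "gradient N (trilin N qs) x = 0\<^sub>v N \<longleftrightarrow> (\<forall>l<N. trilin1 N qs l x = 0)"
    using True by (auto simp: gradient_def partial_trilin vec_eq_iff)
  moreover have "hessian N (trilin N qs) x \<in> carrier_mat N N" by (simp add: hessian_def)
  ultimately show ?thesis
    using True hessian_symmetric[OF True] hessian_form[OF True] by (auto simp: second_order_point_def psd_def)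
qed (simp add: second_order_point_def)

section \<open>Numbering of the variables\<close>

definition vx :: "nat \<Rightarrow> nat" where "vx i = 1 + i"
definition vg :: "nat \<Rightarrow> nat \<Rightarrow> nat" where "vg n i = 1 + n + i"
definition vy :: "nat \<Rightarrow> nat \<Rightarrow> nat" where "vy n r = 1 + 2 * n + r"
definition va :: "nat \<Rightarrow> nat \<Rightarrow> nat \<Rightarrow> nat \<Rightarrow> nat" where "va n m r s = 1 + 2 * n + m + (r * m + s)"

lemma map_upt_add: "map f [0..<a + b] = map f [0..<a] @ map (\<lambda>i. f (a + i)) [0..<b]"
  by (induction b) auto

lemma map_upt_mult: "map f [0..<k * m] = concat (map (\<lambda>p. map (\<lambda>q. f (p * m + q)) [0..<m]) [0..<k])"
proof (induction k)
  case (Suc k)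
  have "map f [0..<Suc k * m] = map f [0..<k * m + m]" by (simp add: add.commute)
  then show ?case unfolding map_upt_add using Suc by simp
qed simp

lemma map_num_vars:
  "map f [0..<num_vars n m] = exps n m (f 0) (\<lambda>i. f (vx i)) (\<lambda>i. f (vg n i)) (\<lambda>r. f (vy n r)) (\<lambda>p q. f (va n m p q))"
proof -
  have "num_vars n m = 1 + (n + (n + (m + m * m)))" by (simp add: num_vars_def)
  then have "map f [0..<num_vars n m] = map f [0..<1 + (n + (n + (m + m * m)))]" by simp
  then show ?thesis
    unfolding map_upt_add[of f 1] map_upt_add[of "\<lambda>i. f (1 + i)" n] map_upt_add[of "\<lambda>i. f (1 + (n + i))" n]
      map_upt_add[of "\<lambda>i. f (1 + (n + (n + i)))" m] map_upt_mult
    by (simp add: exps_def vx_def vg_def vy_def va_def add.assoc mult_2)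
qed

lemma exps_cong:
  assumes "e = e'" "\<And>i. i < n \<Longrightarrow> gx i = gx' i" "\<And>i. i < n \<Longrightarrow> gg i = gg' i" "\<And>r. r < m \<Longrightarrow> gy r = gy' r"
    "\<And>p q. p < m \<Longrightarrow> q < m \<Longrightarrow> ga p q = ga' p q"
  shows "exps n m e gx gg gy ga = exps n m e' gx' gg' gy' ga'"
  unfolding exps_def using assms by (auto intro!: arg_cong[where f = concat] map_cong)

lemma block_less: "r < m \<Longrightarrow> s < m \<Longrightarrow> r * m + s < m * (m::nat)"
proof -
  assume "r < m" "s < m"
  then have "Suc r * m \<le> m * m" by (intro mult_le_mono1) simp
  with \<open>s < m\<close> show ?thesis by simp
qed

lemma block_inj: "q < m \<Longrightarrow> s < m \<Longrightarrow> p * m + q = r * m + s \<longleftrightarrow> p = r \<and> q = (s::nat)"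
proof
  assume a: "q < m" "s < m" "p * m + q = r * m + s"
  have "(p * m + q) div m = p" "(r * m + s) div m = r" "(p * m + q) mod m = q" "(r * m + s) mod m = s"
    using a(1,2) by auto
  then show "p = r \<and> q = s" using a(3) by metis
qed simp

lemma var_less:
  "i < n \<Longrightarrow> vx i < num_vars n m" "i < n \<Longrightarrow> vg n i < num_vars n m" "r < m \<Longrightarrow> vy n r < num_vars n m"
  "r < m \<Longrightarrow> s < m \<Longrightarrow> va n m r s < num_vars n m" "0 < num_vars n m"
  using block_less[of r m s] by (auto simp: vx_def vg_def vy_def va_def num_vars_def)

lemma var_eq:
  "vx i = vx j \<longleftrightarrow> i = j" "vg n i = vg n j \<longleftrightarrow> i = j" "vy n r = vy n s \<longleftrightarrow> r = s"
  "q < m \<Longrightarrow> s < m \<Longrightarrow> va n m p q = va n m r s \<longleftrightarrow> p = r \<and> q = s"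
  using block_inj[of q m s p r] by (auto simp: vx_def vg_def vy_def va_def)

lemma var_neq:
  "vx i \<noteq> 0" "vg n i \<noteq> 0" "vy n r \<noteq> 0" "va n m r s \<noteq> 0"
  "i < n \<Longrightarrow> vx i \<noteq> vg n j" "i < n \<Longrightarrow> vx i \<noteq> vy n r" "i < n \<Longrightarrow> vx i \<noteq> va n m r s"
  "i < n \<Longrightarrow> vg n i \<noteq> vy n r" "i < n \<Longrightarrow> vg n i \<noteq> va n m r s" "r < m \<Longrightarrow> vy n r \<noteq> va n m r' s"
  by (auto simp: vx_def vg_def vy_def va_def)

lemma var_neq_num:
  "i < n \<Longrightarrow> vx i \<noteq> num_vars n m" "i < n \<Longrightarrow> vg n i \<noteq> num_vars n m" "r < m \<Longrightarrow> vy n r \<noteq> num_vars n m"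
  "r < m \<Longrightarrow> s < m \<Longrightarrow> va n m r s \<noteq> num_vars n m" "num_vars n m \<noteq> 0"
  using var_less(1)[of i n m] var_less(2)[of i n m] var_less(3)[of r m n] var_less(4)[of r m s n] var_less(5)[of n m]
  by simp_all

lemma var_pos: "0 < vx i" "0 < vg n i" "0 < vy n r" "0 < va n m r s"
  by (auto simp: vx_def vg_def vy_def va_def)

lemmas vars = var_pos var_less var_eq var_neq var_neq[symmetric] var_neq_num var_neq_num[symmetric]

text \<open>The index of the variable \<open>x\<^sub>i\<close>, with \<open>x\<^sub>0 := 1\<close>: \<open>cv\<close> takes the value \<open>1\<close> at the index \<open>num_vars n m\<close>.\<close>

definition vX :: "nat \<Rightarrow> nat \<Rightarrow> nat \<Rightarrow> nat" where
  "vX n m i = (if i = 0 then num_vars n m else vx i)"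

lemma exps1_of: "i < n \<Longrightarrow> r < m \<Longrightarrow> s < m \<Longrightarrow> exps1 n m i r s = exps_of (num_vars n m) (vX n m i) (vy n r) (vy n s)"
  unfolding exps1_def exps_of_def map_num_vars vX_def
  by (rule exps_cong) (auto simp: vars)

lemma exps2_of: "i < n \<Longrightarrow> r < m \<Longrightarrow> s < m \<Longrightarrow> exps2 n m i r s = exps_of (num_vars n m) (num_vars n m) (vg n i) (va n m r s)"
  unfolding exps2_def exps_of_def map_num_vars
  by (rule exps_cong) (auto simp: vars)

lemma exps3_of: "i < n \<Longrightarrow> r < m \<Longrightarrow> s < m \<Longrightarrow> exps3 n m i r s = exps_of (num_vars n m) 0 (vg n i) (va n m s r)"
  unfolding exps3_def exps_of_def map_num_vars
  by (rule exps_cong) (auto simp: vars)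

lemma const_exps_of: "const_exps n m 2 = exps_of (num_vars n m) (num_vars n m) 0 0"
  "const_exps n m 1 = exps_of (num_vars n m) (num_vars n m) (num_vars n m) 0"
  unfolding const_exps_def exps_of_def map_num_vars
  by (rule exps_cong; auto simp: vars)+

definition quads :: "nat \<Rightarrow> nat \<Rightarrow> (nat \<Rightarrow> nat \<Rightarrow> nat \<Rightarrow> rat) \<Rightarrow> quad list" where
  "quads n m a = (1, num_vars n m, 0, 0) # (2, num_vars n m, num_vars n m, 0) #
     concat (map (\<lambda>i. concat (map (\<lambda>r. concat (map (\<lambda>s. [(a i r s, vX n m i, vy n r, vy n s),
       (a i r s, num_vars n m, vg n i, va n m r s), (a i r s, 0, vg n i, va n m s r)]) [0..<m])) [0..<m])) [0..<n])"

definition array :: "nat \<Rightarrow> nat \<Rightarrow> (nat \<Rightarrow> nat \<Rightarrow> nat \<Rightarrow> 'a) \<Rightarrow> 'a list list list" where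
  "array n m a = map (\<lambda>i. map (\<lambda>r. map (a i r) [0..<m]) [0..<m]) [0..<n]"

lemma map_concat_map: "map f (concat (map g xs)) = concat (map (\<lambda>x. map f (g x)) xs)"
  by (induction xs) auto

lemma poly_terms_quads: "poly_terms n m (array n m a) = map (quad_term (num_vars n m)) (quads n m a)"
proof -
  have "all_terms n m 0 (array n m a) = concat (map (\<lambda>i. concat (map (\<lambda>r. concat (map (\<lambda>s. entry_terms n m i r s (a i r s)) [0..<m])) [0..<m])) [0..<n])"
    by (simp add: all_terms_def mat_terms_def row_terms_def array_def enumerate_map_upt o_def)
  also have "\<dots> = concat (map (\<lambda>i. concat (map (\<lambda>r. concat (map (\<lambda>s. map (quad_term (num_vars n m)) [(a i r s, vX n m i, vy n r, vy n s),
       (a i r s, num_vars n m, vg n i, va n m r s), (a i r s, 0, vg n i, va n m s r)]) [0..<m])) [0..<m])) [0..<n])"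
    by (intro arg_cong[where f = concat] map_cong refl)
      (simp add: entry_terms_def quad_term_def exps1_of exps2_of exps3_of)
  finally show ?thesis
    by (simp add: poly_terms_def quads_def map_concat_map const_exps_of const_exps_of(2)[unfolded One_nat_def] quad_term_def)
qed

lemma sum_list_concat_map: "sum_list (map f (concat (map g [0..<n]))) = (\<Sum>i<n. sum_list (map f (g i)))"
  for f :: "'b \<Rightarrow> real"
  by (induction n) auto

lemma sum_quads:
  fixes f :: "quad \<Rightarrow> real"
  shows "sum_list (map f (quads n m a)) = f (1, num_vars n m, 0, 0) + f (2, num_vars n m, num_vars n m, 0) +
    (\<Sum>i<n. \<Sum>r<m. \<Sum>s<m. f (a i r s, vX n m i, vy n r, vy n s) + f (a i r s, num_vars n m, vg n i, va n m r s) +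
      f (a i r s, 0, vg n i, va n m s r))"
  by (simp add: quads_def sum_list_concat_map add.assoc)

section \<open>Second-order conditions and semidefiniteness\<close>

lemma sum3_delta:
  fixes f :: "nat \<Rightarrow> nat \<Rightarrow> nat \<Rightarrow> real"
  assumes "i < n" "r < m" "s < k"
  shows "(\<Sum>i'<n. \<Sum>r'<m. \<Sum>s'<k. if i' = i \<and> r' = r \<and> s' = s then f i' r' s' else 0) = f i r s"
proof -
  have 1: "(\<Sum>s'<k. if i' = i \<and> r' = r \<and> s' = s then f i' r' s' else 0) = (if i' = i \<and> r' = r then f i' r' s else 0)" for i' r'
    by (cases "i' = i \<and> r' = r") (use assms in auto)
  have 2: "(\<Sum>r'<m. if i' = i \<and> r' = r then f i' r' s else 0) = (if i' = i then f i' r s else 0)" for i'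
    by (cases "i' = i") (use assms in auto)
  show ?thesis unfolding 1 2 using assms by simp
qed

text \<open>An affine function bounded below is constant. This replaces the usual argument that a
  zero on the diagonal of a semidefinite matrix annihilates its row: with the component
  \<open>t\<close> of a direction placed at \<open>g_i\<close>, where the diagonal entry is
  \<open>0\<close>, the quadratic form is affine in \<open>t\<close>.\<close>

lemma linear_nonneg:
  fixes a b :: real
  assumes "\<And>t. a + t * b \<ge> 0"
  shows "b = 0"
proof (rule ccontr)
  assume b: "b \<noteq> 0"
  \<comment> \<open>At this point the function has the value \<open>-1\<close>.\<close>
  have "a + ((- a - 1) / b) * b \<ge> 0" by (rule assms)
  with b show False by simp
qed

text \<open>One summand of the quadratic form for a direction supported on \<open>g_i\<close> and
  \<open>a_rs\<close>. \<open>P\<close> stands for a hit of the index \<open>i\<close>,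
  \<open>Q\<close> and \<open>R\<close> for a hit of \<open>(r, s)\<close> by the running pair and
  by its transpose; \<open>x1\<close> to \<open>x5\<close> are coordinates that are multiplied by
  zero.\<close>

lemma if_products:
  fixes A e t x y :: real
  shows "A * (0 * 0 * x1 + 0 * x2 * 0 + x3 * 0 * 0) + A * ((if P then t else 0) * (if Q then 1 else 0)) +
      A * (0 * (if P then t else 0) * x4 + 0 * x5 * (if R then 1 else 0) + e * (if P then t else 0) * (if R then 1 else 0))
    = (if P \<and> Q then t * A else 0) + (if P \<and> R then t * (e * A) else 0)"
  by (cases P; cases Q; cases R) simp_all

text \<open>The same for a direction supported on \<open>e\<close> and \<open>g_i\<close>.\<close>

lemma if_products':
  fixes A e t x :: real
  shows "A * (0 * 0 * x1 + 0 * x2 * 0 + x3 * 0 * 0) + A * ((if P then t else 0) * 0) +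
      A * (1 * (if P then t else 0) * x + 1 * x5 * 0 + e * (if P then t else 0) * 0) = (if P then t * (A * x) else 0)"
  by (cases P) simp_all

lemma sop_necessary:
  fixes n m a
  defines "N \<equiv> num_vars n m"
  assumes v: "second_order_point N (trilin N (quads n m a)) v"
  shows "(\<forall>i<n. \<forall>r<m. \<forall>s<m. a i r s = a i s r) \<and>
    (\<forall>w\<in>carrier_vec m. (\<Sum>i<n. \<Sum>r<m. \<Sum>s<m. of_rat (a i r s) * (cv N v (vX n m i) * w $ r * w $ s)) \<ge> 0)"
proof -
  have vc: "v \<in> carrier_vec N" and grad: "\<And>l. l < N \<Longrightarrow> trilin1 N (quads n m a) l v = 0"
    and hess: "\<And>u. u \<in> carrier_vec N \<Longrightarrow> quadform N (quads n m a) v u \<ge> 0"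
    using v unfolding second_order_point_trilin by auto
  define e where "e = v $ 0"
  have cv0: "cv N v 0 = e" "cv N v N = 1" using var_less(5) by (auto simp: cv_def e_def N_def)
  have qf: "quadform N (quads n m a) v u = dv N u 0 * dv N u 0 +
     (\<Sum>i<n. \<Sum>r<m. \<Sum>s<m. of_rat (a i r s) * (dv N u (vX n m i) * dv N u (vy n r) * cv N v (vy n s) +
        dv N u (vX n m i) * cv N v (vy n r) * dv N u (vy n s) + cv N v (vX n m i) * dv N u (vy n r) * dv N u (vy n s)) +
      of_rat (a i r s) * (dv N u (vg n i) * dv N u (va n m r s)) +
      of_rat (a i r s) * (dv N u 0 * dv N u (vg n i) * cv N v (va n m s r) + dv N u 0 * cv N v (vg n i) * dv N u (va n m s r) +
        e * dv N u (vg n i) * dv N u (va n m s r)))" for u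
  proof -
    have "dv N u N = 0" by (simp add: dv_def)
    then show ?thesis unfolding quadform_def sum_quads[of _ n m a, folded N_def] using cv0 by simp
  qed
  have step1: "of_rat (a i r s) + e * of_rat (a i s r) = (0::real)" if b: "i < n" "r < m" "s < m" for i r s
  proof (rule linear_nonneg[of 0])
    fix t :: real
    \<comment> \<open>Component \<open>t\<close> at \<open>g_i\<close> and \<open>1\<close> at
      \<open>a_rs\<close>. Both diagonal entries vanish, so the form is \<open>t\<close> times the
      mixed entry. The latter has a part from the monomial \<open>g_i a_rs\<close> and, through the
      transposed index, one from \<open>e g_i a_rs\<close> with coefficient
      \<open>A_isr\<close>.\<close>
    define u where "u = vec N (\<lambda>k. if k = vg n i then t else if k = va n m r s then 1 else 0)"
    have u: "u \<in> carrier_vec N" by (simp add: u_def)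
    have d: "dv N u 0 = 0" "\<And>j. j < n \<Longrightarrow> dv N u (vX n m j) = 0" "\<And>j. j < m \<Longrightarrow> dv N u (vy n j) = 0"
      "\<And>j. j < n \<Longrightarrow> dv N u (vg n j) = (if j = i then t else 0)"
      "\<And>p q. p < m \<Longrightarrow> q < m \<Longrightarrow> dv N u (va n m p q) = (if p = r \<and> q = s then 1 else 0)"
      using b by (auto simp: dv_def u_def vX_def vars N_def)
    have "0 \<le> quadform N (quads n m a) v u" by (rule hess[OF u])
    also have "\<dots> = (\<Sum>i'<n. \<Sum>r'<m. \<Sum>s'<m. (if i' = i \<and> r' = r \<and> s' = s then t * of_rat (a i' r' s') else 0) +
        (if i' = i \<and> r' = s \<and> s' = r then t * (e * of_rat (a i' r' s')) else 0))"
    proof -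
      have "of_rat (a i' r' s') * (dv N u (vX n m i') * dv N u (vy n r') * cv N v (vy n s') +
        dv N u (vX n m i') * cv N v (vy n r') * dv N u (vy n s') + cv N v (vX n m i') * dv N u (vy n r') * dv N u (vy n s')) +
      of_rat (a i' r' s') * (dv N u (vg n i') * dv N u (va n m r' s')) +
      of_rat (a i' r' s') * (dv N u 0 * dv N u (vg n i') * cv N v (va n m s' r') + dv N u 0 * cv N v (vg n i') * dv N u (va n m s' r') +
        e * dv N u (vg n i') * dv N u (va n m s' r')) = (if i' = i \<and> r' = r \<and> s' = s then t * of_rat (a i' r' s') else 0) +
        (if i' = i \<and> r' = s \<and> s' = r then t * (e * of_rat (a i' r' s')) else 0)"
        if "i' < n" "r' < m" "s' < m" for i' r' s'
        unfolding d(1) d(2)[OF that(1)] d(3)[OF that(2)] d(3)[OF that(3)] d(4)[OF that(1)] d(5)[OF that(2,3)] d(5)[OF that(3,2)] if_products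
        by (simp only: conj_commute)
      then have "quadform N (quads n m a) v u = dv N u 0 * dv N u 0 + (\<Sum>i'<n. \<Sum>r'<m. \<Sum>s'<m. (if i' = i \<and> r' = r \<and> s' = s then t * of_rat (a i' r' s') else 0) +
        (if i' = i \<and> r' = s \<and> s' = r then t * (e * of_rat (a i' r' s')) else 0))"
        unfolding qf
        by (intro arg_cong[where f = "\<lambda>z. dv N u 0 * dv N u 0 + z"]) (rule sum.cong[OF refl], rule sum.cong[OF refl], rule sum.cong[OF refl], simp only: lessThan_iff)
      then show ?thesis by (simp only: d(1) mult_zero_left add_0)
    qed
    also have "\<dots> = t * of_rat (a i r s) + t * (e * of_rat (a i s r))"
      unfolding sum.distrib sum3_delta[OF b(1,2,3)] sum3_delta[OF b(1,3,2)] ..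
    finally show "0 + t * (of_rat (a i r s) + e * of_rat (a i s r)) \<ge> 0" by (simp add: algebra_simps)
  qed
  have step2: "(\<Sum>r<m. \<Sum>s<m. of_rat (a i r s) * cv N v (va n m s r)) = 0" if b: "i < n" for i
  proof (rule linear_nonneg[of 1])
    fix t :: real
    \<comment> \<open>Component \<open>1\<close> at \<open>e\<close> and \<open>t\<close> at
      \<open>g_i\<close>: the monomial \<open>e^2\<close> contributes the constant \<open>1\<close>,
      and the factor of \<open>t\<close> is the mixed entry of the Hessian.\<close>
    define u where "u = vec N (\<lambda>k. if k = 0 then 1 else if k = vg n i then t else 0)"
    have u: "u \<in> carrier_vec N" by (simp add: u_def)
    have d: "dv N u 0 = 1" "\<And>j. j < n \<Longrightarrow> dv N u (vX n m j) = 0" "\<And>j. j < m \<Longrightarrow> dv N u (vy n j) = 0"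
      "\<And>j. j < n \<Longrightarrow> dv N u (vg n j) = (if j = i then t else 0)"
      "\<And>p q. p < m \<Longrightarrow> q < m \<Longrightarrow> dv N u (va n m p q) = 0"
      using b by (auto simp: dv_def u_def vX_def vars N_def)
    have "0 \<le> quadform N (quads n m a) v u" by (rule hess[OF u])
    also have "\<dots> = 1 + (\<Sum>i'<n. if i' = i then (\<Sum>r'<m. \<Sum>s'<m. t * (of_rat (a i' r' s') * cv N v (va n m s' r'))) else 0)"
    proof -
      have "of_rat (a i' r' s') * (dv N u (vX n m i') * dv N u (vy n r') * cv N v (vy n s') +
        dv N u (vX n m i') * cv N v (vy n r') * dv N u (vy n s') + cv N v (vX n m i') * dv N u (vy n r') * dv N u (vy n s')) +
      of_rat (a i' r' s') * (dv N u (vg n i') * dv N u (va n m r' s')) +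
      of_rat (a i' r' s') * (dv N u 0 * dv N u (vg n i') * cv N v (va n m s' r') + dv N u 0 * cv N v (vg n i') * dv N u (va n m s' r') +
        e * dv N u (vg n i') * dv N u (va n m s' r')) = (if i' = i then t * (of_rat (a i' r' s') * cv N v (va n m s' r')) else 0)"
        if "i' < n" "r' < m" "s' < m" for i' r' s'
        unfolding d(1) d(2)[OF that(1)] d(3)[OF that(2)] d(3)[OF that(3)] d(4)[OF that(1)] d(5)[OF that(2,3)] d(5)[OF that(3,2)]
        by (rule if_products')
      then have "quadform N (quads n m a) v u = dv N u 0 * dv N u 0 + (\<Sum>i'<n. \<Sum>r'<m. \<Sum>s'<m. if i' = i then t * (of_rat (a i' r' s') * cv N v (va n m s' r')) else 0)"
        unfolding qf
        by (intro arg_cong[where f = "\<lambda>z. dv N u 0 * dv N u 0 + z"]) (rule sum.cong[OF refl], rule sum.cong[OF refl], rule sum.cong[OF refl], simp only: lessThan_iff)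
      also have "dv N u 0 * dv N u 0 = 1" by (simp add: d(1))
      also have "(\<Sum>i'<n. \<Sum>r'<m. \<Sum>s'<m. if i' = i then t * (of_rat (a i' r' s') * cv N v (va n m s' r')) else 0)
        = (\<Sum>i'<n. if i' = i then (\<Sum>r'<m. \<Sum>s'<m. t * (of_rat (a i' r' s') * cv N v (va n m s' r'))) else 0)"
        by (rule sum.cong) auto
      finally show ?thesis .
    qed
    also have "\<dots> = 1 + t * (\<Sum>r'<m. \<Sum>s'<m. of_rat (a i r' s') * cv N v (va n m s' r'))"
      using b by (simp add: sum_distrib_left)
    finally show "1 + t * (\<Sum>r<m. \<Sum>s<m. of_rat (a i r s) * cv N v (va n m s r)) \<ge> 0" .
  qed
  have e: "e = -1"
  proof -
    have "0 = trilin1 N (quads n m a) 0 v" using grad var_less(5) by (simp add: N_def)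
    also have "\<dots> = 2 * e + 2 + (\<Sum>i<n. \<Sum>r<m. \<Sum>s<m. of_rat (a i r s) * (cv N v (vg n i) * cv N v (va n m s r)))"
      unfolding trilin1_def sum_quads[of _ n m a, folded N_def]
      by (simp add: cv0 vX_def vars N_def[symmetric] var_neq_num(5)[of n m, folded N_def])
        (intro sum.cong refl, auto simp: vars)
    also have "(\<Sum>i<n. \<Sum>r<m. \<Sum>s<m. of_rat (a i r s) * (cv N v (vg n i) * cv N v (va n m s r))) =
      (\<Sum>i<n. cv N v (vg n i) * (\<Sum>r<m. \<Sum>s<m. of_rat (a i r s) * cv N v (va n m s r)))"
      by (simp add: sum_distrib_left mult_ac)
    also have "\<dots> = 0" by (intro sum.neutral) (simp add: step2)
    finally show ?thesis by simp
  qed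
  have "a i r s = a i s r" if b: "i < n" "r < m" "s < m" for i r s
    using step1[OF b] e by (simp add: of_rat_eq_iff)
  moreover have "(\<Sum>i<n. \<Sum>r<m. \<Sum>s<m. of_rat (a i r s) * (cv N v (vX n m i) * w $ r * w $ s)) \<ge> 0" if w: "w \<in> carrier_vec m" for w
  proof -
    \<comment> \<open>The test vector \<open>w\<close> is placed on the block of the variables
      \<open>y_r\<close>, with zeros elsewhere; only the monomials with two factors \<open>y\<close>
      survive.\<close>
    define u where "u = vec N (\<lambda>k. if 1 + 2 * n \<le> k \<and> k < 1 + 2 * n + m then w $ (k - (1 + 2 * n)) else 0)"
    have u: "u \<in> carrier_vec N" by (simp add: u_def)
    have d: "dv N u 0 = 0" "\<And>j. j < n \<Longrightarrow> dv N u (vX n m j) = 0" "\<And>j. j < m \<Longrightarrow> dv N u (vy n j) = w $ j"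
      "\<And>j. j < n \<Longrightarrow> dv N u (vg n j) = 0"
      "\<And>p q. p < m \<Longrightarrow> q < m \<Longrightarrow> dv N u (va n m p q) = 0"
      by (auto simp: dv_def u_def vX_def N_def vx_def vg_def vy_def va_def num_vars_def)
    have "0 \<le> quadform N (quads n m a) v u" by (rule hess[OF u])
    also have "\<dots> = (\<Sum>i<n. \<Sum>r<m. \<Sum>s<m. of_rat (a i r s) * (cv N v (vX n m i) * w $ r * w $ s))"
      unfolding qf by (simp add: d)
    finally show ?thesis .
  qed
  ultimately show ?thesis by blast
qed

lemma sop_sufficient:
  fixes n m a
  defines "N \<equiv> num_vars n m"
  assumes sym: "\<And>i r s. i < n \<Longrightarrow> r < m \<Longrightarrow> s < m \<Longrightarrow> a i r s = a i s r" and X0: "X 0 = 1"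
    and nonneg: "\<And>w. w \<in> carrier_vec m \<Longrightarrow> (\<Sum>i<n. \<Sum>r<m. \<Sum>s<m. of_rat (a i r s) * (X i * w $ r * w $ s)) \<ge> (0::real)"
  shows "\<exists>v. second_order_point N (trilin N (quads n m a)) v"
proof -
  \<comment> \<open>Index \<open>0\<close> is \<open>e\<close>, and the indices \<open>1\<close> to
    \<open>n\<close> carry \<open>x_0\<close> to \<open>x_(n-1)\<close>, hence the shift by one;
    \<open>g\<close>, \<open>y\<close> and \<open>a\<close> are zero.\<close>
  define v where "v = vec N (\<lambda>k. if k = 0 then - 1 else if k \<le> n then X (k - 1) else 0)"
  have vc: "v \<in> carrier_vec N" by (simp add: v_def)
  have c: "cv N v 0 = - 1" "cv N v N = 1" "\<And>i. i < n \<Longrightarrow> cv N v (vX n m i) = X i" "\<And>i. i < n \<Longrightarrow> cv N v (vg n i) = 0"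
    "\<And>r. r < m \<Longrightarrow> cv N v (vy n r) = 0" "\<And>r s. r < m \<Longrightarrow> s < m \<Longrightarrow> cv N v (va n m r s) = 0"
    using X0 var_less[where n = n and m = m] by (auto simp: cv_def v_def vX_def N_def vx_def vg_def vy_def va_def)
  have "trilin1 N (quads n m a) l v = 0" if "l < N" for l
  proof -
    \<comment> \<open>The padding index \<open>N\<close> is no variable. At \<open>l = 0\<close> the
      first two products contribute \<open>2 * (-1) + 2 = 0\<close>; all other contributions contain
      a factor \<open>y\<close>, \<open>g\<close> or \<open>a\<close>, which is zero.\<close>
    have l: "N \<noteq> l" using that by simp
    show ?thesis
      unfolding trilin1_def sum_quads[of _ n m a, folded N_def]
      by (simp add: c l)
  qed
  moreover have "quadform N (quads n m a) v u \<ge> 0" if u: "u \<in> carrier_vec N" for u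
  proof -
    define w where "w = vec m (\<lambda>r. dv N u (vy n r))"
    have w: "w \<in> carrier_vec m" by (simp add: w_def)
    have d: "dv N u N = 0" by (simp add: dv_def)
    let ?d = "\<lambda>i r s. of_rat (a i r s) * (dv N u (vg n i) * dv N u (va n m r s)) :: real"
    let ?d' = "\<lambda>i r s. of_rat (a i r s) * (dv N u (vg n i) * dv N u (va n m s r)) :: real"
    have "quadform N (quads n m a) v u = dv N u 0 * dv N u 0 +
      (\<Sum>i<n. \<Sum>r<m. \<Sum>s<m. of_rat (a i r s) * (X i * w $ r * w $ s) + ?d i r s - ?d' i r s)"
      unfolding quadform_def sum_quads[of _ n m a, folded N_def]
      by (simp add: c d, intro sum.cong refl) (auto simp: c d w_def)
    also have "\<dots> = dv N u 0 * dv N u 0 + (\<Sum>i<n. \<Sum>r<m. \<Sum>s<m. of_rat (a i r s) * (X i * w $ r * w $ s)) +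
      ((\<Sum>i<n. \<Sum>r<m. \<Sum>s<m. ?d i r s) - (\<Sum>i<n. \<Sum>r<m. \<Sum>s<m. ?d' i r s))"
      by (simp add: sum.distrib sum_subtractf)
    \<comment> \<open>With \<open>e = -1\<close> the two monomials in \<open>g\<close> and
      \<open>a\<close> enter with opposite signs. Exchanging the summation indices \<open>r\<close>
      and \<open>s\<close> and using the symmetry of \<open>A_i\<close> turns one into the other, so
      they cancel and a square plus the form in \<open>y\<close> remains.\<close>
    also have "(\<Sum>i<n. \<Sum>r<m. \<Sum>s<m. ?d i r s) = (\<Sum>i<n. \<Sum>r<m. \<Sum>s<m. ?d' i r s)"
    proof (rule sum.cong[OF refl])
      fix i assume i: "i \<in> {..<n}"
      have "(\<Sum>r<m. \<Sum>s<m. ?d i r s) = (\<Sum>s<m. \<Sum>r<m. ?d i r s)" by (rule sum.swap)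
      also have "\<dots> = (\<Sum>s<m. \<Sum>r<m. ?d' i s r)" using sym i by (intro sum.cong refl) auto
      finally show "(\<Sum>r<m. \<Sum>s<m. ?d i r s) = (\<Sum>r<m. \<Sum>s<m. ?d' i r s)" .
    qed
    finally show ?thesis using nonneg[OF w] by simp
  qed
  ultimately show ?thesis unfolding second_order_point_trilin using vc by blast
qed

section \<open>From matrices to the two languages\<close>

definition entries :: "rat mat list \<Rightarrow> nat \<Rightarrow> nat \<Rightarrow> nat \<Rightarrow> rat" where
  "entries As i r s = (As ! i) $$ (r, s)"

lemma lin_mat_form:
  assumes "w \<in> carrier_vec m"
  shows "w \<bullet> (lin_mat m A0 As x *\<^sub>v w) = (\<Sum>i<Suc (length As). \<Sum>r<m. \<Sum>s<m.
    of_rat (entries (A0 # As) i r s) * ((case i of 0 \<Rightarrow> 1 | Suc j \<Rightarrow> x $ j) * w $ r * w $ s))"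
proof -
  let ?X = "\<lambda>i. case i of 0 \<Rightarrow> 1 | Suc j \<Rightarrow> x $ j"
  have e: "of_rat (A0 $$ (r, s)) + (\<Sum>i<length As. x $ i * of_rat ((As ! i) $$ (r, s))) =
     (\<Sum>i<Suc (length As). of_rat (entries (A0 # As) i r s) * ?X i)" for r s
    by (simp add: sum.lessThan_Suc_shift entries_def mult.commute del: sum.lessThan_Suc)
  have "w \<bullet> (lin_mat m A0 As x *\<^sub>v w) = (\<Sum>r<m. \<Sum>s<m. \<Sum>i<Suc (length As). of_rat (entries (A0 # As) i r s) * (?X i * w $ r * w $ s))"
    using assms
    by (auto simp: scalar_prod_def lin_mat_def e atLeast0LessThan sum_distrib_left sum_distrib_right mult_ac
        simp del: sum.lessThan_Suc intro!: sum.cong)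
  also have "\<dots> = (\<Sum>r<m. \<Sum>i<Suc (length As). \<Sum>s<m. of_rat (entries (A0 # As) i r s) * (?X i * w $ r * w $ s))"
    by (intro sum.cong refl sum.swap)
  also have "\<dots> = (\<Sum>i<Suc (length As). \<Sum>r<m. \<Sum>s<m. of_rat (entries (A0 # As) i r s) * (?X i * w $ r * w $ s))"
    by (rule sum.swap)
  finally show ?thesis .
qed

lemma lin_mat_transpose:
  assumes "\<forall>A\<in>set (A0 # As). sym_rat_mat m A"
  shows "(lin_mat m A0 As x)\<^sup>T = lin_mat m A0 As x"
proof -
  have sym: "A $$ (s, r) = A $$ (r, s)" if "A \<in> set (A0 # As)" "r < m" "s < m" for A r s
  proof -
    have "A \<in> carrier_mat m m" "A\<^sup>T = A" using assms that(1) by (auto simp: sym_rat_mat_def)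
    then show ?thesis using that(2,3) by (metis carrier_matD index_transpose_mat(1))
  qed
  have "(As ! i) $$ (s, r) = (As ! i) $$ (r, s)" if "i < length As" "r < m" "s < m" for i r s
    using sym[of "As ! i"] that by simp
  then show ?thesis
    using sym[of A0] by (intro eq_matI) (auto simp: lin_mat_def intro!: sum.cong)
qed

text \<open>Only the sizes are assumed, as only these are checked by the program. Symmetry stands on
  the right-hand side: it is one of the facts that a second-order point certifies.\<close>

lemma sop_iff_sdp:
  fixes As m
  defines "n \<equiv> Suc (length As)"
  assumes car: "\<forall>A\<in>set (A0 # As). A \<in> carrier_mat m m"
  shows "(\<exists>v. second_order_point (num_vars n m) (trilin (num_vars n m) (quads n m (entries (A0 # As)))) v) \<longleftrightarrow>
    (\<forall>A\<in>set (A0 # As). sym_rat_mat m A) \<and> (\<exists>x\<in>carrier_vec (length As). psd m (lin_mat m A0 As x))"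
    (is "?L \<longleftrightarrow> ?R")
proof
  let ?N = "num_vars n m"
  assume ?L
  then obtain v where v: "second_order_point ?N (trilin ?N (quads n m (entries (A0 # As)))) v" by blast
  note nec = sop_necessary[OF v]
  have sym: "\<forall>A\<in>set (A0 # As). sym_rat_mat m A"
  proof
    fix A assume A: "A \<in> set (A0 # As)"
    then obtain i where i: "i < n" "A = (A0 # As) ! i" by (metis in_set_conv_nth length_Cons n_def)
    have "A \<in> carrier_mat m m" using car A by blast
    moreover have "A\<^sup>T = A"
      using nec i calculation by (intro eq_matI) (auto simp: entries_def)
    ultimately show "sym_rat_mat m A" by (simp add: sym_rat_mat_def)
  qed
  define x where "x = vec (length As) (\<lambda>j. cv ?N v (vX n m (Suc j)))"
  have X: "cv ?N v (vX n m i) = (case i of 0 \<Rightarrow> 1 | Suc j \<Rightarrow> x $ j)" if "i < n" for i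
    using that by (cases i) (auto simp: x_def n_def vX_def cv_def)
  have "psd m (lin_mat m A0 As x)"
    unfolding psd_def
  proof (intro conjI ballI)
    show "lin_mat m A0 As x \<in> carrier_mat m m" by (simp add: lin_mat_def)
    show "(lin_mat m A0 As x)\<^sup>T = lin_mat m A0 As x" by (rule lin_mat_transpose[OF sym])
    fix w :: "real vec" assume w: "w \<in> carrier_vec m"
    have "0 \<le> (\<Sum>i<n. \<Sum>r<m. \<Sum>s<m. of_rat (entries (A0 # As) i r s) * (cv ?N v (vX n m i) * w $ r * w $ s))"
      using nec w by blast
    also have "\<dots> = w \<bullet> (lin_mat m A0 As x *\<^sub>v w)"
      unfolding lin_mat_form[OF w] n_def[symmetric] by (intro sum.cong refl) (simp add: X)
    finally show "0 \<le> w \<bullet> (lin_mat m A0 As x *\<^sub>v w)" .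
  qed
  moreover have "x \<in> carrier_vec (length As)" by (simp add: x_def)
  ultimately show ?R using sym by blast
next
  assume R: ?R
  then obtain x where sym: "\<forall>A\<in>set (A0 # As). sym_rat_mat m A" and x: "psd m (lin_mat m A0 As x)" by blast
  show ?L
  proof (rule sop_sufficient[where X = "\<lambda>i. case i of 0 \<Rightarrow> 1 | Suc j \<Rightarrow> x $ j"])
    fix i r s assume b: "i < n" "r < m" "s < m"
    have "sym_rat_mat m ((A0 # As) ! i)" using sym b(1) unfolding n_def by (metis length_Cons nth_mem)
    then have "(A0 # As) ! i \<in> carrier_mat m m" "((A0 # As) ! i)\<^sup>T = (A0 # As) ! i" by (auto simp: sym_rat_mat_def)
    then show "entries (A0 # As) i r s = entries (A0 # As) i s r"
      unfolding entries_def using b(2,3) by (metis carrier_matD index_transpose_mat(1))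
  next
    fix w :: "real vec" assume w: "w \<in> carrier_vec m"
    show "0 \<le> (\<Sum>i<n. \<Sum>r<m. \<Sum>s<m. of_rat (entries (A0 # As) i r s) * ((case i of 0 \<Rightarrow> 1 | Suc j \<Rightarrow> x $ j) * w $ r * w $ s))"
      unfolding n_def lin_mat_form[OF w, of A0 As x, symmetric] using x w unfolding psd_def by blast
  qed simp
qed

lemma mat_to_list_array:
  assumes "\<forall>A\<in>set As. A \<in> carrier_mat m m"
  shows "map mat_to_list As = array (length As) m (entries As)"
proof (rule nth_equalityI)
  fix i assume i: "i < length (map mat_to_list As)"
  then have "As ! i \<in> carrier_mat m m" using assms by simp
  then have d: "dim_row (As ! i) = m" "dim_col (As ! i) = m" by auto
  show "map mat_to_list As ! i = array (length As) m (entries As) ! i"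
    using i d by (simp add: mat_to_list_def array_def entries_def)
qed (simp add: array_def)

lemma sdp_poly:
  assumes car: "\<forall>A\<in>set (A0 # As). A \<in> carrier_mat m m"
  shows "enc_poly (num_vars (Suc (length As)) m) (poly_terms (Suc (length As)) m (map mat_to_list (A0 # As))) \<in> CUBIC_SOP \<longleftrightarrow>
    (\<forall>A\<in>set (A0 # As). sym_rat_mat m A) \<and> (\<exists>x\<in>carrier_vec (length As). psd m (lin_mat m A0 As x))"
proof -
  let ?n = "Suc (length As)"
  let ?N = "num_vars ?n m"
  let ?xs = "map mat_to_list (A0 # As)"
  have q: "poly_terms ?n m ?xs = map (quad_term ?N) (quads ?n m (entries (A0 # As)))"
    using mat_to_list_array[OF car] poly_terms_quads[of ?n m "entries (A0 # As)"] by simp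
  have ev: "eval_terms ?N (poly_terms ?n m ?xs) = trilin ?N (quads ?n m (entries (A0 # As)))"
    unfolding q by (rule ext) (rule eval_quad_terms)
  have "enc_poly ?N (poly_terms ?n m ?xs) \<in> CUBIC_SOP \<longleftrightarrow> (\<exists>x. second_order_point ?N (eval_terms ?N (poly_terms ?n m ?xs)) x)"
  proof
    assume "enc_poly ?N (poly_terms ?n m ?xs) \<in> CUBIC_SOP"
    then obtain N' ps where *: "enc_poly ?N (poly_terms ?n m ?xs) = enc_poly N' ps" "\<exists>x. second_order_point N' (eval_terms N' ps) x"
      unfolding CUBIC_SOP_def by blast
    \<comment> \<open>Membership in the language merely provides some polynomial with this encoding;
      unique readability shows that it is the intended one.\<close>
    from *(1) have "reduction ?n m (map (map (map raw_of)) ?xs) = enc_poly N' ps" unfolding reduction_poly .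
    from reduction_is_poly[OF this] obtain ys where ys: "map (map (map raw_of)) ?xs = map (map (map raw_of)) ys"
      "N' = ?N" "ps = poly_terms ?n m ys" by blast
    have "?xs = ys" using ys(1) raw_of_inj by (metis inj_map_eq_map inj_mapI)
    with ys *(2) show "\<exists>x. second_order_point ?N (eval_terms ?N (poly_terms ?n m ?xs)) x" by simp
  next
    assume "\<exists>x. second_order_point ?N (eval_terms ?N (poly_terms ?n m ?xs)) x"
    moreover have "cubic_terms ?N (poly_terms ?n m ?xs)" unfolding q by (rule cubic_quad_terms)
    ultimately show "enc_poly ?N (poly_terms ?n m ?xs) \<in> CUBIC_SOP" unfolding CUBIC_SOP_def by blast
  qed
  then show ?thesis unfolding ev sop_iff_sdp[OF car] .
qed

text \<open>The raw input may still contain non-canonical numbers and asymmetric matrices. Then it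
  lies outside \<open>SDPF\<close>, and its image lies outside \<open>CUBIC_SOP\<close>: in the
  first case it encodes no polynomial, in the second the polynomial has no second-order
  point.\<close>

lemma SDPF_iff:
  assumes w: "w = concat (map code (all_syms xs))" and xs: "xs \<noteq> []" "\<forall>x\<in>set xs. square (length (hd xs)) x"
  shows "w \<in> SDPF \<longleftrightarrow> reduction (length xs) (length (hd xs)) xs \<in> CUBIC_SOP"
proof
  assume "w \<in> SDPF"
  then obtain m A0 As where wA: "w = enc_list enc_mat (A0 # As)" and sym: "\<forall>A\<in>set (A0 # As). sym_rat_mat m A"
    and x: "\<exists>x\<in>carrier_vec (length As). psd m (lin_mat m A0 As x)"
    unfolding SDPF_def by blast
  have car: "\<forall>A\<in>set (A0 # As). A \<in> carrier_mat m m" using sym by (auto simp: sym_rat_mat_def)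
  from wA w have xs_eq: "xs = map (\<lambda>A. map (map raw_of) (mat_to_list A)) (A0 # As)"
    unfolding enc_sdp by (intro code_all_inj) simp
  then have "length xs = Suc (length As)" "xs = map (map (map raw_of)) (map mat_to_list (A0 # As))" by simp_all
  moreover have "length (hd xs) = m" using xs_eq car by (auto simp: mat_to_list_def)
  ultimately show "reduction (length xs) (length (hd xs)) xs \<in> CUBIC_SOP"
    using sdp_poly[OF car] sym x by (simp only: reduction_poly)
next
  let ?n = "length xs" and ?m = "length (hd xs)"
  assume r: "reduction ?n ?m xs \<in> CUBIC_SOP"
  then obtain N ps where "reduction ?n ?m xs = enc_poly N ps" unfolding CUBIC_SOP_def by blast
  \<comment> \<open>Here the digits of the input turn out to be canonical, so that there are
    rational matrices to speak of.\<close>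
  from reduction_is_poly[OF this] obtain ys where ys: "xs = map (map (map raw_of)) ys" by blast
  define As where "As = map (mat_of_rows_list ?m) ys"
  have sq: "length y = ?m \<and> (\<forall>z\<in>set y. length z = ?m)" if "y \<in> set ys" for y
    using xs(2) that unfolding ys by (auto simp: square_def)
  have ml: "map mat_to_list As = ys"
    unfolding As_def map_map
  proof (rule map_idI)
    fix y assume y: "y \<in> set ys"
    show "(mat_to_list \<circ> mat_of_rows_list ?m) y = y"
      using sq[OF y] by (auto simp: mat_to_list_def mat_of_rows_list_def intro!: nth_equalityI)
  qed
  have "As \<noteq> []" using xs(1) ys by (auto simp: As_def)
  then obtain A0 As' where As: "As = A0 # As'" by (cases As) auto
  have car: "\<forall>A\<in>set (A0 # As'). A \<in> carrier_mat ?m ?m"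
    unfolding As[symmetric] As_def using sq by (auto simp: mat_of_rows_list_def)
  have n: "?n = Suc (length As')" using arg_cong[OF ml, of length] ys As by simp
  have wA: "w = enc_list enc_mat (A0 # As')"
    unfolding enc_sdp w ys ml[symmetric] As by (simp add: o_def)
  have "reduction ?n ?m xs = enc_poly (num_vars (Suc (length As')) ?m) (poly_terms (Suc (length As')) ?m (map mat_to_list (A0 # As')))"
    unfolding n[symmetric] As[symmetric] ml using reduction_poly[of ?n ?m ys] ys by metis
  with r have "(\<forall>A\<in>set (A0 # As'). sym_rat_mat ?m A) \<and> (\<exists>x\<in>carrier_vec (length As'). psd ?m (lin_mat ?m A0 As' x))"
    using sdp_poly[OF car] by simp
  with wA show "w \<in> SDPF" unfolding SDPF_def by blast
qed

lemma SDPF_form: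
  assumes "w \<in> SDPF"
  shows "\<exists>xs. w = concat (map code (all_syms xs)) \<and> xs \<noteq> [] \<and> (\<forall>x\<in>set xs. square (length (hd xs)) x)"
proof -
  from assms obtain m A0 As where wA: "w = enc_list enc_mat (A0 # As)" and sym: "\<forall>A\<in>set (A0 # As). sym_rat_mat m A"
    unfolding SDPF_def by blast
  have car: "dim_row A = m" "dim_col A = m" if "A \<in> set (A0 # As)" for A using sym that by (auto simp: sym_rat_mat_def)
  let ?xs = "map (\<lambda>A. map (map raw_of) (mat_to_list A)) (A0 # As)"
  have "length (hd ?xs) = m" using car[of A0] by (simp add: mat_to_list_def)
  moreover have "\<forall>x\<in>set ?xs. square m x" using car by (auto simp: square_def mat_to_list_def)
  ultimately show ?thesis using wA unfolding enc_sdp by (intro exI[of _ ?xs]) simp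
qed

lemma reduction_run:
  "\<exists>n \<le> poly time_poly (length w). exec reduce_prog (init_store w) n None \<and> w \<notin> SDPF \<or>
    (\<exists>\<sigma> v. exec reduce_prog (init_store w) n (Some \<sigma>) \<and> \<sigma> Out = input_tape v \<and> (w \<in> SDPF \<longleftrightarrow> v \<in> CUBIC_SOP))"
proof (cases "\<exists>xs. w = concat (map code (all_syms xs)) \<and> xs \<noteq> [] \<and> (\<forall>x\<in>set xs. square (length (hd xs)) x)")
  case True
  then obtain xs where xs: "w = concat (map code (all_syms xs))" "xs \<noteq> []" "\<forall>x\<in>set xs. square (length (hd xs)) x" by blast
  from run_reduce_prog[OF this] SDPF_iff[OF this] show ?thesis unfolding run_def by blast
next
  case False
  then have "run reduce_prog (init_store w) (poly time_poly (length w)) None"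
    by (intro run_reduce_prog_stuck) blast
  moreover have "w \<notin> SDPF" using False SDPF_form by blast
  ultimately show ?thesis unfolding run_def by blast
qed

theorem theorem5p3:
  shows "(CUBIC_SOP \<in> class_P \<longrightarrow> SDPF \<in> class_P) \<and> (CUBIC_SOP \<in> class_NP \<longrightarrow> SDPF \<in> class_NP)"
proof -
  \<comment> \<open>The alphabet \<open>0, ..., 12\<close> consists of the blank, the two bits and
    the brackets of all depths.\<close>
  let ?M' = "prefix_tm 13 (compile reduce_prog 0 (len reduce_prog))"
  have dec: "decides_in_polytime (?M' M) SDPF" if "wf_tm M" "decides_in_polytime M CUBIC_SOP" for M
    by (rule polytime_reduction[OF that bounded_reduce_prog _ reduction_run]) simp
  show ?thesis
    unfolding class_P_def class_NP_def using dec wf_prefix_tm deterministic_prefix_tm by blast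
qed

end
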